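(* Let $D_{2n}=\langle s,t\mid s^2=t^2=(st)^n=e\rangle$ be the dihedral group with this presentation, with generating set $S=\{s,t\}$. Then its quantum isometry group $\mathbb Q(D_{2n},S)$ is isomorphic, as a compact quantum group, to $\mathcal D_\theta(C^*(D_{2n}),\Delta_{D_{2n}})$ with respect to the automorphism $\theta$ given by $\theta(s)=t$, $\theta(t)=s$.
   Context: A compact quantum group (CQG) is a unital $C^*$-algebra $\mathcal Q$ with a coassociative unital $*$-homomorphism $\Delta:\mathcal Q\to\mathcal Q\hat\otimes\mathcal Q$ ($\hat\otimes$ the spatial tensor product) such that the linear spans of $\Delta(\mathcal Q)(1\otimes\mathcal Q)$ and $\Delta(\mathcal Q)(\mathcal Q\otimes 1)$ are norm-dense. A CQG morphism is a unital $*$-homomorphism intertwining the coproducts. An action of $\mathcal Q$ on a unital $C^*$-algebra $B$ is a unital $*$-homomorphism $\alpha:B\to B\hat\otimes\mathcal Q$ with $(\alpha\otimes id)\alpha=(id\otimes\Delta)\alpha$ and with the linear span of $\alpha(B)(1\otimes\mathcal Q)$ dense in $B\hat\otimes\mathcal Q$. Let $\Gamma$ be a discrete group with finite symmetric generating set $S$ ($a\in S\Rightarrow a^{-1}\in S$, elements of order 2 listed once), with word length $l$, canonical unitaries $\lambda_g\in C^*_r(\Gamma)$ and canonical trace $\tau$. $\mathbb Q(\Gamma,S)$ denotes the quantum isometry group $QISO^+(\mathbb C\Gamma,\ell^2(\Gamma),D_\Gamma)$ of the spectral triple with $D_\Gamma\delta_g=l(g)\delta_g$. Equivalently it is the universal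 object in the category of pairs $(\mathcal Q,\alpha)$ where $\mathcal Q$ is a CQG and $\alpha$ is a $\tau$-preserving action of $\mathcal Q$ on $C^*_r(\Gamma)$ mapping $\mathrm{span}\{\lambda_g:l(g)=r\}$ into $\mathrm{span}\{\lambda_g:l(g)=r\}\otimes\mathcal Q$ for every $r\ge0$ (morphisms are CQG morphisms intertwining the actions; universality means that for every object there is a unique morphism from $\mathbb Q(\Gamma,S)$ to it). $(C^*(\Gamma),\Delta_\Gamma)$ is the full group $C^*$-algebra with $\Delta_\Gamma(\lambda_g)=\lambda_g\otimes\lambda_g$; a group automorphism of $\Gamma$ induces a CQG automorphism of it, denoted by the same symbol. Doubling: for a CQG $(\mathcal Q,\Delta)$ with CQG automorphism $\theta$, $\theta^2=id$, the doubling $\mathcal D_\theta(\mathcal Q,\Delta)$ is the $C^*$-algebra $\mathcal Q\oplus\mathcal Q$ with coproduct $\tilde\Delta$ determined by $\tilde\Delta\circ\xi=(\xi\otimes\xi+\eta\otimes[\eta\circ\theta])\circ\Delta$ and $\tilde\Delta\circ\eta=(\xi\otimes\eta+\eta\otimes[\xi\circ\theta])\circ\Delta$, where $\xi(a)=(a,0)$ and $\eta(a)=(0,a)$.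
   Formalization: Stated for n ≥ 3: for n = 1 (group Z_2) the quantum isometry group has dimension 2 but the doubling has dimension 4, and for n = 2 it is the noncommutative O_2^{-1} while the doubling is commutative, so the claim fails there. *)

theory Defs
  imports
    "HOL-Analysis.Infinite_Sum"
    "HOL-Analysis.L2_Norm"
    "HOL-Algebra.Group"
    "HOL-Library.Function_Algebras"
begin

section \<open>Bounded operators on \<open>\<ell>\<^sup>2(I)\<close>\<close>

text \<open>
  An operator on the Hilbert space \<open>\<ell>\<^sup>2('i)\<close> is given by its matrix
  \<open>a i j = \<langle>\<delta>\<^sub>i, a \<delta>\<^sub>j\<rangle>\<close>. Sum, difference and zero are those of
  \<^theory>\<open>HOL-Library.Function_Algebras\<close>; the multiplication of that theory is
  entrywise and is not used, composition of operators is \<open>op_mult\<close>.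
\<close>

type_synonym 'i l2op = "'i \<Rightarrow> 'i \<Rightarrow> complex"

definition op_scale :: "complex \<Rightarrow> 'i l2op \<Rightarrow> 'i l2op" where
  "op_scale c a = (\<lambda>i j. c * a i j)"

global_interpretation l2op: vector_space op_scale
  by unfold_locales (auto simp: op_scale_def fun_eq_iff algebra_simps)

definition op_mult :: "'i l2op \<Rightarrow> 'i l2op \<Rightarrow> 'i l2op" where
  "op_mult a b = (\<lambda>i j. \<Sum>\<^sub>\<infinity>k. a i k * b k j)"

definition op_adj :: "'i l2op \<Rightarrow> 'i l2op" where
  "op_adj a = (\<lambda>i j. cnj (a j i))"

definition op_id :: "'i l2op" where
  "op_id = (\<lambda>i j. of_bool (i = j))"

text \<open>
  \<open>op_norm_le a r\<close> says that \<open>a\<close> is the matrix of a bounded operator of norm at most \<open>r\<close>: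
  \<open>\<bar>\<langle>y, a x\<rangle>\<bar> \<le> r * \<parallel>y\<parallel> * \<parallel>x\<parallel>\<close> for all finitely supported \<open>x\<close>, \<open>y\<close>, which form a dense
  subspace of \<open>\<ell>\<^sup>2('i)\<close>.
\<close>

definition op_norm_le :: "'i l2op \<Rightarrow> real \<Rightarrow> bool" where
  "op_norm_le a r \<longleftrightarrow> r \<ge> 0 \<and>
     (\<forall>F x y. finite F \<longrightarrow>
        cmod (\<Sum>i\<in>F. \<Sum>j\<in>F. cnj (y i) * a i j * x j)
          \<le> r * L2_set (\<lambda>i. cmod (y i)) F * L2_set (\<lambda>j. cmod (x j)) F)"

definition bounded_op :: "'i l2op \<Rightarrow> bool" where
  "bounded_op a \<longleftrightarrow> (\<exists>r. op_norm_le a r)"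

definition norm_closure :: "'i l2op set \<Rightarrow> 'i l2op set" where
  "norm_closure X = {a. \<forall>\<epsilon>>0. \<exists>b\<in>X. op_norm_le (a - b) \<epsilon>}"

definition op_tensor :: "'i l2op \<Rightarrow> 'j l2op \<Rightarrow> ('i \<times> 'j) l2op" where
  "op_tensor a b = (\<lambda>p q. a (fst p) (fst q) * b (snd p) (snd q))"

text \<open>The identification of \<open>(H \<otimes> K) \<otimes> L\<close> with \<open>H \<otimes> (K \<otimes> L)\<close>.\<close>

definition op_assoc :: "(('i \<times> 'j) \<times> 'k) l2op \<Rightarrow> ('i \<times> ('j \<times> 'k)) l2op" where
  "op_assoc a = (\<lambda>(i, j, k) (i', j', k'). a ((i, j), k) ((i', j'), k'))"


section \<open>Unital C*-algebras\<close>

text \<open>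
  By the Gelfand--Naimark theorem every unital C*-algebra is isomorphic to a norm-closed
  *-algebra of operators on some \<open>\<ell>\<^sup>2('i)\<close>. The unit is a projection, but need not be
  the identity operator.
\<close>

definition unital_cstar_algebra :: "'i l2op set \<Rightarrow> bool" where
  "unital_cstar_algebra A \<longleftrightarrow>
     (\<forall>a\<in>A. bounded_op a) \<and>
     l2op.subspace A \<and>
     (\<forall>a\<in>A. \<forall>b\<in>A. op_mult a b \<in> A) \<and>
     (\<forall>a\<in>A. op_adj a \<in> A) \<and>
     norm_closure A \<subseteq> A \<and>
     (\<exists>e\<in>A. \<forall>a\<in>A. op_mult e a = a \<and> op_mult a e = a)"

definition alg_unit :: "'i l2op set \<Rightarrow> 'i l2op" where
  "alg_unit A = (THE e. e \<in> A \<and> (\<forall>a\<in>A. op_mult e a = a \<and> op_mult a e = a))"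

definition star_hom :: "'i l2op set \<Rightarrow> 'j l2op set \<Rightarrow> ('i l2op \<Rightarrow> 'j l2op) \<Rightarrow> bool" where
  "star_hom A B \<phi> \<longleftrightarrow>
     (\<forall>a\<in>A. \<phi> a \<in> B) \<and>
     (\<forall>a\<in>A. \<forall>b\<in>A. \<phi> (a + b) = \<phi> a + \<phi> b) \<and>
     (\<forall>c. \<forall>a\<in>A. \<phi> (op_scale c a) = op_scale c (\<phi> a)) \<and>
     (\<forall>a\<in>A. \<forall>b\<in>A. \<phi> (op_mult a b) = op_mult (\<phi> a) (\<phi> b)) \<and>
     (\<forall>a\<in>A. \<phi> (op_adj a) = op_adj (\<phi> a))"

definition unital_star_hom :: "'i l2op set \<Rightarrow> 'j l2op set \<Rightarrow> ('i l2op \<Rightarrow> 'j l2op) \<Rightarrow> bool" where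
  "unital_star_hom A B \<phi> \<longleftrightarrow> star_hom A B \<phi> \<and> \<phi> (alg_unit A) = alg_unit B"

definition spatial_tensor :: "'i l2op set \<Rightarrow> 'j l2op set \<Rightarrow> ('i \<times> 'j) l2op set" where
  "spatial_tensor A B = norm_closure (l2op.span {op_tensor a b | a b. a \<in> A \<and> b \<in> B})"

text \<open>
  \<open>tensor_hom A B C D \<phi> \<psi> F\<close> says that \<open>F\<close> is the *-homomorphism \<open>\<phi> \<otimes> \<psi>\<close> from the spatial
  tensor product of \<open>A\<close> and \<open>B\<close> to that of \<open>C\<close> and \<open>D\<close>. For *-homomorphisms \<open>\<phi>\<close>, \<open>\<psi>\<close>
  such an \<open>F\<close> exists, and it is unique on the spatial tensor product because *-homomorphisms
  of C*-algebras are continuous.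
\<close>

definition tensor_hom ::
  "'i l2op set \<Rightarrow> 'j l2op set \<Rightarrow> 'k l2op set \<Rightarrow> 'l l2op set \<Rightarrow>
   ('i l2op \<Rightarrow> 'k l2op) \<Rightarrow> ('j l2op \<Rightarrow> 'l l2op) \<Rightarrow> (('i \<times> 'j) l2op \<Rightarrow> ('k \<times> 'l) l2op) \<Rightarrow> bool" where
  "tensor_hom A B C D \<phi> \<psi> F \<longleftrightarrow>
     star_hom (spatial_tensor A B) (spatial_tensor C D) F \<and>
     (\<forall>a\<in>A. \<forall>b\<in>B. F (op_tensor a b) = op_tensor (\<phi> a) (\<psi> b))"

definition tensor_map ::
  "'i l2op set \<Rightarrow> 'j l2op set \<Rightarrow> 'k l2op set \<Rightarrow> 'l l2op set \<Rightarrow>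
   ('i l2op \<Rightarrow> 'k l2op) \<Rightarrow> ('j l2op \<Rightarrow> 'l l2op) \<Rightarrow> ('i \<times> 'j) l2op \<Rightarrow> ('k \<times> 'l) l2op" where
  "tensor_map A B C D \<phi> \<psi> = (SOME F. tensor_hom A B C D \<phi> \<psi> F)"


section \<open>Compact quantum groups and their actions\<close>

record 'i cqg =
  alg :: "'i l2op set"
  comult :: "'i l2op \<Rightarrow> ('i \<times> 'i) l2op"

definition compact_quantum_group :: "'i cqg \<Rightarrow> bool" where
  "compact_quantum_group Q \<longleftrightarrow>
     (let A = alg Q; \<Delta> = comult Q; AA = spatial_tensor A A in
       unital_cstar_algebra A \<and>
       unital_star_hom A AA \<Delta> \<and>
       (\<exists>F G. tensor_hom A A AA A \<Delta> (\<lambda>x. x) F \<and> tensor_hom A A A AA (\<lambda>x. x) \<Delta> G \<and>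
          (\<forall>a\<in>A. op_assoc (F (\<Delta> a)) = G (\<Delta> a))) \<and>
       AA \<subseteq> norm_closure (l2op.span
         {op_mult (\<Delta> a) (op_tensor (alg_unit A) b) | a b. a \<in> A \<and> b \<in> A}) \<and>
       AA \<subseteq> norm_closure (l2op.span
         {op_mult (\<Delta> a) (op_tensor b (alg_unit A)) | a b. a \<in> A \<and> b \<in> A}))"

definition cqg_morphism :: "'i cqg \<Rightarrow> 'j cqg \<Rightarrow> ('i l2op \<Rightarrow> 'j l2op) \<Rightarrow> bool" where
  "cqg_morphism Q R \<phi> \<longleftrightarrow>
     unital_star_hom (alg Q) (alg R) \<phi> \<and>
     (\<exists>F. tensor_hom (alg Q) (alg Q) (alg R) (alg R) \<phi> \<phi> F \<and>
        (\<forall>a\<in>alg Q. F (comult Q a) = comult R (\<phi> a)))"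

definition cqg_isomorphic :: "'i cqg \<Rightarrow> 'j cqg \<Rightarrow> bool" where
  "cqg_isomorphic Q R \<longleftrightarrow>
     (\<exists>\<phi> \<psi>. cqg_morphism Q R \<phi> \<and> cqg_morphism R Q \<psi> \<and>
        (\<forall>a\<in>alg Q. \<psi> (\<phi> a) = a) \<and> (\<forall>b\<in>alg R. \<phi> (\<psi> b) = b))"

definition cqg_action :: "'b l2op set \<Rightarrow> 'i cqg \<Rightarrow> ('b l2op \<Rightarrow> ('b \<times> 'i) l2op) \<Rightarrow> bool" where
  "cqg_action B Q \<alpha> \<longleftrightarrow>
     (let A = alg Q; \<Delta> = comult Q; BA = spatial_tensor B A in
       unital_star_hom B BA \<alpha> \<and>
       (\<exists>F G. tensor_hom B A BA A \<alpha> (\<lambda>x. x) F \<and>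
          tensor_hom B A B (spatial_tensor A A) (\<lambda>x. x) \<Delta> G \<and>
          (\<forall>b\<in>B. op_assoc (F (\<alpha> b)) = G (\<alpha> b))) \<and>
       BA \<subseteq> norm_closure (l2op.span
         {op_mult (\<alpha> b) (op_tensor (alg_unit B) q) | b q. b \<in> B \<and> q \<in> A}))"


section \<open>Doubling\<close>

definition inl_op :: "'i l2op \<Rightarrow> ('i + 'i) l2op" where
  "inl_op a = (\<lambda>p q. case (p, q) of (Inl i, Inl j) \<Rightarrow> a i j | _ \<Rightarrow> 0)"

definition inr_op :: "'i l2op \<Rightarrow> ('i + 'i) l2op" where
  "inr_op a = (\<lambda>p q. case (p, q) of (Inr i, Inr j) \<Rightarrow> a i j | _ \<Rightarrow> 0)"

definition direct_sum :: "'i l2op set \<Rightarrow> ('i + 'i) l2op set" where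
  "direct_sum A = {inl_op a + inr_op b | a b. a \<in> A \<and> b \<in> A}"

text \<open>
  \<open>inl_op\<close> and \<open>inr_op\<close> are the embeddings \<open>\<xi>\<close> and \<open>\<eta>\<close>; in the coproduct, \<open>a\<close> and \<open>b\<close> are the
  two components of \<open>x = \<xi> a + \<eta> b\<close>.
\<close>

definition doubling :: "'i cqg \<Rightarrow> ('i l2op \<Rightarrow> 'i l2op) \<Rightarrow> ('i + 'i) cqg" where
  "doubling Q \<theta> =
     (let A = alg Q; \<Delta> = comult Q; \<xi> = inl_op; \<eta> = inr_op;
          T = tensor_map A A (direct_sum A) (direct_sum A) in
      \<lparr>alg = direct_sum A,
       comult = (\<lambda>x. let a = (\<lambda>i j. x (Inl i) (Inl j)); b = (\<lambda>i j. x (Inr i) (Inr j)) in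
         (T \<xi> \<xi> (\<Delta> a) + T \<eta> (\<eta> \<circ> \<theta>) (\<Delta> a)) +
         (T \<xi> \<eta> (\<Delta> b) + T \<eta> (\<xi> \<circ> \<theta>) (\<Delta> b)))\<rparr>)"


section \<open>Group C*-algebras\<close>

subsection \<open>The reduced group C*-algebra\<close>

text \<open>
  The canonical unitaries of the left regular representation. \<open>\<ell>\<^sup>2(G)\<close> is the subspace of
  \<open>\<ell>\<^sup>2('g)\<close> spanned by \<open>\<delta>\<^sub>h\<close> for \<open>h\<close> in the carrier.
\<close>

definition left_regular :: "('g, 'm) monoid_scheme \<Rightarrow> 'g \<Rightarrow> 'g l2op" where
  "left_regular G g = (\<lambda>h k. of_bool (h \<in> carrier G \<and> k \<in> carrier G \<and> h = g \<otimes>\<^bsub>G\<^esub> k))"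

definition reduced_group_cstar :: "('g, 'm) monoid_scheme \<Rightarrow> 'g l2op set" where
  "reduced_group_cstar G = norm_closure (l2op.span (left_regular G ` carrier G))"

definition canonical_trace :: "('g, 'm) monoid_scheme \<Rightarrow> 'g l2op \<Rightarrow> complex" where
  "canonical_trace G x = x \<one>\<^bsub>G\<^esub> \<one>\<^bsub>G\<^esub>"

text \<open>
  The slice map \<open>\<tau> \<otimes> id\<close>, for \<open>\<tau>\<close> the canonical trace, which is the vector state at \<open>\<delta>\<^sub>e\<close>.
\<close>

definition trace_slice :: "('g, 'm) monoid_scheme \<Rightarrow> ('g \<times> 'i) l2op \<Rightarrow> 'i l2op" where
  "trace_slice G x = (\<lambda>i j. x (\<one>\<^bsub>G\<^esub>, i) (\<one>\<^bsub>G\<^esub>, j))"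

subsection \<open>The full group C*-algebra\<close>

definition unitary_rep :: "('g, 'm) monoid_scheme \<Rightarrow> ('g \<Rightarrow> 'k l2op) \<Rightarrow> bool" where
  "unitary_rep G \<pi> \<longleftrightarrow>
     \<pi> \<one>\<^bsub>G\<^esub> = op_id \<and>
     (\<forall>g\<in>carrier G. bounded_op (\<pi> g) \<and> op_adj (\<pi> g) = \<pi> (inv\<^bsub>G\<^esub> g)) \<and>
     (\<forall>g\<in>carrier G. \<forall>h\<in>carrier G. \<pi> (g \<otimes>\<^bsub>G\<^esub> h) = op_mult (\<pi> g) (\<pi> h))"

text \<open>
  The direct sum of all unitary representations of \<open>G\<close> on \<open>\<ell>\<^sup>2(nat)\<close>. The norm of a linear
  combination of the operators \<open>universal_rep G g\<close> is the supremum of its norms in these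
  representations. For countable \<open>G\<close> this is the norm of the full group C*-algebra: a cyclic
  representation of a countable group is separable, and its countable multiple acts on
  \<open>\<ell>\<^sup>2(nat)\<close>.
\<close>

definition universal_rep :: "('g, 'm) monoid_scheme \<Rightarrow> 'g \<Rightarrow> (('g \<Rightarrow> nat l2op) \<times> nat) l2op" where
  "universal_rep G g =
     (\<lambda>(\<pi>, i) (\<rho>, j). if \<pi> = \<rho> \<and> unitary_rep G \<pi> then \<pi> g i j else 0)"

definition full_group_cstar :: "('g, 'm) monoid_scheme \<Rightarrow> (('g \<Rightarrow> nat l2op) \<times> nat) l2op set" where
  "full_group_cstar G = norm_closure (l2op.span (universal_rep G ` carrier G))"

definition full_group_cqg :: "('g, 'm) monoid_scheme \<Rightarrow> (('g \<Rightarrow> nat l2op) \<times> nat) cqg" where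
  "full_group_cqg G =
     \<lparr>alg = full_group_cstar G,
      comult = (SOME \<Delta>.
        unital_star_hom (full_group_cstar G)
          (spatial_tensor (full_group_cstar G) (full_group_cstar G)) \<Delta> \<and>
        (\<forall>g\<in>carrier G. \<Delta> (universal_rep G g) = op_tensor (universal_rep G g) (universal_rep G g)))\<rparr>"

definition full_group_map ::
  "('g, 'm) monoid_scheme \<Rightarrow> ('g \<Rightarrow> 'g) \<Rightarrow>
   (('g \<Rightarrow> nat l2op) \<times> nat) l2op \<Rightarrow> (('g \<Rightarrow> nat l2op) \<times> nat) l2op" where
  "full_group_map G \<theta> =
     (SOME \<phi>. unital_star_hom (full_group_cstar G) (full_group_cstar G) \<phi> \<and>
        (\<forall>g\<in>carrier G. \<phi> (universal_rep G g) = universal_rep G (\<theta> g)))"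


section \<open>The quantum isometry group of a group dual\<close>

definition word_length :: "('g, 'm) monoid_scheme \<Rightarrow> 'g set \<Rightarrow> 'g \<Rightarrow> nat" where
  "word_length G S g =
     (LEAST r. \<exists>ws. length ws = r \<and> set ws \<subseteq> S \<and> foldr (\<otimes>\<^bsub>G\<^esub>) ws \<one>\<^bsub>G\<^esub> = g)"

definition length_preserving_action ::
  "('g, 'm) monoid_scheme \<Rightarrow> 'g set \<Rightarrow> 'i cqg \<Rightarrow> ('g l2op \<Rightarrow> ('g \<times> 'i) l2op) \<Rightarrow> bool" where
  "length_preserving_action G S Q \<alpha> \<longleftrightarrow>
     compact_quantum_group Q \<and>
     cqg_action (reduced_group_cstar G) Q \<alpha> \<and>
     (\<forall>x\<in>reduced_group_cstar G.
        trace_slice G (\<alpha> x) = op_scale (canonical_trace G x) (alg_unit (alg Q))) \<and>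
     (\<forall>r. \<forall>x\<in>l2op.span {left_regular G g | g. g \<in> carrier G \<and> word_length G S g = r}.
        \<alpha> x \<in> l2op.span {op_tensor (left_regular G g) q | g q.
                  g \<in> carrier G \<and> word_length G S g = r \<and> q \<in> alg Q})"

definition action_morphism ::
  "'b l2op set \<Rightarrow> 'i cqg \<Rightarrow> ('b l2op \<Rightarrow> ('b \<times> 'i) l2op) \<Rightarrow>
   'j cqg \<Rightarrow> ('b l2op \<Rightarrow> ('b \<times> 'j) l2op) \<Rightarrow> ('i l2op \<Rightarrow> 'j l2op) \<Rightarrow> bool" where
  "action_morphism B Q \<alpha> R \<beta> \<phi> \<longleftrightarrow>
     cqg_morphism Q R \<phi> \<and>
     (\<exists>F. tensor_hom B (alg Q) B (alg R) (\<lambda>x. x) \<phi> F \<and> (\<forall>b\<in>B. F (\<alpha> b) = \<beta> b))"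

text \<open>
  The universal object among the objects realised on \<open>\<ell>\<^sup>2('i)\<close>, where \<open>'i\<close> is any infinite type.
  (HOL cannot quantify over all types inside a definition; a statement that is polymorphic
  in \<open>'i\<close> covers all Hilbert spaces.) Maps are compared on the carrier only.
\<close>

definition quantum_isometry_group ::
  "('g, 'm) monoid_scheme \<Rightarrow> 'g set \<Rightarrow> 'i cqg \<Rightarrow> ('g l2op \<Rightarrow> ('g \<times> 'i) l2op) \<Rightarrow> bool" where
  "quantum_isometry_group G S Q \<alpha> \<longleftrightarrow>
     length_preserving_action G S Q \<alpha> \<and>
     (\<forall>(R :: 'i cqg) \<beta>. length_preserving_action G S R \<beta> \<longrightarrow>
        (\<exists>\<phi>. action_morphism (reduced_group_cstar G) Q \<alpha> R \<beta> \<phi> \<and>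
           (\<forall>\<psi>. action_morphism (reduced_group_cstar G) Q \<alpha> R \<beta> \<psi> \<longrightarrow>
              (\<forall>a\<in>alg Q. \<psi> a = \<phi> a))))"


section \<open>Groups given by presentations\<close>

text \<open>
  Words over the generators \<open>'x\<close>: the letter \<open>(x, True)\<close> stands for \<open>x\<close> and \<open>(x, False)\<close> for
  its inverse.
\<close>

inductive word_equiv :: "('x \<times> bool) list set \<Rightarrow> ('x \<times> bool) list \<Rightarrow> ('x \<times> bool) list \<Rightarrow> bool"
  for R where
  refl: "word_equiv R u u"
| sym: "word_equiv R u v \<Longrightarrow> word_equiv R v u"
| trans: "word_equiv R u v \<Longrightarrow> word_equiv R v w \<Longrightarrow> word_equiv R u w"
| cancel: "word_equiv R (u @ [(x, b), (x, \<not> b)] @ v) (u @ v)"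
| relator: "r \<in> R \<Longrightarrow> word_equiv R (u @ r @ v) (u @ v)"

definition word_rel :: "('x \<times> bool) list set \<Rightarrow> (('x \<times> bool) list \<times> ('x \<times> bool) list) set" where
  "word_rel R = {(u, v). word_equiv R u v}"

definition presented_group :: "('x \<times> bool) list set \<Rightarrow> ('x \<times> bool) list set monoid" where
  "presented_group R =
     \<lparr>carrier = UNIV // word_rel R,
      mult = (\<lambda>A B. \<Union>u\<in>A. \<Union>v\<in>B. word_rel R `` {u @ v}),
      one = word_rel R `` {[]}\<rparr>"

datatype dihedral_gen = Gen_s | Gen_t

definition dihedral_relators :: "nat \<Rightarrow> (dihedral_gen \<times> bool) list set" where
  "dihedral_relators n =
     {[(Gen_s, True), (Gen_s, True)],
      [(Gen_t, True), (Gen_t, True)],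
      concat (replicate n [(Gen_s, True), (Gen_t, True)])}"

text \<open>The dihedral group of order \<open>2 * n\<close>.\<close>

definition dihedral :: "nat \<Rightarrow> (dihedral_gen \<times> bool) list set monoid" where
  "dihedral n = presented_group (dihedral_relators n)"

definition dih_s :: "nat \<Rightarrow> (dihedral_gen \<times> bool) list set" where
  "dih_s n = word_rel (dihedral_relators n) `` {[(Gen_s, True)]}"

definition dih_t :: "nat \<Rightarrow> (dihedral_gen \<times> bool) list set" where
  "dih_t n = word_rel (dihedral_relators n) `` {[(Gen_t, True)]}"

fun swap_gen :: "dihedral_gen \<Rightarrow> dihedral_gen" where
  "swap_gen Gen_s = Gen_t"
| "swap_gen Gen_t = Gen_s"

text \<open>
  Exchanging the letters \<open>s\<close> and \<open>t\<close> in all words of an equivalence class; by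
  \<open>dihedral_swap_iso\<close> below this is the automorphism with \<open>s \<mapsto> t\<close> and \<open>t \<mapsto> s\<close>.
\<close>

definition swap_word :: "(dihedral_gen \<times> bool) list \<Rightarrow> (dihedral_gen \<times> bool) list" where
  "swap_word = map (\<lambda>(x, b). (swap_gen x, b))"

definition dihedral_swap ::
  "(dihedral_gen \<times> bool) list set \<Rightarrow> (dihedral_gen \<times> bool) list set" where
  "dihedral_swap X = swap_word ` X"

lemma equiv_word_rel: "equiv UNIV (word_rel R)"
proof (rule equivI)
  show "refl_on UNIV (word_rel R)"
    by (simp add: refl_on_def word_rel_def word_equiv.refl)
  show "sym (word_rel R)"
    unfolding sym_def word_rel_def by (simp add: word_equiv.sym)
  show "trans (word_rel R)"
    unfolding trans_def word_rel_def using word_equiv.trans by blast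
qed simp

lemma word_equiv_context: "word_equiv R u v \<Longrightarrow> word_equiv R (p @ u @ q) (p @ v @ q)"
proof (induction rule: word_equiv.induct)
  case (cancel u x b v)
  show ?case using word_equiv.cancel[of R "p @ u" x b "v @ q"] by simp
next
  case (relator r u v)
  show ?case using word_equiv.relator[OF relator(1), of "p @ u" "v @ q"] by simp
qed (rule word_equiv.refl, erule word_equiv.sym, erule (1) word_equiv.trans)

lemma word_equiv_append:
  assumes "word_equiv R u u'" "word_equiv R v v'"
  shows "word_equiv R (u @ v) (u' @ v')"
  using word_equiv_context[OF assms(1), of "[]" v] word_equiv_context[OF assms(2), of u' "[]"]
  by (simp add: word_equiv.trans[of R "u @ v" "u' @ v"])

lemma word_class_eq_iff: "word_rel R `` {u} = word_rel R `` {v} \<longleftrightarrow> word_equiv R u v"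
  using eq_equiv_class_iff[OF equiv_word_rel, of u v R] by (simp add: word_rel_def)

lemma presented_mult:
  "word_rel R `` {u} \<otimes>\<^bsub>presented_group R\<^esub> word_rel R `` {v} = word_rel R `` {u @ v}"
proof -
  let ?U = "word_rel R `` {u}" and ?V = "word_rel R `` {v}"
  have "word_rel R `` {u' @ v'} = word_rel R `` {u @ v}" if "u' \<in> ?U" "v' \<in> ?V" for u' v'
    using that word_equiv_append[of R u u' v v', THEN word_equiv.sym]
    by (simp add: word_class_eq_iff) (simp add: word_rel_def)
  moreover have "u \<in> ?U" "v \<in> ?V"
    by (simp_all add: word_rel_def word_equiv.refl)
  ultimately have "(\<Union>u'\<in>?U. \<Union>v'\<in>?V. word_rel R `` {u' @ v'}) = word_rel R `` {u @ v}"
    by blast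
  then show ?thesis
    by (simp add: presented_group_def)
qed

lemma presented_carrier: "carrier (presented_group R) = range (\<lambda>u. word_rel R `` {u})"
  by (auto simp: presented_group_def quotient_def)

lemma presented_one: "\<one>\<^bsub>presented_group R\<^esub> = word_rel R `` {[]}"
  by (simp add: presented_group_def)

definition inv_word :: "('x \<times> bool) list \<Rightarrow> ('x \<times> bool) list" where
  "inv_word u = rev (map (\<lambda>(x, b). (x, \<not> b)) u)"

lemma inv_word_equiv: "word_equiv R (inv_word u @ u) []"
proof (induction u)
  case Nil
  show ?case by (simp add: inv_word_def word_equiv.refl)
next
  case (Cons a u)
  obtain x b where "a = (x, b)" by fastforce
  then have "word_equiv R (inv_word (a # u) @ a # u) (inv_word u @ u)"
    using word_equiv.cancel[of R "inv_word u" x "\<not> b" u] by (simp add: inv_word_def)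
  with Cons show ?case by (blast intro: word_equiv.trans)
qed

lemma group_presented_group: "group (presented_group R)"
proof (rule groupI)
  fix x assume "x \<in> carrier (presented_group R)"
  then obtain u where "x = word_rel R `` {u}" by (auto simp: presented_carrier)
  then show "\<exists>y\<in>carrier (presented_group R). y \<otimes>\<^bsub>presented_group R\<^esub> x = \<one>\<^bsub>presented_group R\<^esub>"
    by (intro bexI[of _ "word_rel R `` {inv_word u}"])
      (auto simp: presented_mult presented_one presented_carrier word_class_eq_iff inv_word_equiv)
qed (auto simp: presented_carrier presented_mult presented_one)

lemma swap_word_involution: "swap_word (swap_word u) = u"
proof -
  have "swap_gen (swap_gen x) = x" for x by (cases x) auto
  then show ?thesis by (induction u) (auto simp: swap_word_def)
qed

lemma swap_word_append: "swap_word (u @ v) = swap_word u @ swap_word v"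
  by (simp add: swap_word_def)

lemma dihedral_reverse_relator:
  "word_equiv (dihedral_relators n) (concat (replicate n [(Gen_t, True), (Gen_s, True)])) []"
proof -
  let ?R = "dihedral_relators n" and ?s = "(Gen_s, True)" and ?t = "(Gen_t, True)"
  have shift: "?s # concat (replicate m [?t, ?s]) = concat (replicate m [?s, ?t]) @ [?s]" for m
    by (induction m) auto
  let ?w = "concat (replicate n [?t, ?s])"
  have ss: "word_equiv ?R ([?s, ?s] @ v) v" for v
    using word_equiv.relator[of "[?s, ?s]" ?R "[]" v] by (simp add: dihedral_relators_def)
  have st: "word_equiv ?R ([?s] @ concat (replicate n [?s, ?t]) @ [?s]) ([?s] @ [?s])"
    by (rule word_equiv.relator) (simp add: dihedral_relators_def)
  have "word_equiv ?R ([?s, ?s] @ ?w) ([?s] @ [?s])"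
    using st shift[of n] by simp
  then have "word_equiv ?R ?w ([?s] @ [?s])"
    by (rule word_equiv.trans[OF word_equiv.sym[OF ss]])
  then show ?thesis
    by (rule word_equiv.trans) (use ss[of "[]"] in simp)
qed

lemma swap_word_equiv:
  "word_equiv (dihedral_relators n) u v \<Longrightarrow>
   word_equiv (dihedral_relators n) (swap_word u) (swap_word v)"
proof (induction rule: word_equiv.induct)
  case (cancel u x b v)
  show ?case
    using word_equiv.cancel[of "dihedral_relators n" "swap_word u" "swap_gen x" b "swap_word v"]
    by (simp add: swap_word_def)
next
  case (relator r u v)
  have "swap_word (concat (replicate n [(Gen_s, True), (Gen_t, True)]))
      = concat (replicate n [(Gen_t, True), (Gen_s, True)])"
    by (simp add: swap_word_def map_concat)
  moreover have "word_equiv (dihedral_relators n) [(x, True), (x, True)] []" for x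
    using word_equiv.relator[of "[(x, True), (x, True)]" "dihedral_relators n" "[]" "[]"]
    by (cases x) (simp_all add: dihedral_relators_def)
  ultimately have "word_equiv (dihedral_relators n) (swap_word r) []"
    using relator dihedral_reverse_relator[of n]
    by (auto simp: dihedral_relators_def swap_word_def)
  then show ?case
    using word_equiv_context[of _ "swap_word r" "[]" "swap_word u" "swap_word v"]
    by (simp add: swap_word_append)
qed (rule word_equiv.refl, erule word_equiv.sym, erule (1) word_equiv.trans)

lemma dihedral_swap_class:
  "dihedral_swap (word_rel (dihedral_relators n) `` {u})
     = word_rel (dihedral_relators n) `` {swap_word u}"
proof -
  have "v \<in> swap_word ` {v. word_equiv (dihedral_relators n) u v}"
    if "word_equiv (dihedral_relators n) (swap_word u) v" for v
    using swap_word_equiv[OF that] swap_word_involution[of u] swap_word_involution[of v]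
    by (intro image_eqI[of _ _ "swap_word v"]) auto
  then show ?thesis
    using swap_word_equiv[of n u] by (auto simp: dihedral_swap_def word_rel_def)
qed

lemma dihedral_swap_iso: "dihedral_swap \<in> iso (dihedral n) (dihedral n)"
  and dihedral_swap_s: "dihedral_swap (dih_s n) = dih_t n"
  and dihedral_swap_t: "dihedral_swap (dih_t n) = dih_s n"
proof -
  have invol: "dihedral_swap (dihedral_swap X) = X" for X
    by (simp add: dihedral_swap_def image_image swap_word_involution)
  then have "inj_on dihedral_swap (carrier (dihedral n))"
    by (rule inj_on_inverseI)
  moreover have "dihedral_swap ` carrier (dihedral n) = carrier (dihedral n)"
  proof -
    have "dihedral_swap ` carrier (dihedral n) \<subseteq> carrier (dihedral n)"
      by (auto simp: dihedral_def presented_carrier dihedral_swap_class)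
    moreover have "X \<in> dihedral_swap ` carrier (dihedral n)" if "X \<in> carrier (dihedral n)" for X
      using that calculation by (intro image_eqI[of _ _ "dihedral_swap X"]) (auto simp: invol)
    ultimately show ?thesis by blast
  qed
  moreover have "dihedral_swap \<in> hom (dihedral n) (dihedral n)"
    by (rule homI)
      (auto simp: dihedral_def presented_carrier presented_mult dihedral_swap_class swap_word_append)
  ultimately show "dihedral_swap \<in> iso (dihedral n) (dihedral n)"
    by (simp add: iso_def bij_betw_def)
  show "dihedral_swap (dih_s n) = dih_t n" "dihedral_swap (dih_t n) = dih_s n"
    unfolding dih_s_def dih_t_def dihedral_swap_class by (simp_all add: swap_word_def)
qed

end

theory Submission
  imports Defs "HOL-Algebra.Generated_Groups" "HOL-Library.Countable_Set"
begin

text \<open>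
  Why the theorem is true. Let \<open>\<beta>\<close> be a length-preserving action of \<open>R\<close>. On the two
  elements of length one it has the form \<open>\<beta>(s) = s \<otimes> a + t \<otimes> b\<close> and
  \<open>\<beta>(t) = s \<otimes> c + t \<otimes> d\<close>. Since \<open>s\<close> is a self-adjoint unitary and \<open>e\<close>, \<open>st\<close>, \<open>ts\<close> are
  distinct (here \<open>n \<ge> 3\<close> enters), \<open>a\<close> and \<open>b\<close> are self-adjoint, \<open>a\<^sup>2 + b\<^sup>2 = 1\<close> and
  \<open>ab = ba = 0\<close>; likewise for \<open>c\<close> and \<open>d\<close>. The trace of \<open>\<beta>(st)\<close> vanishes, so
  \<open>ac + bd = 0\<close>. These relations force \<open>ac = bd = 0\<close> and then \<open>d\<^sup>2 = a\<^sup>2\<close>, \<open>c\<^sup>2 = b\<^sup>2\<close>: the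
  unit of \<open>R\<close> splits into two orthogonal projections \<open>p = a\<^sup>2\<close> and \<open>q = b\<^sup>2\<close>, with \<open>a\<close> and
  \<open>d\<close> involutions in the corner of \<open>p\<close>, and \<open>c\<close> and \<open>b\<close> in the corner of \<open>q\<close>
  (\<open>cross_zero\<close>, \<open>square_eq\<close>).

  Multiplying out words in \<open>s\<close> and \<open>t\<close>, mixed products of the two corners vanish, hence
  \<open>\<beta>(g) = g \<otimes> x + \<theta>(g) \<otimes> y\<close> with \<open>x\<close> and \<open>y\<close> multiplicative in \<open>g\<close>
  (\<open>coeffs_mult\<close>). So \<open>R\<close> receives a homomorphism from two orthogonal copies of the
  group algebra of \<open>D\<^sub>2\<^sub>n\<close>, whose values on group elements are the \<open>P (g, y)\<close>; all
  relations of the group, including \<open>(st)\<^sup>n = e\<close>, are inherited through \<open>\<beta>\<close>.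
  Coassociativity of the action, read off at \<open>g = s, t\<close>, where \<open>\<theta>(g) \<noteq> g\<close>, is exactly
  the formula for the coproduct of the doubling (\<open>comult_P\<close>). Conversely, the doubling acts
  by \<open>g \<mapsto> g \<otimes> \<xi>(g) + \<theta>(g) \<otimes> \<eta>(\<theta>(g))\<close>, and \<open>\<theta>\<close> preserves the word length
  (\<open>length_preserving\<close>). Hence the doubling is initial (\<open>universal\<close>).

  The doubling is finite-dimensional. All linear algebra is done in bases for which each
  coefficient is a single matrix entry (\<open>entry_frame\<close>), so that closures and tensor
  products cause no analytic difficulty; on the side of \<open>R\<close>, an arbitrary algebra of bounded
  operators, the only analytic input is associativity of the matrix product
  (\<open>op_mult_assoc\<close>). The argument applies verbatim to every algebra with such a basis and
  the multiplication table and coproduct of the doubling. It is used twice: for the doubling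
  of the full group algebra itself, and for a copy of it on the index type of the given
  universal object, which serves to link the two (\<open>universal_isomorphic\<close>).
\<close>

section \<open>Square-summable matrices\<close>

definition square_summable :: "('k \<Rightarrow> complex) \<Rightarrow> bool" where
  "square_summable x \<longleftrightarrow> (\<lambda>k. (cmod (x k))\<^sup>2) summable_on UNIV"

text \<open>
  Matrix products make sense, and are bilinear, as soon as all rows and columns lie in
  \<open>\<ell>\<^sup>2\<close>. This class contains the bounded operators, and its stability under sums and
  tensor products is a matter of numerical series alone.
\<close>

definition l2_matrix :: "'i l2op \<Rightarrow> bool" where
  "l2_matrix a \<longleftrightarrow> (\<forall>i. square_summable (a i)) \<and> (\<forall>j. square_summable (\<lambda>i. a i j))"

lemma square_summable_mult:
  assumes "square_summable x" "square_summable y"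
  shows "(\<lambda>k. x k * y k) abs_summable_on UNIV"
proof -
  have "(\<lambda>k. (cmod (x k))\<^sup>2 + (cmod (y k))\<^sup>2) summable_on UNIV"
    using assms by (auto simp: square_summable_def intro: summable_on_add)
  then show ?thesis
  proof (rule summable_on_comparison_test)
    fix k
    have "2 * (cmod (x k) * cmod (y k)) \<le> (cmod (x k))\<^sup>2 + (cmod (y k))\<^sup>2"
      using sum_squares_bound[of "cmod (x k)" "cmod (y k)"] by simp
    moreover have "0 \<le> cmod (x k) * cmod (y k)" by simp
    ultimately show "cmod (x k * y k) \<le> (cmod (x k))\<^sup>2 + (cmod (y k))\<^sup>2"
      unfolding norm_mult by linarith
  qed simp
qed

lemmas square_summable_mult_summable = abs_summable_summable[OF square_summable_mult]

lemma square_summable_add: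
  assumes "square_summable x" "square_summable y"
  shows "square_summable (\<lambda>k. x k + y k)"
proof -
  have "(\<lambda>k. 2 * (cmod (x k))\<^sup>2 + 2 * (cmod (y k))\<^sup>2) summable_on UNIV"
    using assms unfolding square_summable_def
    by (intro summable_on_add summable_on_cmult_right)
  then show ?thesis unfolding square_summable_def
  proof (rule summable_on_comparison_test)
    fix k
    have "(cmod (x k + y k))\<^sup>2 \<le> (cmod (x k) + cmod (y k))\<^sup>2"
      by (simp add: norm_triangle_ineq power_mono)
    also have "\<dots> \<le> 2 * (cmod (x k))\<^sup>2 + 2 * (cmod (y k))\<^sup>2"
      using sum_squares_bound[of "cmod (x k)" "cmod (y k)"]
      by (simp add: power2_sum algebra_simps)
    finally show "(cmod (x k + y k))\<^sup>2 \<le> 2 * (cmod (x k))\<^sup>2 + 2 * (cmod (y k))\<^sup>2" .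
  qed simp
qed

lemma square_summable_scale: "square_summable x \<Longrightarrow> square_summable (\<lambda>k. c * x k)"
  unfolding square_summable_def
  by (simp add: norm_mult power_mult_distrib summable_on_cmult_right)

lemma square_summable_finite_support: "finite {k. x k \<noteq> 0} \<Longrightarrow> square_summable x"
  unfolding square_summable_def
  by (rule finite_nonzero_values_imp_summable_on) simp

lemma square_summable_cnj: "square_summable x \<Longrightarrow> square_summable (\<lambda>k. cnj (x k))"
  by (simp add: square_summable_def)

lemma abs_summable_on_times:
  fixes f :: "'a \<Rightarrow> 'c :: {banach, real_normed_field}"
  assumes "f abs_summable_on A" "g abs_summable_on B"
  shows "(\<lambda>(x, y). f x * g y) abs_summable_on A \<times> B"
  unfolding abs_summable_on_Sigma_iff
  using assms
  by (auto simp: norm_mult infsum_cmult_right' abs_mult infsum_nonneg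
      intro!: summable_on_cmult_right summable_on_cmult_left)

lemma square_summable_tensor:
  assumes "square_summable x" "square_summable y"
  shows "square_summable (\<lambda>p. x (fst p) * y (snd p))"
proof -
  have "(\<lambda>(k, l). (cmod (x k))\<^sup>2 * (cmod (y l))\<^sup>2) summable_on UNIV \<times> UNIV"
    by (rule abs_summable_summable, rule abs_summable_on_times)
      (use assms in \<open>simp_all add: square_summable_def\<close>)
  then show ?thesis
    by (simp add: square_summable_def norm_mult power_mult_distrib case_prod_unfold)
qed

lemma square_summable_range:
  assumes "inj h" "\<And>k. k \<notin> range h \<Longrightarrow> x k = 0" "square_summable (\<lambda>k. x (h k))"
  shows "square_summable x"
proof -
  let ?f = "\<lambda>k. (cmod (x k))\<^sup>2"
  have "(?f \<circ> h) summable_on UNIV" using assms(3) by (simp add: square_summable_def o_def)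
  then have "?f summable_on range h" using summable_on_reindex[OF assms(1)] by blast
  also have "?f summable_on range h \<longleftrightarrow> ?f summable_on UNIV"
    by (rule summable_on_cong_neutral) (use assms(2) in auto)
  finally show ?thesis by (simp add: square_summable_def)
qed

lemma l2_matrix_row: "l2_matrix a \<Longrightarrow> square_summable (a i)"
  and l2_matrix_col: "l2_matrix a \<Longrightarrow> square_summable (\<lambda>i. a i j)"
  by (auto simp: l2_matrix_def)

lemma l2_matrix_zero: "l2_matrix 0"
  by (simp add: l2_matrix_def square_summable_finite_support)

lemma l2_matrix_add: "l2_matrix a \<Longrightarrow> l2_matrix b \<Longrightarrow> l2_matrix (a + b)"
  by (simp add: l2_matrix_def square_summable_add plus_fun_def)

lemma l2_matrix_scale: "l2_matrix a \<Longrightarrow> l2_matrix (op_scale c a)"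
  by (simp add: l2_matrix_def square_summable_scale op_scale_def)

lemma l2_matrix_sum: "(\<And>k. k \<in> K \<Longrightarrow> l2_matrix (f k)) \<Longrightarrow> l2_matrix (sum f K)"
  by (induction K rule: infinite_finite_induct) (simp_all add: l2_matrix_zero l2_matrix_add)

lemma l2_matrix_span:
  assumes "x \<in> l2op.span X" "\<And>a. a \<in> X \<Longrightarrow> l2_matrix a"
  shows "l2_matrix x"
  using assms
  by (induction rule: l2op.span_induct_alt) (auto intro: l2_matrix_zero l2_matrix_add l2_matrix_scale)

lemma l2_matrix_tensor: "l2_matrix a \<Longrightarrow> l2_matrix b \<Longrightarrow> l2_matrix (op_tensor a b)"
  unfolding l2_matrix_def op_tensor_def by (auto intro!: square_summable_tensor)

text \<open>Evaluating the form of \<open>a\<close> at a column of \<open>a\<close> itself bounds that column by the norm.\<close>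

lemma bounded_op_l2_matrix:
  assumes "bounded_op a"
  shows "l2_matrix a"
proof -
  obtain r where r: "op_norm_le a r" using assms by (auto simp: bounded_op_def)
  have r0: "r \<ge> 0" using r by (simp add: op_norm_le_def)
  \<comment> \<open>\<open>s\<close> will be the squared norm of a truncated row or column\<close>
  have key: "s \<le> r\<^sup>2" if "s \<le> r * sqrt s" "s \<ge> 0" for s
  proof (cases "s = 0")
    case False
    then have "sqrt s * sqrt s \<le> r * sqrt s" "sqrt s > 0" using that by auto
    then have "sqrt s \<le> r" by (rule mult_right_le_imp_le)
    then show ?thesis by (rule sqrt_le_D)
  qed simp
  have cs: "cmod (\<Sum>i\<in>F. \<Sum>j\<in>F. cnj (y i) * a i j * x j)
          \<le> r * L2_set (\<lambda>i. cmod (y i)) F * L2_set (\<lambda>j. cmod (x j)) F" if "finite F" for F x y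
    using r that by (simp add: op_norm_le_def)
  have delta: "L2_set (\<lambda>i. cmod (of_bool (i = j))) F = 1" if "finite F" "j \<in> F" for F and j :: 'a
  proof -
    have "(\<Sum>i\<in>F. (cmod (of_bool (i = j)))\<^sup>2) = (\<Sum>i\<in>F. of_bool (i = j))"
      by (rule sum.cong) auto
    then show ?thesis using that by (simp add: L2_set_def of_bool_def)
  qed
  have mono: "sum (\<lambda>i. (cmod (v i))\<^sup>2) F \<le> r\<^sup>2"
    if "sum (\<lambda>i. (cmod (v i))\<^sup>2) (insert j F) \<le> r\<^sup>2" "finite F" for v :: "'a \<Rightarrow> complex" and j F
  proof -
    have "sum (\<lambda>i. (cmod (v i))\<^sup>2) F \<le> sum (\<lambda>i. (cmod (v i))\<^sup>2) (insert j F)"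
      using that by (intro sum_mono2) auto
    then show ?thesis using that by linarith
  qed
  have col: "sum (\<lambda>i. (cmod (a i j))\<^sup>2) F \<le> r\<^sup>2" if "finite F" "j \<in> F" for j F
  proof (rule key)
    let ?s = "\<Sum>i\<in>F. (cmod (a i j))\<^sup>2"
    have "(\<Sum>l\<in>F. cnj (a i j) * a i l * of_bool (l = j)) = cnj (a i j) * a i j" for i
      using that sum.delta[of F j "\<lambda>l. cnj (a i j) * a i l"]
      by (simp add: of_bool_def if_distrib cong: if_cong)
    then have "(\<Sum>i\<in>F. \<Sum>l\<in>F. cnj (a i j) * a i l * of_bool (l = j)) = of_real ?s"
      by (simp only: of_real_sum complex_norm_square mult.commute[of "cnj _"])
    then show "?s \<le> r * sqrt ?s"
      using cs[OF that(1), of "\<lambda>i. a i j" "\<lambda>l. of_bool (l = j)"] delta[OF that]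
      by (simp add: L2_set_def norm_of_real sum_nonneg del: of_real_sum)
  qed (rule sum_nonneg, simp)
  have row: "sum (\<lambda>j. (cmod (a i j))\<^sup>2) F \<le> r\<^sup>2" if "finite F" "i \<in> F" for i F
  proof (rule key)
    let ?s = "\<Sum>j\<in>F. (cmod (a i j))\<^sup>2"
    have "(\<Sum>k\<in>F. cnj (of_bool (k = i)) * a k l * cnj (a i l)) = a i l * cnj (a i l)" for l
      using that sum.delta[of F i "\<lambda>k. a k l * cnj (a i l)"]
      by (simp add: of_bool_def if_distrib if_distribR cong: if_cong)
    then have "(\<Sum>k\<in>F. \<Sum>l\<in>F. cnj (of_bool (k = i)) * a k l * cnj (a i l)) = of_real ?s"
      by (subst sum.swap) (simp only: of_real_sum complex_norm_square)
    then show "?s \<le> r * sqrt ?s"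
      using cs[OF that(1), of "\<lambda>l. of_bool (l = i)" "\<lambda>l. cnj (a i l)"] delta[OF that]
      by (simp add: L2_set_def norm_of_real sum_nonneg del: of_real_sum)
  qed (rule sum_nonneg, simp)
  have "square_summable v"
    if *: "\<And>F. finite F \<Longrightarrow> j \<in> F \<Longrightarrow> sum (\<lambda>i. (cmod (v i))\<^sup>2) F \<le> r\<^sup>2"
    for v :: "'a \<Rightarrow> complex" and j
    unfolding square_summable_def
  proof (rule nonneg_bdd_above_summable_on)
    have "sum (\<lambda>i. (cmod (v i))\<^sup>2) F \<le> r\<^sup>2" if "finite F" for F
      by (rule mono[OF * that]) (use that in auto)
    then show "bdd_above (sum (\<lambda>i. (cmod (v i))\<^sup>2) ` {F. F \<subseteq> UNIV \<and> finite F})"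
      by (auto intro!: bdd_aboveI2[of _ _ "r\<^sup>2"])
  qed simp
  from this[OF row] this[OF col] show ?thesis
    by (auto simp: l2_matrix_def)
qed

subsection \<open>Products\<close>

lemma op_mult_summable:
  "l2_matrix a \<Longrightarrow> l2_matrix b \<Longrightarrow> (\<lambda>k. a i k * b k j) summable_on UNIV"
  by (intro square_summable_mult_summable l2_matrix_row l2_matrix_col)

lemma op_mult_add_left:
  "l2_matrix a \<Longrightarrow> l2_matrix b \<Longrightarrow> l2_matrix c \<Longrightarrow> op_mult (a + b) c = op_mult a c + op_mult b c"
  by (intro ext) (simp add: op_mult_def distrib_right infsum_add op_mult_summable)

lemma op_mult_add_right:
  "l2_matrix a \<Longrightarrow> l2_matrix b \<Longrightarrow> l2_matrix c \<Longrightarrow> op_mult c (a + b) = op_mult c a + op_mult c b"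
  by (intro ext) (simp add: op_mult_def distrib_left infsum_add op_mult_summable)

lemma op_mult_scale_left: "op_mult (op_scale c a) b = op_scale c (op_mult a b)"
  by (simp add: op_mult_def op_scale_def mult.assoc infsum_cmult_right')

lemma op_mult_scale_right: "op_mult a (op_scale c b) = op_scale c (op_mult a b)"
  by (simp add: op_mult_def op_scale_def mult.left_commute infsum_cmult_right')

lemma op_mult_zero [simp]: "op_mult 0 a = 0" "op_mult a 0 = 0"
  by (simp_all add: op_mult_def fun_eq_iff)

lemma op_mult_sum_left:
  assumes "\<And>k. k \<in> K \<Longrightarrow> l2_matrix (f k)" "l2_matrix c"
  shows "op_mult (sum f K) c = (\<Sum>k\<in>K. op_mult (f k) c)"
  using assms(1)
  by (induction K rule: infinite_finite_induct)
    (simp_all add: op_mult_add_left l2_matrix_sum assms(2))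

lemma op_mult_sum_right:
  assumes "\<And>k. k \<in> K \<Longrightarrow> l2_matrix (f k)" "l2_matrix c"
  shows "op_mult c (sum f K) = (\<Sum>k\<in>K. op_mult c (f k))"
  using assms(1)
  by (induction K rule: infinite_finite_induct)
    (simp_all add: op_mult_add_right l2_matrix_sum assms(2))

lemma op_adj_mult: "op_adj (op_mult a b) = op_mult (op_adj b) (op_adj a)"
  by (simp add: op_adj_def op_mult_def fun_eq_iff mult.commute flip: infsum_cnj)

lemma op_adj_add: "op_adj (a + b) = op_adj a + op_adj b"
  by (simp add: op_adj_def fun_eq_iff)

lemma op_adj_scale: "op_adj (op_scale c a) = op_scale (cnj c) (op_adj a)"
  by (simp add: op_adj_def op_scale_def)

lemma op_adj_tensor: "op_adj (op_tensor a b) = op_tensor (op_adj a) (op_adj b)"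
  by (simp add: op_adj_def op_tensor_def)

lemma op_tensor_add_left: "op_tensor (a + b) c = op_tensor a c + op_tensor b c"
  and op_tensor_add_right: "op_tensor c (a + b) = op_tensor c a + op_tensor c b"
  by (simp_all add: op_tensor_def fun_eq_iff algebra_simps)

lemma op_tensor_scale_left: "op_tensor (op_scale z a) c = op_scale z (op_tensor a c)"
  and op_tensor_scale_right: "op_tensor c (op_scale z a) = op_scale z (op_tensor c a)"
  by (simp_all add: op_tensor_def op_scale_def fun_eq_iff algebra_simps)

lemma op_tensor_zero [simp]: "op_tensor 0 a = 0" "op_tensor a 0 = 0"
  by (simp_all add: op_tensor_def fun_eq_iff)

lemma op_tensor_sum_left: "op_tensor (sum f K) c = (\<Sum>k\<in>K. op_tensor (f k) c)"
  and op_tensor_sum_right: "op_tensor c (sum f K) = (\<Sum>k\<in>K. op_tensor c (f k))"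
  by (induction K rule: infinite_finite_induct)
    (simp_all add: op_tensor_add_left op_tensor_add_right)

lemma infsum_single: "(\<And>k. k \<noteq> a \<Longrightarrow> f k = 0) \<Longrightarrow> infsum f UNIV = (f a :: complex)"
  using infsum_cong_neutral[of "{a}" UNIV f f] by auto

lemma infsum_range:
  assumes "inj h" "\<And>k. k \<notin> range h \<Longrightarrow> f k = 0"
  shows "infsum f UNIV = (infsum (\<lambda>k. f (h k)) UNIV :: complex)"
proof -
  have "infsum f UNIV = infsum f (range h)"
    by (rule infsum_cong_neutral) (use assms in auto)
  also have "\<dots> = infsum (f \<circ> h) UNIV" using assms(1) by (rule infsum_reindex)
  finally show ?thesis by (simp add: o_def)
qed

text \<open>Fubini for the absolutely summable double series \<open>\<Sum>\<^sub>k\<^sub>l (a\<^sub>i\<^sub>k c\<^sub>k\<^sub>j) (b\<^sub>m\<^sub>l d\<^sub>l\<^sub>n)\<close>.\<close>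

lemma op_mult_tensor:
  assumes "l2_matrix a" "l2_matrix b" "l2_matrix c" "l2_matrix d"
  shows "op_mult (op_tensor a b) (op_tensor c d) = op_tensor (op_mult a c) (op_mult b d)"
proof (intro ext)
  fix p q :: "'a \<times> 'b"
  obtain i m j n where pq: "p = (i, m)" "q = (j, n)" by (cases p; cases q) auto
  let ?f = "\<lambda>k. a i k * c k j" and ?g = "\<lambda>l. b m l * d l n"
  have f: "?f abs_summable_on UNIV" and g: "?g abs_summable_on UNIV"
    using square_summable_mult[OF l2_matrix_row[OF assms(1)] l2_matrix_col[OF assms(3)]]
      square_summable_mult[OF l2_matrix_row[OF assms(2)] l2_matrix_col[OF assms(4)]] by blast+
  have "(\<lambda>(k, l). ?f k * ?g l) abs_summable_on UNIV \<times> UNIV"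
    by (rule abs_summable_on_times[OF f g])
  then have "(\<lambda>(k, l). ?f k * ?g l) summable_on UNIV \<times> UNIV"
    by (rule abs_summable_summable)
  then have "(\<Sum>\<^sub>\<infinity>(k, l)\<in>UNIV \<times> UNIV. ?f k * ?g l) = (\<Sum>\<^sub>\<infinity>k. \<Sum>\<^sub>\<infinity>l. ?f k * ?g l)"
    by (simp add: infsum_Sigma'_banach)
  also have "\<dots> = (\<Sum>\<^sub>\<infinity>k. ?f k) * (\<Sum>\<^sub>\<infinity>l. ?g l)"
    by (simp add: infsum_cmult_right' infsum_cmult_left')
  finally show "op_mult (op_tensor a b) (op_tensor c d) p q
      = op_tensor (op_mult a c) (op_mult b d) p q"
    by (simp add: pq op_mult_def op_tensor_def case_prod_unfold algebra_simps)
qed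

lemma op_mult_tensor_sums:
  assumes "\<And>y. l2_matrix (a y)" "\<And>y. l2_matrix (b y)" "\<And>y. l2_matrix (c y)" "\<And>y. l2_matrix (d y)"
  shows "op_mult (\<Sum>y\<in>Y. op_tensor (a y) (b y)) (\<Sum>z\<in>Z. op_tensor (c z) (d z))
    = (\<Sum>y\<in>Y. \<Sum>z\<in>Z. op_tensor (op_mult (a y) (c z)) (op_mult (b y) (d z)))"
  by (simp add: assms op_mult_sum_left op_mult_sum_right op_mult_tensor l2_matrix_sum l2_matrix_tensor)
    (rule sum.swap)

subsection \<open>Associativity\<close>

lemma has_sum_sum:
  fixes f :: "'k \<Rightarrow> 'a \<Rightarrow> complex"
  shows "(\<And>k. k \<in> K \<Longrightarrow> (f k has_sum s k) A) \<Longrightarrow> ((\<lambda>x. \<Sum>k\<in>K. f k x) has_sum (\<Sum>k\<in>K. s k)) A"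
  by (induction K rule: infinite_finite_induct) (simp_all add: has_sum_add)

text \<open>
  Both vectors are extended by zero to the union of the two index sets.
\<close>

lemma op_norm_le_rectangle:
  assumes "op_norm_le a r" "finite H" "finite E"
  shows "cmod (\<Sum>i\<in>H. \<Sum>j\<in>E. x i * a i j * y j)
    \<le> r * L2_set (\<lambda>i. cmod (x i)) H * L2_set (\<lambda>j. cmod (y j)) E"
proof -
  let ?F = "H \<union> E"
  let ?x = "\<lambda>i. if i \<in> H then cnj (x i) else 0" and ?y = "\<lambda>j. if j \<in> E then y j else 0"
  have F: "finite ?F" using assms by simp
  have "(\<Sum>i\<in>?F. \<Sum>j\<in>?F. cnj (?x i) * a i j * ?y j) = (\<Sum>i\<in>?F. \<Sum>j\<in>E. cnj (?x i) * a i j * y j)"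
    using assms by (intro sum.cong[OF HOL.refl]; intro sum.mono_neutral_cong_right) auto
  also have "\<dots> = (\<Sum>i\<in>H. \<Sum>j\<in>E. x i * a i j * y j)"
    using assms by (intro sum.mono_neutral_cong_right) auto
  finally have 1: "(\<Sum>i\<in>?F. \<Sum>j\<in>?F. cnj (?x i) * a i j * ?y j) = (\<Sum>i\<in>H. \<Sum>j\<in>E. x i * a i j * y j)" .
  have 2: "L2_set (\<lambda>i. cmod (?x i)) ?F = L2_set (\<lambda>i. cmod (x i)) H"
    using assms unfolding L2_set_def by (intro arg_cong[of _ _ sqrt] sum.mono_neutral_cong_right) auto
  have 3: "L2_set (\<lambda>j. cmod (?y j)) ?F = L2_set (\<lambda>j. cmod (y j)) E"
    using assms unfolding L2_set_def by (intro arg_cong[of _ _ sqrt] sum.mono_neutral_cong_right) auto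
  have "\<forall>x y. cmod (\<Sum>i\<in>?F. \<Sum>j\<in>?F. cnj (x i) * a i j * y j)
      \<le> r * L2_set (\<lambda>i. cmod (x i)) ?F * L2_set (\<lambda>j. cmod (y j)) ?F"
    using assms(1) F by (simp add: op_norm_le_def)
  from this[rule_format, of ?x ?y] show ?thesis
    unfolding 1 2 3 .
qed

definition l2_norm :: "('k \<Rightarrow> complex) \<Rightarrow> real" where
  "l2_norm x = sqrt (\<Sum>\<^sub>\<infinity>k. (cmod (x k))\<^sup>2)"

lemma L2_set_le_l2_norm:
  assumes "square_summable x" "finite F"
  shows "L2_set (\<lambda>k. cmod (x k)) F \<le> l2_norm x"
  unfolding L2_set_def l2_norm_def
  using assms by (intro real_sqrt_le_mono finite_sum_le_infsum) (auto simp: square_summable_def)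

lemma l2_norm_nonneg: "l2_norm x \<ge> 0"
  by (simp add: l2_norm_def infsum_nonneg)

text \<open>The form \<open>\<Sum>\<^sub>l (\<Sum>\<^sub>k x\<^sub>k b\<^sub>k\<^sub>l) y\<^sub>l\<close> is bounded by the norm of \<open>b\<close> in both variables.\<close>

lemma bounded_form:
  assumes b: "op_norm_le b r" and x: "square_summable x" and y: "square_summable y"
  shows "(\<lambda>l. (\<Sum>\<^sub>\<infinity>k. x k * b k l) * y l) summable_on UNIV"
    and "cmod (\<Sum>\<^sub>\<infinity>l. (\<Sum>\<^sub>\<infinity>k. x k * b k l) * y l) \<le> r * l2_norm x * l2_norm y"
proof -
  have r0: "r \<ge> 0" using b by (simp add: op_norm_le_def)
  have l2b: "l2_matrix b" using b bounded_op_l2_matrix by (auto simp: bounded_op_def)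
  define z where "z l = (\<Sum>\<^sub>\<infinity>k. x k * b k l)" for l
  have sm: "(\<lambda>k. x k * b k l) summable_on UNIV" for l
    by (intro square_summable_mult_summable x l2_matrix_col l2b)
  have fin: "cmod (\<Sum>l\<in>E. z l * v l) \<le> r * l2_norm x * L2_set (\<lambda>l. cmod (v l)) E"
    if E: "finite E" for E v
  proof -
    have "((\<lambda>k. \<Sum>l\<in>E. x k * b k l * v l) has_sum (\<Sum>l\<in>E. z l * v l)) UNIV"
      unfolding z_def by (intro has_sum_sum has_sum_cmult_left has_sum_infsum sm)
    then have lim: "((\<lambda>H. \<Sum>k\<in>H. \<Sum>l\<in>E. x k * b k l * v l) \<longlongrightarrow> (\<Sum>l\<in>E. z l * v l))
        (finite_subsets_at_top UNIV)"
      by (simp add: has_sum_def)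
    show ?thesis
    proof (rule tendsto_upperbound[OF tendsto_norm[OF lim]])
      show "\<forall>\<^sub>F H in finite_subsets_at_top UNIV.
          cmod (\<Sum>k\<in>H. \<Sum>l\<in>E. x k * b k l * v l) \<le> r * l2_norm x * L2_set (\<lambda>l. cmod (v l)) E"
      proof (rule eventually_finite_subsets_at_top_weakI)
        fix H :: "'a set" assume H: "finite H"
        have "cmod (\<Sum>k\<in>H. \<Sum>l\<in>E. x k * b k l * v l)
            \<le> r * L2_set (\<lambda>k. cmod (x k)) H * L2_set (\<lambda>l. cmod (v l)) E"
          by (rule op_norm_le_rectangle[OF b H E])
        also have "\<dots> \<le> r * l2_norm x * L2_set (\<lambda>l. cmod (v l)) E"
          by (intro mult_right_mono mult_left_mono L2_set_le_l2_norm x H r0 L2_set_nonneg)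
        finally show "cmod (\<Sum>k\<in>H. \<Sum>l\<in>E. x k * b k l * v l)
            \<le> r * l2_norm x * L2_set (\<lambda>l. cmod (v l)) E" .
      qed
    qed simp
  qed
  \<comment> \<open>testing against \<open>v = cnj \<circ> z\<close> bounds the partial sums of \<open>\<bar>z\<bar>\<^sup>2\<close>\<close>
  have "square_summable z"
    unfolding square_summable_def
  proof (rule nonneg_bdd_above_summable_on)
    have "sum (\<lambda>l. (cmod (z l))\<^sup>2) E \<le> (r * l2_norm x)\<^sup>2" if E: "finite E" for E
    proof (cases "sum (\<lambda>l. (cmod (z l))\<^sup>2) E = 0")
      case False
      let ?s = "sum (\<lambda>l. (cmod (z l))\<^sup>2) E"
      have "(\<Sum>l\<in>E. z l * cnj (z l)) = of_real ?s"
        by (simp only: of_real_sum complex_norm_square)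
      moreover have s: "?s > 0" using False by (simp add: sum_nonneg less_le)
      ultimately have "?s \<le> r * l2_norm x * sqrt ?s"
        using fin[OF E, of "\<lambda>l. cnj (z l)"]
        by (simp add: L2_set_def norm_of_real del: of_real_sum)
      then have "sqrt ?s * sqrt ?s \<le> r * l2_norm x * sqrt ?s" "sqrt ?s > 0" using s by auto
      then have "sqrt ?s \<le> r * l2_norm x" by (rule mult_right_le_imp_le)
      then show ?thesis by (rule sqrt_le_D)
    qed simp
    then show "bdd_above (sum (\<lambda>l. (cmod (z l))\<^sup>2) ` {F. F \<subseteq> UNIV \<and> finite F})"
      by (auto intro!: bdd_aboveI2[of _ _ "(r * l2_norm x)\<^sup>2"])
  qed simp
  then show sum_zy: "(\<lambda>l. (\<Sum>\<^sub>\<infinity>k. x k * b k l) * y l) summable_on UNIV"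
    unfolding z_def[symmetric] by (intro square_summable_mult_summable y)
  then have lim: "((\<lambda>E. \<Sum>l\<in>E. z l * y l) \<longlongrightarrow> (\<Sum>\<^sub>\<infinity>l. z l * y l)) (finite_subsets_at_top UNIV)"
    using infsum_tendsto unfolding z_def by blast
  have "cmod (\<Sum>\<^sub>\<infinity>l. z l * y l) \<le> r * l2_norm x * l2_norm y"
  proof (rule tendsto_upperbound[OF tendsto_norm[OF lim]])
    show "\<forall>\<^sub>F E in finite_subsets_at_top UNIV. cmod (\<Sum>l\<in>E. z l * y l) \<le> r * l2_norm x * l2_norm y"
    proof (rule eventually_finite_subsets_at_top_weakI)
      fix E :: "'a set" assume E: "finite E"
      have "r * l2_norm x * L2_set (\<lambda>l. cmod (y l)) E \<le> r * l2_norm x * l2_norm y"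
        by (intro mult_left_mono L2_set_le_l2_norm y E mult_nonneg_nonneg r0 l2_norm_nonneg)
      then show "cmod (\<Sum>l\<in>E. z l * y l) \<le> r * l2_norm x * l2_norm y"
        using fin[OF E, of y] by linarith
    qed
  qed simp
  then show "cmod (\<Sum>\<^sub>\<infinity>l. (\<Sum>\<^sub>\<infinity>k. x k * b k l) * y l) \<le> r * l2_norm x * l2_norm y"
    by (simp add: z_def)
qed

text \<open>
  The double series \<open>\<Sum>\<^sub>k\<^sub>l a\<^sub>i\<^sub>k b\<^sub>k\<^sub>l c\<^sub>l\<^sub>j\<close> need not converge absolutely, so Fubini does not
  apply. Instead the row \<open>x\<close> of \<open>a\<close> is truncated to a finite set \<open>F\<close>, where the summations can
  be exchanged, and the remainder is at most \<open>\<parallel>b\<parallel> \<parallel>x - x\<^sub>F\<parallel> \<parallel>y\<parallel>\<close>.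
\<close>

lemma op_mult_assoc:
  assumes a: "l2_matrix a" and b: "bounded_op b" and c: "l2_matrix c"
  shows "op_mult (op_mult a b) c = op_mult a (op_mult b c)"
proof (intro ext)
  fix i j
  obtain r where r: "op_norm_le b r" using b by (auto simp: bounded_op_def)
  have l2b: "l2_matrix b" by (rule bounded_op_l2_matrix[OF b])
  define x where "x = a i"
  define y where "y = (\<lambda>l. c l j)"
  have x: "square_summable x" and y: "square_summable y"
    using a c by (simp_all add: x_def y_def l2_matrix_row l2_matrix_col)
  define T where "T = (\<Sum>\<^sub>\<infinity>l. (\<Sum>\<^sub>\<infinity>k. x k * b k l) * y l)"
  define w where "w k = (\<Sum>\<^sub>\<infinity>l. b k l * y l)" for k
  have smb: "(\<lambda>k. v k * b k l) summable_on UNIV" if "square_summable v" for v l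
    by (intro square_summable_mult_summable that l2_matrix_col l2b)
  have smw: "(\<lambda>l. b k l * y l) summable_on UNIV" for k
    by (intro square_summable_mult_summable y l2_matrix_row l2b)
  have err: "cmod (T - (\<Sum>k\<in>F. x k * w k))
      \<le> r * sqrt ((\<Sum>\<^sub>\<infinity>k. (cmod (x k))\<^sup>2) - (\<Sum>k\<in>F. (cmod (x k))\<^sup>2)) * l2_norm y" if F: "finite F" for F
  proof -
    define u where "u = (\<lambda>k. if k \<in> F then x k else 0)"
    define v where "v = (\<lambda>k. if k \<in> F then 0 else x k)"
    have xs: "(\<lambda>k. (cmod (x k))\<^sup>2) summable_on UNIV" using x by (simp add: square_summable_def)
    have u: "square_summable u"
      by (rule square_summable_finite_support, rule finite_subset[OF _ F]) (auto simp: u_def)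
    have "(\<lambda>k. (cmod (v k))\<^sup>2) summable_on UNIV"
      by (rule summable_on_comparison_test[OF xs]) (auto simp: v_def)
    then have v: "square_summable v" by (simp add: square_summable_def)
    have "(\<Sum>\<^sub>\<infinity>k. (cmod (x k))\<^sup>2) = (\<Sum>\<^sub>\<infinity>k. (cmod (u k))\<^sup>2 + (cmod (v k))\<^sup>2)"
      by (rule infsum_cong) (auto simp: u_def v_def)
    also have "\<dots> = (\<Sum>\<^sub>\<infinity>k. (cmod (u k))\<^sup>2) + (\<Sum>\<^sub>\<infinity>k. (cmod (v k))\<^sup>2)"
      using u v by (intro infsum_add) (auto simp: square_summable_def)
    also have "(\<Sum>\<^sub>\<infinity>k. (cmod (u k))\<^sup>2) = (\<Sum>\<^sub>\<infinity>k\<in>F. (cmod (x k))\<^sup>2)"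
      by (rule infsum_cong_neutral) (auto simp: u_def)
    finally have nv: "l2_norm v = sqrt ((\<Sum>\<^sub>\<infinity>k. (cmod (x k))\<^sup>2) - (\<Sum>k\<in>F. (cmod (x k))\<^sup>2))"
      using F by (simp add: l2_norm_def)
    have "(\<Sum>k\<in>F. x k * w k) = (\<Sum>\<^sub>\<infinity>l. \<Sum>k\<in>F. x k * (b k l * y l))"
      unfolding w_def
      by (rule infsumI[symmetric]) (intro has_sum_sum has_sum_cmult_right has_sum_infsum smw)
    also have "\<dots> = (\<Sum>\<^sub>\<infinity>l. (\<Sum>\<^sub>\<infinity>k. u k * b k l) * y l)"
    proof (rule infsum_cong)
      fix l
      have "(\<Sum>\<^sub>\<infinity>k. u k * b k l) = (\<Sum>\<^sub>\<infinity>k\<in>F. x k * b k l)"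
        by (rule infsum_cong_neutral) (auto simp: u_def)
      then show "(\<Sum>k\<in>F. x k * (b k l * y l)) = (\<Sum>\<^sub>\<infinity>k. u k * b k l) * y l"
        using F by (simp add: sum_distrib_right mult.assoc)
    qed
    finally have S: "(\<Sum>k\<in>F. x k * w k) = (\<Sum>\<^sub>\<infinity>l. (\<Sum>\<^sub>\<infinity>k. u k * b k l) * y l)" .
    have "T = (\<Sum>\<^sub>\<infinity>l. (\<Sum>\<^sub>\<infinity>k. u k * b k l) * y l + (\<Sum>\<^sub>\<infinity>k. v k * b k l) * y l)"
      unfolding T_def
    proof (rule infsum_cong)
      fix l
      have "(\<Sum>\<^sub>\<infinity>k. x k * b k l) = (\<Sum>\<^sub>\<infinity>k. u k * b k l + v k * b k l)"
        by (rule infsum_cong) (auto simp: u_def v_def)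
      also have "\<dots> = (\<Sum>\<^sub>\<infinity>k. u k * b k l) + (\<Sum>\<^sub>\<infinity>k. v k * b k l)"
        by (intro infsum_add smb u v)
      finally show "(\<Sum>\<^sub>\<infinity>k. x k * b k l) * y l
          = (\<Sum>\<^sub>\<infinity>k. u k * b k l) * y l + (\<Sum>\<^sub>\<infinity>k. v k * b k l) * y l"
        by (simp add: distrib_right)
    qed
    also have "\<dots> = (\<Sum>k\<in>F. x k * w k) + (\<Sum>\<^sub>\<infinity>l. (\<Sum>\<^sub>\<infinity>k. v k * b k l) * y l)"
      unfolding S by (intro infsum_add bounded_form(1)[OF r] u v y)
    finally show ?thesis
      using bounded_form(2)[OF r v y] by (simp add: nv)
  qed
  have "((\<lambda>k. x k * w k) has_sum T) UNIV"
    unfolding has_sum_def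
  proof (rule Lim_transform2)
    let ?B = "\<lambda>F. r * sqrt ((\<Sum>\<^sub>\<infinity>k. (cmod (x k))\<^sup>2) - (\<Sum>k\<in>F. (cmod (x k))\<^sup>2)) * l2_norm y"
    have "((\<lambda>F. \<Sum>k\<in>F. (cmod (x k))\<^sup>2) \<longlongrightarrow> (\<Sum>\<^sub>\<infinity>k. (cmod (x k))\<^sup>2)) (finite_subsets_at_top UNIV)"
      using x by (intro infsum_tendsto) (simp add: square_summable_def)
    then have "(?B \<longlongrightarrow> r * sqrt ((\<Sum>\<^sub>\<infinity>k. (cmod (x k))\<^sup>2) - (\<Sum>\<^sub>\<infinity>k. (cmod (x k))\<^sup>2)) * l2_norm y)
        (finite_subsets_at_top UNIV)"
      by (intro tendsto_intros)
    then have B: "(?B \<longlongrightarrow> 0) (finite_subsets_at_top UNIV)" by simp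
    show "((\<lambda>F. T - (\<Sum>k\<in>F. x k * w k)) \<longlongrightarrow> 0) (finite_subsets_at_top UNIV)"
    proof (rule tendsto_0_le[OF B, of _ 1], rule eventually_finite_subsets_at_top_weakI)
      fix F :: "'a set" assume "finite F"
      from err[OF this] show "norm (T - (\<Sum>k\<in>F. x k * w k)) \<le> norm (?B F) * 1"
        unfolding mult_1_right real_norm_def by linarith
    qed
  qed simp
  then have "T = (\<Sum>\<^sub>\<infinity>k. x k * w k)" by (simp add: infsumI)
  then show "op_mult (op_mult a b) c i j = op_mult a (op_mult b c) i j"
    by (simp add: T_def w_def x_def y_def op_mult_def)
qed

section \<open>Boundedness\<close>

lemma op_norm_le_add:
  assumes "op_norm_le a r" "op_norm_le b s"
  shows "op_norm_le (a + b) (r + s)"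
  unfolding op_norm_le_def
proof (intro conjI allI impI)
  show "0 \<le> r + s" using assms by (simp add: op_norm_le_def)
  fix F :: "'a set" and x y :: "'a \<Rightarrow> complex" assume F: "finite F"
  let ?f = "\<lambda>a. \<Sum>i\<in>F. \<Sum>j\<in>F. cnj (y i) * a i j * x j"
  let ?y = "L2_set (\<lambda>i. cmod (y i)) F" and ?x = "L2_set (\<lambda>j. cmod (x j)) F"
  have "?f (a + b) = ?f a + ?f b"
    by (simp add: algebra_simps sum.distrib)
  moreover have "cmod (?f a) \<le> r * ?y * ?x" "cmod (?f b) \<le> s * ?y * ?x"
    using assms F by (auto simp: op_norm_le_def)
  moreover have "cmod (?f a + ?f b) \<le> cmod (?f a) + cmod (?f b)"
    by (rule norm_triangle_ineq)
  ultimately show "cmod (?f (a + b)) \<le> (r + s) * ?y * ?x"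
    by (simp add: distrib_right)
qed

lemma op_norm_le_scale:
  assumes "op_norm_le a r"
  shows "op_norm_le (op_scale c a) (cmod c * r)"
  unfolding op_norm_le_def
proof (intro conjI allI impI)
  show "0 \<le> cmod c * r" using assms by (simp add: op_norm_le_def)
  fix F :: "'a set" and x y :: "'a \<Rightarrow> complex" assume F: "finite F"
  have "(\<Sum>i\<in>F. \<Sum>j\<in>F. cnj (y i) * op_scale c a i j * x j)
      = c * (\<Sum>i\<in>F. \<Sum>j\<in>F. cnj (y i) * a i j * x j)"
    by (simp add: op_scale_def sum_distrib_left algebra_simps)
  then show "cmod (\<Sum>i\<in>F. \<Sum>j\<in>F. cnj (y i) * op_scale c a i j * x j)
      \<le> cmod c * r * L2_set (\<lambda>i. cmod (y i)) F * L2_set (\<lambda>j. cmod (x j)) F"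
    using assms F by (simp add: op_norm_le_def norm_mult mult.assoc mult_left_mono)
qed

lemma op_norm_le_zero: "0 \<le> r \<Longrightarrow> op_norm_le 0 r"
  by (simp add: op_norm_le_def)

lemma bounded_op_span:
  assumes "x \<in> l2op.span X" "\<And>a. a \<in> X \<Longrightarrow> bounded_op a"
  shows "bounded_op x"
  using assms(1)
proof (induction rule: l2op.span_induct_alt)
  case base
  show ?case unfolding bounded_op_def using op_norm_le_zero[of 0] by blast
next
  case (step c y z)
  then obtain r s where "op_norm_le y r" "op_norm_le z s"
    using assms(2) unfolding bounded_op_def by blast
  then have "op_norm_le (op_scale c y + z) (cmod c * r + s)"
    by (intro op_norm_le_add op_norm_le_scale)
  then show ?case unfolding bounded_op_def by blast
qed

lemma op_norm_le_entry:
  assumes "op_norm_le a r"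
  shows "cmod (a i j) \<le> r"
proof -
  have "L2_set (\<lambda>k. cmod 1) {l} = 1" for l :: 'a
    by (simp add: L2_set_def)
  then show ?thesis
    using op_norm_le_rectangle[OF assms, of "{i}" "{j}" "\<lambda>_. 1" "\<lambda>_. 1"] by simp
qed

text \<open>
  If \<open>a\<^sup>* a\<close> is a coordinate projection then \<open>a\<close> is a contraction, because
  \<open>\<parallel>a x\<parallel>\<^sup>2 = \<langle>x, a\<^sup>* a x\<rangle> \<le> \<parallel>x\<parallel>\<^sup>2\<close> for finitely supported \<open>x\<close>. This is how unitaries and
  their direct sums, of whatever size, are seen to be bounded.
\<close>

lemma op_norm_le_partial_isometry:
  assumes a: "l2_matrix a" and proj: "\<And>i j. op_mult (op_adj a) a i j = of_bool (i = j \<and> P i)"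
  shows "op_norm_le a 1"
  unfolding op_norm_le_def
proof (intro conjI allI impI)
  fix F :: "'a set" and x y :: "'a \<Rightarrow> complex" assume F: "finite F"
  define z where "z i = (\<Sum>j\<in>F. a i j * x j)" for i
  have sm: "((\<lambda>i. cnj (a i j) * a i k) has_sum of_bool (j = k \<and> P j)) UNIV" for j k
  proof -
    have "(\<lambda>i. cnj (a i j) * a i k) summable_on UNIV"
      by (intro square_summable_mult_summable square_summable_cnj l2_matrix_col a)
    then show ?thesis
      using proj[of j k] has_sum_infsum unfolding op_mult_def op_adj_def by metis
  qed
  have "((\<lambda>i. \<Sum>j\<in>F. \<Sum>k\<in>F. (cnj (x j) * x k) * (cnj (a i j) * a i k)) has_sum
      (\<Sum>j\<in>F. \<Sum>k\<in>F. (cnj (x j) * x k) * of_bool (j = k \<and> P j))) UNIV"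
    by (intro has_sum_sum has_sum_cmult_right sm)
  moreover have "(\<Sum>j\<in>F. \<Sum>k\<in>F. (cnj (x j) * x k) * (cnj (a i j) * a i k)) = of_real ((cmod (z i))\<^sup>2)" for i
    unfolding complex_norm_square z_def cnj_sum sum_product
    by (subst sum.swap) (simp add: algebra_simps)
  moreover have "(\<Sum>j\<in>F. \<Sum>k\<in>F. (cnj (x j) * x k) * of_bool (j = k \<and> P j))
      = of_real (\<Sum>j\<in>F. of_bool (P j) * (cmod (x j))\<^sup>2)"
  proof -
    have "(\<Sum>k\<in>F. (cnj (x j) * x k) * of_bool (j = k \<and> P j))
        = of_real (of_bool (P j) * (cmod (x j))\<^sup>2)" if "j \<in> F" for j
    proof -
      have "(\<Sum>k\<in>F. (cnj (x j) * x k) * of_bool (j = k \<and> P j))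
          = (\<Sum>k\<in>F. if j = k then cnj (x j) * x j * of_bool (P j) else 0)"
        by (rule sum.cong) auto
      also have "\<dots> = of_real (of_bool (P j) * (cmod (x j))\<^sup>2)"
        using F that by (simp add: complex_norm_square mult.commute del: of_real_power)
      finally show ?thesis .
    qed
    then show ?thesis by simp
  qed
  ultimately have "((\<lambda>i. complex_of_real ((cmod (z i))\<^sup>2)) has_sum
      of_real (\<Sum>j\<in>F. of_bool (P j) * (cmod (x j))\<^sup>2)) UNIV"
    by simp
  then have "((\<lambda>i. (cmod (z i))\<^sup>2) has_sum (\<Sum>j\<in>F. of_bool (P j) * (cmod (x j))\<^sup>2)) UNIV"
    by (simp only: has_sum_of_real_iff)
  then have "(\<Sum>i\<in>F. (cmod (z i))\<^sup>2) \<le> (\<Sum>j\<in>F. of_bool (P j) * (cmod (x j))\<^sup>2)"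
    by (rule finite_sum_le_has_sum) (use F in auto)
  also have "\<dots> \<le> (\<Sum>j\<in>F. (cmod (x j))\<^sup>2)"
    by (rule sum_mono) auto
  finally have zx: "L2_set (\<lambda>i. cmod (z i)) F \<le> L2_set (\<lambda>j. cmod (x j)) F"
    by (simp add: L2_set_def)
  have "cmod (\<Sum>i\<in>F. \<Sum>j\<in>F. cnj (y i) * a i j * x j) = cmod (\<Sum>i\<in>F. cnj (y i) * z i)"
    by (simp add: z_def sum_distrib_left mult.assoc)
  also have "\<dots> \<le> (\<Sum>i\<in>F. \<bar>cmod (y i)\<bar> * \<bar>cmod (z i)\<bar>)"
    using norm_sum[of "\<lambda>i. cnj (y i) * z i" F] by (simp add: norm_mult)
  also have "\<dots> \<le> L2_set (\<lambda>i. cmod (y i)) F * L2_set (\<lambda>i. cmod (z i)) F"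
    by (rule L2_set_mult_ineq)
  also have "\<dots> \<le> L2_set (\<lambda>i. cmod (y i)) F * L2_set (\<lambda>j. cmod (x j)) F"
    using zx by (rule mult_left_mono) simp
  finally show "cmod (\<Sum>i\<in>F. \<Sum>j\<in>F. cnj (y i) * a i j * x j)
      \<le> 1 * L2_set (\<lambda>i. cmod (y i)) F * L2_set (\<lambda>j. cmod (x j)) F" by simp
qed simp

section \<open>Finite-dimensional algebras with distinguished matrix entries\<close>

text \<open>
  The finite-dimensional spaces that occur have bases \<open>u\<close> for which each coefficient of a
  vector can be read off at one matrix position \<open>p k\<close>. Consequently coefficients are
  continuous and defined on all matrices: the span is norm-closed, linear maps can be
  prescribed on the basis, and tensor products are again of this form.
\<close>

definition entry_frame :: "'k set \<Rightarrow> ('k \<Rightarrow> 'i l2op) \<Rightarrow> ('k \<Rightarrow> 'i \<times> 'i) \<Rightarrow> bool" where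
  "entry_frame K u p \<longleftrightarrow> finite K \<and> (\<forall>k\<in>K. l2_matrix (u k)) \<and>
     (\<forall>k\<in>K. \<forall>l\<in>K. u k (fst (p l)) (snd (p l)) = of_bool (k = l))"

definition frame_map :: "'k set \<Rightarrow> ('k \<Rightarrow> 'i \<times> 'i) \<Rightarrow> ('k \<Rightarrow> 'j l2op) \<Rightarrow> 'i l2op \<Rightarrow> 'j l2op" where
  "frame_map K p f x = (\<Sum>k\<in>K. op_scale (x (fst (p k)) (snd (p k))) (f k))"

text \<open>From here on sums of operators are vectors, and are not to be evaluated entrywise.\<close>

declare plus_fun_apply [simp del] zero_fun_apply [simp del]

lemma sum_op_apply: "(\<Sum>k\<in>K. f k) i j = (\<Sum>k\<in>K. f k i j)"
  for f :: "'k \<Rightarrow> 'i l2op"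
  by (induction K rule: infinite_finite_induct) (simp_all add: plus_fun_apply zero_fun_apply)

lemma frame_map_add: "frame_map K p f (x + y) = frame_map K p f x + frame_map K p f y"
  by (simp add: frame_map_def plus_fun_apply l2op.scale_left_distrib sum.distrib)

lemma frame_map_scale: "frame_map K p f (op_scale c x) = op_scale c (frame_map K p f x)"
  by (simp add: frame_map_def l2op.scale_sum_right) (simp add: op_scale_def mult.assoc)

lemma frame_map_zero: "frame_map K p f 0 = 0"
  by (simp add: frame_map_def zero_fun_apply)

lemma frame_map_basis:
  assumes "entry_frame K u p" "k \<in> K"
  shows "frame_map K p f (u k) = f k"
proof -
  have "frame_map K p f (u k) = (\<Sum>l\<in>K. if k = l then f k else 0)"
    unfolding frame_map_def
    by (rule sum.cong) (use assms in \<open>auto simp: entry_frame_def\<close>)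
  then show ?thesis using assms by (simp add: entry_frame_def)
qed

lemma frame_map_mem:
  assumes "l2op.subspace C" "\<And>k. k \<in> K \<Longrightarrow> f k \<in> C"
  shows "frame_map K p f x \<in> C"
  unfolding frame_map_def
  by (intro l2op.subspace_sum l2op.subspace_scale assms)

lemma frame_expand:
  assumes "entry_frame K u p" "x \<in> l2op.span (u ` K)"
  shows "frame_map K p u x = x"
  using assms(2)
proof (induction rule: l2op.span_induct_alt)
  case base
  show ?case by (rule frame_map_zero)
next
  case (step c x y)
  then show ?case
    using frame_map_basis[OF assms(1)]
    by (auto simp: frame_map_add frame_map_scale)
qed

lemma norm_closure_superset: "X \<subseteq> norm_closure X"
  by (auto simp: norm_closure_def intro!: bexI op_norm_le_zero)

text \<open>
  If \<open>b\<close> in the span is within \<open>\<epsilon>\<close> of \<open>a\<close>, then so are its coefficients from the entries of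
  \<open>a\<close>; hence \<open>a\<close> agrees entrywise with the element of the span built from its own entries.
\<close>

lemma norm_closure_frame:
  assumes fr: "entry_frame K u p"
  shows "norm_closure (l2op.span (u ` K)) = l2op.span (u ` K)"
proof
  show "norm_closure (l2op.span (u ` K)) \<subseteq> l2op.span (u ` K)"
  proof
    fix a assume a: "a \<in> norm_closure (l2op.span (u ` K))"
    have "a i j = frame_map K p u a i j" for i j
    proof -
      \<comment> \<open>an error \<open>\<epsilon>\<close> in all entries contributes \<open>\<epsilon>\<close> itself and \<open>\<epsilon>\<close> times each basis entry\<close>
      define M where "M = 1 + (\<Sum>k\<in>K. cmod (u k i j))"
      have M: "M > 0" unfolding M_def by (intro add_pos_nonneg sum_nonneg) auto
      have "cmod (a i j - frame_map K p u a i j) \<le> 0 + \<delta>" if "\<delta> > 0" for \<delta>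
      proof -
        define \<epsilon> where "\<epsilon> = \<delta> / M"
        have "\<epsilon> > 0" using that M by (simp add: \<epsilon>_def)
        then obtain b where b: "b \<in> l2op.span (u ` K)" "op_norm_le (a - b) \<epsilon>"
          using a by (auto simp: norm_closure_def)
        have ab: "cmod (a i j - b i j) \<le> \<epsilon>" for i j
          using op_norm_le_entry[OF b(2), of i j] by simp
        have "a i j - frame_map K p u a i j
            = (a i j - b i j) + (\<Sum>k\<in>K. (b (fst (p k)) (snd (p k)) - a (fst (p k)) (snd (p k))) * u k i j)"
          using arg_cong[OF frame_expand[OF fr b(1)], of "\<lambda>x. x i j"]
          by (simp add: frame_map_def sum_op_apply op_scale_def left_diff_distrib sum_subtractf)
        also have "cmod \<dots> \<le> \<epsilon> + (\<Sum>k\<in>K. \<epsilon> * cmod (u k i j))"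
        proof (rule order.trans[OF norm_triangle_ineq], rule add_mono[OF ab],
            rule order.trans[OF norm_sum], rule sum_mono)
          fix k
          show "cmod ((b (fst (p k)) (snd (p k)) - a (fst (p k)) (snd (p k))) * u k i j)
              \<le> \<epsilon> * cmod (u k i j)"
            unfolding norm_mult
            by (rule mult_right_mono) (use ab in \<open>simp_all add: norm_minus_commute\<close>)
        qed
        also have "\<dots> = \<epsilon> * M" by (simp add: M_def distrib_left sum_distrib_left)
        also have "\<dots> = 0 + \<delta>" using M by (simp add: \<epsilon>_def)
        finally show ?thesis .
      qed
      then have "cmod (a i j - frame_map K p u a i j) \<le> 0" by (rule field_le_epsilon)
      then show ?thesis by simp
    qed
    then have "a = frame_map K p u a" by (intro ext)
    moreover have "frame_map K p u a \<in> l2op.span (u ` K)"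
      by (rule frame_map_mem) (auto intro: l2op.span_base)
    ultimately show "a \<in> l2op.span (u ` K)" by simp
  qed
qed (rule norm_closure_superset)

lemma entry_frame_tensor:
  assumes "entry_frame K u p" "entry_frame L v q"
  shows "entry_frame (K \<times> L) (\<lambda>(k, l). op_tensor (u k) (v l))
    (\<lambda>(k, l). ((fst (p k), fst (q l)), (snd (p k), snd (q l))))"
  using assms by (auto simp: entry_frame_def l2_matrix_tensor) (auto simp: op_tensor_def)

lemma op_tensor_span:
  assumes a: "a \<in> l2op.span X" and b: "b \<in> l2op.span Y"
  shows "op_tensor a b \<in> l2op.span {op_tensor x y | x y. x \<in> X \<and> y \<in> Y}" (is "_ \<in> ?S")
proof -
  have 1: "op_tensor x b \<in> ?S" if "x \<in> X" for x
    using b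
  proof (induction rule: l2op.span_induct_alt)
    case (step c y z)
    then show ?case
      using that unfolding op_tensor_add_right op_tensor_scale_right
      by (intro l2op.span_add l2op.span_scale) (auto intro: l2op.span_base)
  qed (simp add: l2op.span_zero)
  from a show ?thesis
  proof (induction rule: l2op.span_induct_alt)
    case (step c y z)
    then show ?case
      using 1 unfolding op_tensor_add_left op_tensor_scale_left
      by (intro l2op.span_add l2op.span_scale) auto
  qed (simp add: l2op.span_zero)
qed

lemma spatial_tensor_frame:
  assumes "entry_frame K u p" "entry_frame L v q"
  shows "spatial_tensor (l2op.span (u ` K)) (l2op.span (v ` L))
    = l2op.span ((\<lambda>(k, l). op_tensor (u k) (v l)) ` (K \<times> L))" (is "_ = ?R")
proof -
  have "{op_tensor x y | x y. x \<in> u ` K \<and> y \<in> v ` L} = (\<lambda>(k, l). op_tensor (u k) (v l)) ` (K \<times> L)"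
    by auto
  then have "{op_tensor a b | a b. a \<in> l2op.span (u ` K) \<and> b \<in> l2op.span (v ` L)} \<subseteq> ?R"
    using op_tensor_span[of _ "u ` K" _ "v ` L"] by auto
  moreover have "(\<lambda>(k, l). op_tensor (u k) (v l)) ` (K \<times> L)
      \<subseteq> {op_tensor a b | a b. a \<in> l2op.span (u ` K) \<and> b \<in> l2op.span (v ` L)}"
    by (auto intro!: exI l2op.span_base)
  ultimately have "l2op.span {op_tensor a b | a b. a \<in> l2op.span (u ` K) \<and> b \<in> l2op.span (v ` L)} = ?R"
    by (intro equalityI l2op.span_minimal l2op.span_mono l2op.subspace_span)
  then show ?thesis
    unfolding spatial_tensor_def
    using norm_closure_frame[OF entry_frame_tensor[OF assms]] by simp
qed

section \<open>Homomorphisms prescribed on a basis\<close>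

text \<open>
  The form in which identities between linear maps are reduced to basis vectors: the maps are
  only known to be linear on the span, as is the case for homomorphisms.
\<close>

lemma linear_on_eq_on_span:
  assumes "\<And>a b. a \<in> l2op.span X \<Longrightarrow> b \<in> l2op.span X \<Longrightarrow> f (a + b) = f a + f b"
    "\<And>c a. a \<in> l2op.span X \<Longrightarrow> f (op_scale c a) = op_scale c (f a)"
    and "\<And>a b. a \<in> l2op.span X \<Longrightarrow> b \<in> l2op.span X \<Longrightarrow> g (a + b) = g a + g b"
    "\<And>c a. a \<in> l2op.span X \<Longrightarrow> g (op_scale c a) = op_scale c (g a)"
    and "\<And>x. x \<in> X \<Longrightarrow> f x = g x" "a \<in> l2op.span X"
  shows "f a = g a"
proof -
  have f0: "f 0 = 0" and g0: "g 0 = 0"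
    using assms(2)[of 0 0] assms(4)[of 0 0] by (simp_all add: l2op.span_zero)
  have "a \<in> l2op.span X \<and> f a = g a"
    using assms(6)
  proof (induction rule: l2op.span_induct_alt)
    case (step c x y)
    then show ?case using assms(1-5)
      by (auto simp: l2op.span_add l2op.span_scale l2op.span_base)
  qed (simp add: f0 g0 l2op.span_zero)
  then show ?thesis ..
qed

lemma star_hom_mono: "star_hom A B \<phi> \<Longrightarrow> B \<subseteq> C \<Longrightarrow> star_hom A C \<phi>"
  by (auto simp: star_hom_def)

lemma star_hom_id: "star_hom A A (\<lambda>x. x)"
  by (simp add: star_hom_def)

lemma star_hom_comp: "star_hom A B \<phi> \<Longrightarrow> star_hom B C \<psi> \<Longrightarrow> star_hom A C (\<lambda>x. \<psi> (\<phi> x))"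
  by (simp add: star_hom_def)

lemma star_hom_zero: "star_hom A B \<phi> \<Longrightarrow> 0 \<in> A \<Longrightarrow> \<phi> 0 = 0"
  unfolding star_hom_def by (metis l2op.scale_zero_left)

lemma star_hom_sum:
  assumes "star_hom A B \<phi>" "l2op.subspace V" "V \<subseteq> A" "\<And>k. k \<in> K \<Longrightarrow> f k \<in> V"
  shows "\<phi> (sum f K) = (\<Sum>k\<in>K. \<phi> (f k))"
  using assms(4)
proof (induction K rule: infinite_finite_induct)
  case (insert k K)
  have "f k \<in> A" "sum f K \<in> A"
    using assms(2,3) insert by (auto intro: l2op.subspace_sum)
  then show ?case using insert assms(1) by (simp add: star_hom_def)
qed (use star_hom_zero[OF assms(1)] assms(2,3) l2op.subspace_0 in auto)

text \<open>
  Induction over a span that carries along square-summability, on which bilinearity of the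
  product depends.
\<close>

lemma l2_span_induct [consumes 2, case_names base step]:
  assumes "\<forall>a\<in>X. l2_matrix a" "x \<in> l2op.span X"
    and "P 0"
    and "\<And>c a y. a \<in> X \<Longrightarrow> l2_matrix a \<Longrightarrow> l2_matrix y \<Longrightarrow> P y \<Longrightarrow> P (op_scale c a + y)"
  shows "P x"
proof -
  have "l2_matrix x \<and> P x"
    using assms(2)
    by (induction rule: l2op.span_induct_alt)
      (use assms(1,3,4) in \<open>auto intro: l2_matrix_zero l2_matrix_add l2_matrix_scale\<close>)
  then show ?thesis ..
qed

lemma op_mult_span_closed:
  assumes l2X: "\<forall>x\<in>X. l2_matrix x" and X: "\<And>x y. x \<in> X \<Longrightarrow> y \<in> X \<Longrightarrow> op_mult x y \<in> l2op.span X"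
    and a: "a \<in> l2op.span X" and b: "b \<in> l2op.span X"
  shows "op_mult a b \<in> l2op.span X"
proof -
  have l2: "l2_matrix x" if "x \<in> l2op.span X" for x
    using that l2X by (auto intro: l2_matrix_span)
  have 1: "op_mult x b \<in> l2op.span X" if "x \<in> X" for x
    using l2X b
  proof (induction rule: l2_span_induct)
    case (step c y z)
    then have "op_mult x (op_scale c y + z) = op_scale c (op_mult x y) + op_mult x z"
      using that l2X l2 by (simp add: op_mult_add_right op_mult_scale_right l2_matrix_scale)
    then show ?case using step that X by (simp add: l2op.span_add l2op.span_scale)
  qed (simp add: l2op.span_zero)
  from l2X a show ?thesis
  proof (induction rule: l2_span_induct)
    case (step c y z)
    then have "op_mult (op_scale c y + z) b = op_scale c (op_mult y b) + op_mult z b"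
      using b l2X l2 by (simp add: op_mult_add_left op_mult_scale_left l2_matrix_scale)
    then show ?case using step 1 by (simp add: l2op.span_add l2op.span_scale)
  qed (simp add: l2op.span_zero)
qed

lemma op_adj_zero: "op_adj 0 = 0"
  by (simp add: op_adj_def zero_fun_def)

lemma op_adj_span_closed:
  assumes "\<And>x. x \<in> X \<Longrightarrow> op_adj x \<in> l2op.span X" and a: "a \<in> l2op.span X"
  shows "op_adj a \<in> l2op.span X"
  using a
proof (induction rule: l2op.span_induct_alt)
  case base
  then show ?case by (simp add: l2op.span_zero op_adj_zero)
next
  case (step c y z)
  then show ?case
    using assms(1) by (simp add: op_adj_add op_adj_scale l2op.span_add l2op.span_scale)
qed

text \<open>
  Because coefficients are matrix entries, \<open>frame_map\<close> is linear by construction; it remains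
  to propagate the product and the adjoint from the basis to its span.
\<close>

lemma star_hom_frame_map:
  assumes fr: "entry_frame K u p" and C: "l2op.subspace C"
    and f: "\<And>k. k \<in> K \<Longrightarrow> f k \<in> C" "\<And>k. k \<in> K \<Longrightarrow> l2_matrix (f k)"
    and mult: "\<And>k l. k \<in> K \<Longrightarrow> l \<in> K \<Longrightarrow> frame_map K p f (op_mult (u k) (u l)) = op_mult (f k) (f l)"
    and adj: "\<And>k. k \<in> K \<Longrightarrow> frame_map K p f (op_adj (u k)) = op_adj (f k)"
  shows "star_hom (l2op.span (u ` K)) C (frame_map K p f)"
proof -
  let ?A = "l2op.span (u ` K)" and ?F = "frame_map K p f"
  have l2u: "l2_matrix (u k)" if "k \<in> K" for k using fr that by (simp add: entry_frame_def)
  have l2: "l2_matrix x" if "x \<in> ?A" for x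
    by (rule l2_matrix_span[OF that]) (use l2u in auto)
  have l2uK: "\<forall>a\<in>u ` K. l2_matrix a" using l2u by auto
  have l2F: "l2_matrix (?F x)" for x
    unfolding frame_map_def by (intro l2_matrix_sum l2_matrix_scale f)
  note basis = frame_map_basis[OF fr]
  have 1: "?F (op_mult (u k) b) = op_mult (f k) (?F b)" if k: "k \<in> K" and "b \<in> ?A" for k b
    using l2uK that(2)
  proof (induction rule: l2_span_induct)
    case (step c y z)
    obtain l where l: "l \<in> K" "y = u l" using step by auto
    have "op_mult (u k) (op_scale c y + z) = op_scale c (op_mult (u k) y) + op_mult (u k) z"
      using k l step l2u l2 by (simp add: op_mult_add_right op_mult_scale_right l2_matrix_scale)
    moreover have "op_mult (f k) (?F (op_scale c y + z))
        = op_scale c (op_mult (f k) (f l)) + op_mult (f k) (?F z)"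
      using k l f(2) l2F
      by (simp add: frame_map_add frame_map_scale basis op_mult_add_right op_mult_scale_right
          l2_matrix_scale)
    ultimately show ?case using step k l mult by (simp add: frame_map_add frame_map_scale)
  qed (simp add: frame_map_zero)
  have "?F (op_mult a b) = op_mult (?F a) (?F b)" if "a \<in> ?A" and b: "b \<in> ?A" for a b
    using l2uK that(1)
  proof (induction rule: l2_span_induct)
    case (step c y z)
    obtain l where l: "l \<in> K" "y = u l" using step by auto
    have "op_mult (op_scale c y + z) b = op_scale c (op_mult y b) + op_mult z b"
      using b l step l2u l2 by (simp add: op_mult_add_left op_mult_scale_left l2_matrix_scale)
    moreover have "op_mult (?F (op_scale c y + z)) (?F b)
        = op_scale c (op_mult (f l) (?F b)) + op_mult (?F z) (?F b)"
      using l f(2) l2F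
      by (simp add: frame_map_add frame_map_scale basis op_mult_add_left op_mult_scale_left
          l2_matrix_scale)
    ultimately show ?case using step l 1[OF l(1) b] by (simp add: frame_map_add frame_map_scale)
  qed (simp add: frame_map_zero)
  moreover have "?F (op_adj a) = op_adj (?F a)" if "a \<in> ?A" for a
    using that
  proof (induction rule: l2op.span_induct_alt)
    case base
    show ?case by (simp add: frame_map_zero op_adj_zero)
  next
    case (step c y z)
    then show ?case
      using adj by (auto simp: op_adj_add op_adj_scale frame_map_add frame_map_scale basis)
  qed
  ultimately show ?thesis
    by (simp add: star_hom_def frame_map_add frame_map_scale frame_map_mem C f)
qed

lemma star_hom_eq_frame_map:
  assumes "entry_frame K u p" "star_hom (l2op.span (u ` K)) C \<phi>" "a \<in> l2op.span (u ` K)"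
  shows "\<phi> a = frame_map K p (\<lambda>k. \<phi> (u k)) a"
proof -
  have mem: "u k \<in> l2op.span (u ` K)" if "k \<in> K" for k using that by (auto intro: l2op.span_base)
  have "\<phi> a = \<phi> (frame_map K p u a)" using frame_expand[OF assms(1,3)] by simp
  also have "\<dots> = (\<Sum>k\<in>K. \<phi> (op_scale (a (fst (p k)) (snd (p k))) (u k)))"
    unfolding frame_map_def
    by (rule star_hom_sum[OF assms(2) l2op.subspace_span order_refl]) (simp add: l2op.span_scale mem)
  also have "\<dots> = frame_map K p (\<lambda>k. \<phi> (u k)) a"
    unfolding frame_map_def
    by (rule sum.cong) (use assms(2) mem in \<open>simp_all add: star_hom_def\<close>)
  finally show ?thesis .
qed

lemma star_hom_cong:
  assumes "star_hom (l2op.span X) B \<phi>" "\<And>a. a \<in> l2op.span X \<Longrightarrow> \<psi> a = \<phi> a"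
    "\<And>a b. a \<in> l2op.span X \<Longrightarrow> b \<in> l2op.span X \<Longrightarrow> op_mult a b \<in> l2op.span X"
    "\<And>a. a \<in> l2op.span X \<Longrightarrow> op_adj a \<in> l2op.span X"
  shows "star_hom (l2op.span X) B \<psi>"
  using assms(1) unfolding star_hom_def
  by (simp add: assms(2-4) l2op.span_add l2op.span_scale)

lemma op_tensor_in_span: "a \<in> A \<Longrightarrow> b \<in> B \<Longrightarrow> op_tensor a b \<in> l2op.span {op_tensor a b | a b. a \<in> A \<and> b \<in> B}"
  by (rule l2op.span_base) auto

lemma op_tensor_in_spatial: "a \<in> A \<Longrightarrow> b \<in> B \<Longrightarrow> op_tensor a b \<in> spatial_tensor A B"
  unfolding spatial_tensor_def using op_tensor_in_span norm_closure_superset by blast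

lemma tensor_hom_apply: "tensor_hom A B C D \<phi> \<psi> F \<Longrightarrow> a \<in> A \<Longrightarrow> b \<in> B \<Longrightarrow>
    F (op_tensor a b) = op_tensor (\<phi> a) (\<psi> b)"
  by (simp add: tensor_hom_def)

lemma tensor_hom_sum:
  assumes "tensor_hom A B C D \<phi> \<psi> F" "\<And>k. k \<in> K \<Longrightarrow> a k \<in> A" "\<And>k. k \<in> K \<Longrightarrow> b k \<in> B"
  shows "F (\<Sum>k\<in>K. op_tensor (a k) (b k)) = (\<Sum>k\<in>K. op_tensor (\<phi> (a k)) (\<psi> (b k)))"
proof -
  have "F (\<Sum>k\<in>K. op_tensor (a k) (b k)) = (\<Sum>k\<in>K. F (op_tensor (a k) (b k)))"
  proof (rule star_hom_sum)
    show "star_hom (spatial_tensor A B) (spatial_tensor C D) F"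
      using assms(1) by (simp add: tensor_hom_def)
    show "l2op.span {op_tensor a b | a b. a \<in> A \<and> b \<in> B} \<subseteq> spatial_tensor A B"
      unfolding spatial_tensor_def by (rule norm_closure_superset)
  qed (simp_all add: l2op.subspace_span op_tensor_in_span assms(2,3))
  also have "\<dots> = (\<Sum>k\<in>K. op_tensor (\<phi> (a k)) (\<psi> (b k)))"
    using assms by (intro sum.cong) (auto simp: tensor_hom_def)
  finally show ?thesis .
qed

text \<open>
  For a basis of \<open>A\<close> and a basis of \<open>B\<close> as above, the algebraic tensor product is already
  complete, and \<open>\<phi> \<otimes> \<psi>\<close> is given by its values on the products of basis vectors.
\<close>

lemma tensor_hom_frame:
  assumes u: "entry_frame K u p" and v: "entry_frame L v q"
    and A: "A = l2op.span (u ` K)" and B: "B = l2op.span (v ` L)"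
    and Am: "\<And>x y. x \<in> A \<Longrightarrow> y \<in> A \<Longrightarrow> op_mult x y \<in> A" "\<And>x. x \<in> A \<Longrightarrow> op_adj x \<in> A"
    and Bm: "\<And>x y. x \<in> B \<Longrightarrow> y \<in> B \<Longrightarrow> op_mult x y \<in> B" "\<And>x. x \<in> B \<Longrightarrow> op_adj x \<in> B"
    and \<phi>: "star_hom A C \<phi>" and \<psi>: "star_hom B D \<psi>"
    and C: "\<And>c. c \<in> C \<Longrightarrow> l2_matrix c" and D: "\<And>d. d \<in> D \<Longrightarrow> l2_matrix d"
  shows "\<exists>F. tensor_hom A B C D \<phi> \<psi> F"
proof -
  let ?w = "\<lambda>(k, l). op_tensor (u k) (v l)"
  let ?pq = "\<lambda>(k, l). ((fst (p k), fst (q l)), (snd (p k), snd (q l)))"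
  let ?f = "\<lambda>(k, l). op_tensor (\<phi> (u k)) (\<psi> (v l))"
  define F where "F = frame_map (K \<times> L) ?pq ?f"
  have uA: "u k \<in> A" if "k \<in> K" for k unfolding A using that by (auto intro: l2op.span_base)
  have vB: "v l \<in> B" if "l \<in> L" for l unfolding B using that by (auto intro: l2op.span_base)
  have l2u: "l2_matrix (u k)" if "k \<in> K" for k using u that by (simp add: entry_frame_def)
  have l2v: "l2_matrix (v l)" if "l \<in> L" for l using v that by (simp add: entry_frame_def)
  have \<phi>C: "\<phi> a \<in> C" if "a \<in> A" for a using \<phi> that by (simp add: star_hom_def)
  have \<psi>D: "\<psi> b \<in> D" if "b \<in> B" for b using \<psi> that by (simp add: star_hom_def)
  have tens: "F (op_tensor a b) = op_tensor (\<phi> a) (\<psi> b)" if "a \<in> A" "b \<in> B" for a b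
  proof -
    have "F (op_tensor a b) = (\<Sum>k\<in>K. \<Sum>l\<in>L. op_scale (a (fst (p k)) (snd (p k)))
        (op_scale (b (fst (q l)) (snd (q l))) (op_tensor (\<phi> (u k)) (\<psi> (v l)))))"
      unfolding F_def frame_map_def sum.cartesian_product
      by (intro sum.cong) (auto simp: op_tensor_def op_scale_def mult.assoc)
    also have "\<dots> = op_tensor (frame_map K p (\<lambda>k. \<phi> (u k)) a) (frame_map L q (\<lambda>l. \<psi> (v l)) b)"
      unfolding frame_map_def op_tensor_sum_left op_tensor_sum_right
        op_tensor_scale_left op_tensor_scale_right l2op.scale_sum_right
      by (subst sum.swap) (simp only: l2op.scale_left_commute)
    also have "\<dots> = op_tensor (\<phi> a) (\<psi> b)"
      using star_hom_eq_frame_map[OF u \<phi>[unfolded A]] star_hom_eq_frame_map[OF v \<psi>[unfolded B]]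
        that by (simp add: A B)
    finally show ?thesis .
  qed
  have "star_hom (l2op.span (?w ` (K \<times> L))) (l2op.span {op_tensor c d | c d. c \<in> C \<and> d \<in> D}) F"
    unfolding F_def
  proof (rule star_hom_frame_map[OF entry_frame_tensor[OF u v] l2op.subspace_span])
    fix k assume "k \<in> K \<times> L"
    then show "?f k \<in> l2op.span {op_tensor c d | c d. c \<in> C \<and> d \<in> D}" "l2_matrix (?f k)"
      by (auto intro!: op_tensor_in_span l2_matrix_tensor C D \<phi>C \<psi>D uA vB)
  next
    fix k l assume k: "k \<in> K \<times> L" and l: "l \<in> K \<times> L"
    obtain k1 k2 l1 l2 where kl: "k = (k1, k2)" "l = (l1, l2)" by (cases k; cases l) auto
    have "op_mult (?w k) (?w l) = op_tensor (op_mult (u k1) (u l1)) (op_mult (v k2) (v l2))"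
      using k l by (simp add: kl op_mult_tensor l2u l2v)
    moreover have "op_mult (?f k) (?f l)
        = op_tensor (op_mult (\<phi> (u k1)) (\<phi> (u l1))) (op_mult (\<psi> (v k2)) (\<psi> (v l2)))"
      using k l by (simp add: kl op_mult_tensor C D \<phi>C \<psi>D uA vB)
    ultimately show "frame_map (K \<times> L) ?pq ?f (op_mult (?w k) (?w l)) = op_mult (?f k) (?f l)"
      using k l \<phi> \<psi> tens[unfolded F_def] by (simp add: kl Am Bm uA vB star_hom_def)
  next
    fix k assume k: "k \<in> K \<times> L"
    then show "frame_map (K \<times> L) ?pq ?f (op_adj (?w k)) = op_adj (?f k)"
      using \<phi> \<psi> tens[unfolded F_def]
      by (auto simp: op_adj_tensor Am Bm uA vB star_hom_def)
  qed
  then have "star_hom (spatial_tensor A B) (spatial_tensor C D) F"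
    unfolding spatial_tensor_def[of C D] A B spatial_tensor_frame[OF u v]
    by (rule star_hom_mono[OF _ norm_closure_superset])
  then show ?thesis using tens by (auto simp: tensor_hom_def)
qed

lemma alg_unit_eqI:
  assumes "e \<in> A" "\<And>a. a \<in> A \<Longrightarrow> op_mult e a = a \<and> op_mult a e = a"
  shows "alg_unit A = e"
  unfolding alg_unit_def
proof (rule the_equality)
  fix e' assume "e' \<in> A \<and> (\<forall>a\<in>A. op_mult e' a = a \<and> op_mult a e' = a)"
  then show "e' = e" using assms by metis
qed (use assms in auto)

lemma unit_on_span:
  assumes X: "\<And>x. x \<in> X \<Longrightarrow> l2_matrix x" and f: "l2_matrix f"
    and unit: "\<And>x. x \<in> X \<Longrightarrow> op_mult f x = x \<and> op_mult x f = x" and x: "x \<in> l2op.span X"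
  shows "op_mult f x = x \<and> op_mult x f = x"
proof -
  have l2: "l2_matrix x" if "x \<in> l2op.span X" for x
    using that X by (rule l2_matrix_span)
  show ?thesis
  proof
    show "op_mult f x = x"
      by (rule linear_on_eq_on_span[of X "op_mult f" "\<lambda>x. x" x])
        (use x l2 f unit in \<open>auto simp: op_mult_add_right op_mult_scale_right\<close>)
    show "op_mult x f = x"
      by (rule linear_on_eq_on_span[of X "\<lambda>x. op_mult x f" "\<lambda>x. x" x])
        (use x l2 f unit in \<open>auto simp: op_mult_add_left op_mult_scale_left\<close>)
  qed
qed

lemma alg_unit_span:
  assumes "\<And>x. x \<in> X \<Longrightarrow> l2_matrix x" "f \<in> l2op.span X"
    and "\<And>x. x \<in> X \<Longrightarrow> op_mult f x = x \<and> op_mult x f = x"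
  shows "alg_unit (l2op.span X) = f"
proof (rule alg_unit_eqI[OF assms(2)])
  have "l2_matrix f" using assms(2,1) by (rule l2_matrix_span)
  then show "op_mult f x = x \<and> op_mult x f = x" if "x \<in> l2op.span X" for x
    using unit_on_span[of X f x] assms(1,3) that by blast
qed

lemma alg_unit_tensor:
  assumes v: "entry_frame I v q" and w: "entry_frame J w r"
    and V: "V = l2op.span (v ` I)" and W: "W = l2op.span (w ` J)" and fe: "f \<in> V" "e \<in> W"
    and f: "\<And>k. k \<in> I \<Longrightarrow> op_mult f (v k) = v k \<and> op_mult (v k) f = v k"
    and e: "\<And>k. k \<in> J \<Longrightarrow> op_mult e (w k) = w k \<and> op_mult (w k) e = w k"
  shows "alg_unit (spatial_tensor V W) = op_tensor f e"
proof -
  have l2v: "l2_matrix (v k)" if "k \<in> I" for k using v that by (simp add: entry_frame_def)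
  have l2w: "l2_matrix (w k)" if "k \<in> J" for k using w that by (simp add: entry_frame_def)
  have l2f: "l2_matrix f" using fe(1) unfolding V by (rule l2_matrix_span) (use l2v in auto)
  have l2e: "l2_matrix e" using fe(2) unfolding W by (rule l2_matrix_span) (use l2w in auto)
  show ?thesis
    using op_tensor_in_spatial[OF fe] unfolding V W spatial_tensor_frame[OF v w]
    by (rule alg_unit_span[rotated])
      (auto simp: op_mult_tensor l2_matrix_tensor l2v l2w l2f l2e f e)
qed

lemma op_assoc_add: "op_assoc (a + b) = op_assoc a + op_assoc b"
  by (auto simp: op_assoc_def fun_eq_iff plus_fun_apply)

lemma op_assoc_scale: "op_assoc (op_scale c a) = op_scale c (op_assoc a)"
  by (auto simp: op_assoc_def op_scale_def fun_eq_iff)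

lemma op_assoc_tensor: "op_assoc (op_tensor (op_tensor a b) c) = op_tensor a (op_tensor b c)"
  by (auto simp: op_assoc_def op_tensor_def fun_eq_iff)

lemma op_assoc_sum: "op_assoc (sum f K) = (\<Sum>k\<in>K. op_assoc (f k))"
proof (induction K rule: infinite_finite_induct)
  have "op_assoc 0 = 0" by (auto simp: op_assoc_def fun_eq_iff zero_fun_apply)
  then show "op_assoc (sum f {}) = (\<Sum>k\<in>{}. op_assoc (f k))"
    "\<And>A. infinite A \<Longrightarrow> op_assoc (sum f A) = (\<Sum>k\<in>A. op_assoc (f k))" by simp_all
qed (simp add: op_assoc_add)

section \<open>Groups generated by two exchangeable involutions\<close>

text \<open>
  All that is used of the dihedral group: it is finite, generated by two non-commuting
  involutions, and has an automorphism that exchanges them.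
\<close>

locale swapped_involutions = group G for G :: "('g, 'm) monoid_scheme" (structure) +
  fixes s t :: 'g and \<theta> :: "'g \<Rightarrow> 'g"
  assumes finite_carrier: "finite (carrier G)"
    and s_closed [simp]: "s \<in> carrier G" and t_closed [simp]: "t \<in> carrier G"
    and s_s: "s \<otimes> s = \<one>" and t_t: "t \<otimes> t = \<one>"
    and noncommuting: "s \<otimes> t \<noteq> t \<otimes> s"
    and generated: "carrier G = generate G {s, t}"
    and swap_hom: "\<theta> \<in> hom G G" and swap_s: "\<theta> s = t" and swap_t: "\<theta> t = s"
begin

lemma inv_s: "inv s = s" and inv_t: "inv t = t"
  using s_s t_t by (simp_all add: inv_equality)

lemma generators_induct [consumes 1, case_names s t mult]:
  assumes "g \<in> carrier G" "P s" "P t"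
    "\<And>g h. g \<in> carrier G \<Longrightarrow> h \<in> carrier G \<Longrightarrow> P g \<Longrightarrow> P h \<Longrightarrow> P (g \<otimes> h)"
  shows "P g"
proof -
  have "g \<in> generate G {s, t}" using assms(1) generated by simp
  then show ?thesis
  proof (induction rule: generate.induct)
    case one
    then show ?case using assms(4)[of s s] assms(2) s_s by simp
  next
    case (incl h)
    then show ?case using assms(2,3) by auto
  next
    case (inv h)
    then show ?case using assms(2,3) inv_s inv_t by auto
  next
    case (eng h1 h2)
    then show ?case using assms(4) generated by simp
  qed
qed

lemma swap_closed [simp]: "g \<in> carrier G \<Longrightarrow> \<theta> g \<in> carrier G"
  using swap_hom by (rule hom_in_carrier)

lemma swap_mult: "g \<in> carrier G \<Longrightarrow> h \<in> carrier G \<Longrightarrow> \<theta> (g \<otimes> h) = \<theta> g \<otimes> \<theta> h"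
  using swap_hom by (rule hom_mult)

lemma swap_swap [simp]: "g \<in> carrier G \<Longrightarrow> \<theta> (\<theta> g) = g"
  by (induction rule: generators_induct) (simp_all add: swap_s swap_t swap_mult)

lemma swap_one [simp]: "\<theta> \<one> = \<one>"
  using hom_one[OF swap_hom is_group is_group] .

lemma swap_inv: "g \<in> carrier G \<Longrightarrow> \<theta> (inv g) = inv (\<theta> g)"
  using group_hom.hom_inv[of G G \<theta> g] swap_hom is_group
  by (simp add: group_hom_def group_hom_axioms_def)

text \<open>The action of \<open>\<int>\<^sub>2\<close> through \<open>\<theta>\<close>, where \<open>True\<close> is the neutral element and \<open>=\<close> the group law.\<close>

definition tw :: "bool \<Rightarrow> 'g \<Rightarrow> 'g" where
  "tw y g = (if y then g else \<theta> g)"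

lemma tw_closed [simp]: "g \<in> carrier G \<Longrightarrow> tw y g \<in> carrier G"
  by (simp add: tw_def)

lemma tw_tw [simp]: "g \<in> carrier G \<Longrightarrow> tw x (tw y g) = tw (x = y) g"
  by (simp add: tw_def)

lemma tw_True [simp]: "tw True g = g"
  by (simp add: tw_def)

lemma tw_mult: "g \<in> carrier G \<Longrightarrow> h \<in> carrier G \<Longrightarrow> tw y (g \<otimes> h) = tw y g \<otimes> tw y h"
  by (simp add: tw_def swap_mult)

lemma tw_inv: "g \<in> carrier G \<Longrightarrow> tw y (inv g) = inv (tw y g)"
  by (simp add: tw_def swap_inv)

lemma tw_one [simp]: "tw y \<one> = \<one>"
  by (simp add: tw_def)

subsection \<open>Word length\<close>

lemma s_neq_one: "s \<noteq> \<one>" and t_neq_one: "t \<noteq> \<one>" and s_neq_t: "s \<noteq> t"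
  and st_neq_one: "s \<otimes> t \<noteq> \<one>" and ts_neq_one: "t \<otimes> s \<noteq> \<one>"
proof -
  show "s \<noteq> \<one>" "t \<noteq> \<one>" "s \<noteq> t" using noncommuting by auto
  have "t = inv s" if "s \<otimes> t = \<one>" using that by (metis inv_equality inv_inv s_closed t_closed)
  moreover have "s = inv t" if "t \<otimes> s = \<one>" using that by (metis inv_equality inv_inv s_closed t_closed)
  ultimately show "s \<otimes> t \<noteq> \<one>" "t \<otimes> s \<noteq> \<one>"
    using noncommuting inv_s inv_t by auto
qed

text \<open>
  The words over which \<open>word_length\<close> takes a minimum.
\<close>

definition spells :: "'g list \<Rightarrow> 'g \<Rightarrow> bool" where
  "spells ws g \<longleftrightarrow> set ws \<subseteq> {s, t} \<and> foldr (\<otimes>) ws \<one> = g"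

lemma foldr_closed: "set ws \<subseteq> {s, t} \<Longrightarrow> foldr (\<otimes>) ws \<one> \<in> carrier G"
  by (induction ws) auto

lemma foldr_append: "set ws \<subseteq> {s, t} \<Longrightarrow> set vs \<subseteq> {s, t} \<Longrightarrow>
    foldr (\<otimes>) (ws @ vs) \<one> = foldr (\<otimes>) ws \<one> \<otimes> foldr (\<otimes>) vs \<one>"
  by (induction ws) (auto simp: foldr_closed m_assoc)

lemma ex_spells: "g \<in> carrier G \<Longrightarrow> \<exists>ws. spells ws g"
proof (induction rule: generators_induct)
  case s
  show ?case by (rule exI[of _ "[s]"]) (simp add: spells_def)
next
  case t
  show ?case by (rule exI[of _ "[t]"]) (simp add: spells_def)
next
  case (mult g h)
  then obtain ws vs where "spells ws g" "spells vs h" by auto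
  then have "spells (ws @ vs) (g \<otimes> h)"
    using foldr_append unfolding spells_def by auto
  then show ?case ..
qed

text \<open>
  The automorphism permutes the generating set, so it acts letter by letter on words.
\<close>

lemma spells_swap: "spells ws g \<Longrightarrow> spells (map \<theta> ws) (\<theta> g)"
proof (induction ws arbitrary: g)
  case (Cons w ws)
  then have "spells ws (foldr (\<otimes>) ws \<one>)" and w: "w \<in> {s, t}" and g: "g = w \<otimes> foldr (\<otimes>) ws \<one>"
    and ws: "set ws \<subseteq> {s, t}"
    by (auto simp: spells_def)
  then have "spells (map \<theta> ws) (\<theta> (foldr (\<otimes>) ws \<one>))" using Cons.IH by blast
  then show ?case
    using w g foldr_closed[OF ws] by (auto simp: spells_def swap_mult swap_s swap_t)
qed (simp add: spells_def)

lemma word_length_eq: "word_length G {s, t} g = (LEAST r. \<exists>ws. length ws = r \<and> spells ws g)"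
  by (simp add: word_length_def spells_def)

lemma word_length_swap: "g \<in> carrier G \<Longrightarrow> word_length G {s, t} (\<theta> g) = word_length G {s, t} g"
proof -
  assume g: "g \<in> carrier G"
  have "(\<exists>ws. length ws = r \<and> spells ws (\<theta> g)) \<longleftrightarrow> (\<exists>ws. length ws = r \<and> spells ws g)" for r
    using spells_swap[of _ g] spells_swap[of _ "\<theta> g"] swap_swap[OF g] by (metis length_map)
  then show ?thesis by (simp add: word_length_eq)
qed

lemma word_length_tw: "g \<in> carrier G \<Longrightarrow> word_length G {s, t} (tw y g) = word_length G {s, t} g"
  by (simp add: tw_def word_length_swap)

lemma word_length_spells:
  assumes "g \<in> carrier G"
  obtains ws where "length ws = word_length G {s, t} g" "spells ws g"
  using LeastI_ex[of "\<lambda>r. \<exists>ws. length ws = r \<and> spells ws g"] ex_spells[OF assms]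
  by (auto simp: word_length_eq)

lemma word_length_0_iff: "g \<in> carrier G \<Longrightarrow> word_length G {s, t} g = 0 \<longleftrightarrow> g = \<one>"
proof
  assume "g \<in> carrier G" "word_length G {s, t} g = 0"
  then show "g = \<one>" by (metis word_length_spells length_0_conv spells_def foldr.simps(1) id_apply)
next
  assume "g = \<one>"
  then have "\<exists>ws. length ws = 0 \<and> spells ws g" by (simp add: spells_def)
  then show "word_length G {s, t} g = 0" by (simp add: word_length_eq)
qed

lemma word_length_1_iff: "g \<in> carrier G \<Longrightarrow> word_length G {s, t} g = 1 \<longleftrightarrow> g \<in> {s, t}"
proof
  assume g: "g \<in> carrier G" "word_length G {s, t} g = 1"
  then obtain ws where ws: "length ws = 1" "spells ws g" by (metis word_length_spells)
  then obtain w where "ws = [w]" by (metis One_nat_def length_0_conv length_Suc_conv)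
  then show "g \<in> {s, t}" using ws by (auto simp: spells_def)
next
  assume g: "g \<in> carrier G" "g \<in> {s, t}"
  then have "spells [g] g" by (auto simp: spells_def)
  then have "\<exists>ws. length ws = 1 \<and> spells ws g" by (intro exI[of _ "[g]"]) simp
  then have "word_length G {s, t} g \<le> 1" unfolding word_length_eq by (rule Least_le)
  moreover have "word_length G {s, t} g \<noteq> 0"
    using word_length_0_iff[OF g(1)] g(2) s_neq_one t_neq_one by auto
  ultimately show "word_length G {s, t} g = 1" by linarith
qed

subsection \<open>The reduced group algebra\<close>

abbreviation lam where "lam \<equiv> left_regular G"

lemma left_regular_mult:
  assumes "g \<in> carrier G" "h \<in> carrier G"
  shows "op_mult (lam g) (lam h) = lam (g \<otimes> h)"
proof (intro ext)
  fix i j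
  have "op_mult (lam g) (lam h) i j = lam g i (h \<otimes> j) * lam h (h \<otimes> j) j"
    unfolding op_mult_def by (rule infsum_single) (auto simp: left_regular_def)
  also have "\<dots> = lam (g \<otimes> h) i j"
    using assms by (auto simp: left_regular_def m_assoc)
  finally show "op_mult (lam g) (lam h) i j = lam (g \<otimes> h) i j" .
qed

lemma left_regular_adj: "g \<in> carrier G \<Longrightarrow> op_adj (lam g) = lam (inv g)"
  by (intro ext) (auto simp: op_adj_def left_regular_def simp flip: m_assoc)

lemma left_regular_l2: "l2_matrix (lam g)"
  unfolding l2_matrix_def
  by (intro conjI allI square_summable_finite_support finite_subset[OF _ finite_carrier])
    (auto simp: left_regular_def)

lemma left_regular_frame: "entry_frame (carrier G) lam (\<lambda>g. (g, \<one>))"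
  using finite_carrier by (auto simp: entry_frame_def left_regular_l2) (auto simp: left_regular_def)

abbreviation B where "B \<equiv> reduced_group_cstar G"

lemma reduced_eq: "B = l2op.span (lam ` carrier G)"
  unfolding reduced_group_cstar_def by (rule norm_closure_frame[OF left_regular_frame])

lemma left_regular_in: "g \<in> carrier G \<Longrightarrow> lam g \<in> B"
  unfolding reduced_eq by (auto intro: l2op.span_base)

lemma reduced_mult: "x \<in> B \<Longrightarrow> y \<in> B \<Longrightarrow> op_mult x y \<in> B"
  unfolding reduced_eq
  by (rule op_mult_span_closed)
    (auto simp: left_regular_l2 left_regular_mult intro!: l2op.span_base)

lemma reduced_adj: "x \<in> B \<Longrightarrow> op_adj x \<in> B"
  unfolding reduced_eq
  by (rule op_adj_span_closed) (auto simp: left_regular_adj intro!: l2op.span_base)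

lemma reduced_l2: "x \<in> B \<Longrightarrow> l2_matrix x"
  unfolding reduced_eq by (erule l2_matrix_span) (auto simp: left_regular_l2)

lemma reduced_unit: "alg_unit B = lam \<one>"
  unfolding reduced_eq
  by (rule alg_unit_span)
    (use left_regular_in in \<open>auto simp: left_regular_l2 left_regular_mult reduced_eq\<close>)

end

section \<open>Two copies of the group algebra\<close>

lemma sum_bool: "(\<Sum>y\<in>UNIV. f y) = f True + (f False :: 'a :: comm_monoid_add)"
  by (simp add: UNIV_bool add.commute)

text \<open>
  The doubling in coordinates, realised on any index type: \<open>u (g, True)\<close> and
  \<open>u (g, False)\<close> are the copies \<open>\<xi> g\<close> and \<open>\<eta> g\<close> of \<open>g\<close>. In the notation of
  \<open>tw\<close> the two formulas for the coproduct of the doubling become a single one.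
\<close>

locale doubled_group_algebra = swapped_involutions G s t \<theta>
  for G :: "('g, 'm) monoid_scheme" (structure) and s t \<theta> +
  fixes Q :: "'k cqg" and u :: "'g \<times> bool \<Rightarrow> 'k l2op" and p :: "'g \<times> bool \<Rightarrow> 'k \<times> 'k"
  assumes frame: "entry_frame (carrier G \<times> UNIV) u p"
    and alg_eq: "alg Q = l2op.span (u ` (carrier G \<times> UNIV))"
    and u_bounded: "g \<in> carrier G \<Longrightarrow> bounded_op (u (g, x))"
    and u_mult: "g \<in> carrier G \<Longrightarrow> h \<in> carrier G \<Longrightarrow>
      op_mult (u (g, x)) (u (h, y)) = (if x = y then u (g \<otimes> h, x) else 0)"
    and u_adj: "g \<in> carrier G \<Longrightarrow> op_adj (u (g, x)) = u (inv g, x)"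
    and comult_add: "a \<in> alg Q \<Longrightarrow> b \<in> alg Q \<Longrightarrow> comult Q (a + b) = comult Q a + comult Q b"
    and comult_scale: "a \<in> alg Q \<Longrightarrow> comult Q (op_scale c a) = op_scale c (comult Q a)"
    and comult_u: "g \<in> carrier G \<Longrightarrow>
      comult Q (u (g, x)) = (\<Sum>y\<in>UNIV. op_tensor (u (g, y)) (u (tw y g, x = y)))"
begin

abbreviation K where "K \<equiv> carrier G \<times> (UNIV :: bool set)"
abbreviation A where "A \<equiv> alg Q"
abbreviation AA where "AA \<equiv> spatial_tensor A A"
abbreviation BA where "BA \<equiv> spatial_tensor B A"

lemma u_l2: "g \<in> carrier G \<Longrightarrow> l2_matrix (u (g, x))"
  using u_bounded by (rule bounded_op_l2_matrix)

lemma u_in: "g \<in> carrier G \<Longrightarrow> u (g, x) \<in> A"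
  unfolding alg_eq by (auto intro: l2op.span_base)

lemma A_l2: "a \<in> A \<Longrightarrow> l2_matrix a"
  unfolding alg_eq by (erule l2_matrix_span) (auto simp: u_l2)

lemma A_mult: "a \<in> A \<Longrightarrow> b \<in> A \<Longrightarrow> op_mult a b \<in> A"
  unfolding alg_eq
  by (rule op_mult_span_closed)
    (use u_in in \<open>auto simp: u_l2 u_mult alg_eq l2op.span_zero\<close>)

lemma A_adj: "a \<in> A \<Longrightarrow> op_adj a \<in> A"
  unfolding alg_eq
  by (rule op_adj_span_closed) (use u_in in \<open>auto simp: u_adj alg_eq\<close>)

definition e where "e = (\<Sum>y\<in>UNIV. u (\<one>, y))"

lemma e_in: "e \<in> A"
  unfolding e_def alg_eq by (intro l2op.span_sum l2op.span_base) auto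

lemma e_u: "g \<in> carrier G \<Longrightarrow> op_mult e (u (g, x)) = u (g, x)"
  and u_e: "g \<in> carrier G \<Longrightarrow> op_mult (u (g, x)) e = u (g, x)"
  by (cases x; simp add: e_def sum_bool op_mult_add_left op_mult_add_right u_l2 u_mult)+

lemma e_unit: "a \<in> A \<Longrightarrow> op_mult e a = a \<and> op_mult a e = a"
  unfolding alg_eq
  by (rule unit_on_span[OF _ A_l2[OF e_in]]) (auto simp: u_l2 e_u u_e)

lemma alg_unit_A: "alg_unit A = e"
  using e_in e_unit by (rule alg_unit_eqI)

lemma A_cstar: "unital_cstar_algebra A"
  unfolding unital_cstar_algebra_def
proof (intro conjI ballI)
  show "bounded_op a" if "a \<in> A" for a
    using that unfolding alg_eq by (rule bounded_op_span) (auto simp: u_bounded)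
  show "l2op.subspace A" unfolding alg_eq by (rule l2op.subspace_span)
  show "norm_closure A \<subseteq> A" unfolding alg_eq norm_closure_frame[OF frame] by simp
  show "\<exists>e\<in>A. \<forall>a\<in>A. op_mult e a = a \<and> op_mult a e = a" using e_in e_unit by blast
qed (simp_all add: A_mult A_adj)

lemma AA_eq: "AA = l2op.span ((\<lambda>(k, l). op_tensor (u k) (u l)) ` (K \<times> K))"
  unfolding alg_eq by (rule spatial_tensor_frame[OF frame frame])

lemma BA_eq: "BA = l2op.span ((\<lambda>(k, l). op_tensor (lam k) (u l)) ` (carrier G \<times> K))"
  unfolding alg_eq reduced_eq by (rule spatial_tensor_frame[OF left_regular_frame frame])

lemma AA_subspace: "l2op.subspace AA"
  unfolding AA_eq by (rule l2op.subspace_span)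

lemma BA_subspace: "l2op.subspace BA"
  unfolding BA_eq by (rule l2op.subspace_span)

lemma AA_l2: "x \<in> AA \<Longrightarrow> l2_matrix x"
  unfolding AA_eq by (erule l2_matrix_span) (auto intro!: l2_matrix_tensor u_l2)

lemma BA_l2: "x \<in> BA \<Longrightarrow> l2_matrix x"
  unfolding BA_eq by (erule l2_matrix_span) (auto intro!: l2_matrix_tensor u_l2 left_regular_l2)

lemma AA_unit: "alg_unit AA = op_tensor e e"
  by (rule alg_unit_tensor[OF frame frame alg_eq alg_eq e_in e_in]) (auto simp: e_u u_e)

lemma BA_unit: "alg_unit BA = op_tensor (lam \<one>) e"
  by (rule alg_unit_tensor[OF left_regular_frame frame reduced_eq alg_eq left_regular_in e_in])
    (auto simp: left_regular_mult e_u u_e)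

subsection \<open>The coproduct\<close>

lemma comult_star_hom: "star_hom A AA (comult Q)"
proof -
  let ?f = "\<lambda>k. comult Q (u k)"
  let ?F = "frame_map K p ?f"
  note basis = frame_map_basis[OF frame]
  have "star_hom (l2op.span (u ` K)) AA ?F"
  proof (rule star_hom_frame_map[OF frame])
    show "l2op.subspace AA" by (rule AA_subspace)
    show "?f k \<in> AA" if k: "k \<in> K" for k
      using that
      by (auto simp: comult_u intro!: l2op.subspace_sum[OF AA_subspace] op_tensor_in_spatial u_in)
    then show "l2_matrix (?f k)" if k: "k \<in> K" for k using AA_l2 that by blast
    fix k l assume "k \<in> K" "l \<in> K"
    then obtain g x h y where kl: "k = (g, x)" "l = (h, y)" "g \<in> carrier G" "h \<in> carrier G" by auto
    have "?F (op_mult (u k) (u l)) = (if x = y then ?f (g \<otimes> h, x) else 0)"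
      using kl basis[of "(g \<otimes> h, x)" ?f] by (auto simp: u_mult frame_map_zero)
    also have "\<dots> = op_mult (?f k) (?f l)"
      using kl by (cases x; cases y)
        (simp_all add: comult_u sum_bool op_mult_add_left op_mult_add_right op_mult_tensor
          l2_matrix_tensor l2_matrix_add u_l2 u_mult tw_mult)
    finally show "?F (op_mult (u k) (u l)) = op_mult (?f k) (?f l)" .
  next
    fix k assume "k \<in> K"
    then obtain g x where k: "k = (g, x)" "g \<in> carrier G" by auto
    then show "?F (op_adj (u k)) = op_adj (?f k)"
      using basis[of "(inv g, x)" ?f]
      by (simp add: u_adj comult_u sum_bool op_adj_add op_adj_tensor tw_inv)
  qed
  then show ?thesis
    unfolding alg_eq
  proof (rule star_hom_cong)
    fix a assume a: "a \<in> l2op.span (u ` K)"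
    show "comult Q a = ?F a"
      by (rule linear_on_eq_on_span[of "u ` K" "comult Q" ?F a])
        (use a comult_add comult_scale basis[of _ ?f] in \<open>auto simp: alg_eq frame_map_add frame_map_scale\<close>)
  qed (use A_mult A_adj in \<open>simp_all add: alg_eq\<close>)
qed

lemma comult_unital: "unital_star_hom A AA (comult Q)"
  using comult_star_hom comult_add[OF u_in u_in, of \<one> \<one> True False]
  by (simp add: unital_star_hom_def alg_unit_A AA_unit)
    (simp add: e_def sum_bool comult_u op_tensor_add_left op_tensor_add_right ac_simps)

lemma star_hom_linear:
  assumes "star_hom A C \<phi>"
  shows "a \<in> A \<Longrightarrow> b \<in> A \<Longrightarrow> \<phi> (a + b) = \<phi> a + \<phi> b"
    and "a \<in> A \<Longrightarrow> \<phi> (op_scale c a) = op_scale c (\<phi> a)"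
  using assms by (auto simp: star_hom_def)

lemma comult_coassoc:
  "\<exists>F H. tensor_hom A A AA A (comult Q) (\<lambda>x. x) F \<and> tensor_hom A A A AA (\<lambda>x. x) (comult Q) H \<and>
    (\<forall>a\<in>A. op_assoc (F (comult Q a)) = H (comult Q a))"
proof -
  obtain F where F: "tensor_hom A A AA A (comult Q) (\<lambda>x. x) F"
    using tensor_hom_frame[OF frame frame alg_eq alg_eq A_mult A_adj A_mult A_adj
        comult_star_hom star_hom_id AA_l2 A_l2] by blast
  obtain H where H: "tensor_hom A A A AA (\<lambda>x. x) (comult Q) H"
    using tensor_hom_frame[OF frame frame alg_eq alg_eq A_mult A_adj A_mult A_adj
        star_hom_id comult_star_hom A_l2 AA_l2] by blast
  have hF: "star_hom AA (spatial_tensor AA A) F" and hH: "star_hom AA (spatial_tensor A AA) H"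
    using F H by (simp_all add: tensor_hom_def)
  note lF = star_hom_linear[OF star_hom_comp[OF comult_star_hom hF]]
  note lH = star_hom_linear[OF star_hom_comp[OF comult_star_hom hH]]
  \<comment> \<open>both sides are \<open>\<Sum>\<^sub>y\<^sub>z u (g, z) \<otimes> u (tw z g, y = z) \<otimes> u (tw y g, x = y)\<close>\<close>
  have basis: "op_assoc (F (comult Q (u (g, x)))) = H (comult Q (u (g, x)))" if g: "g \<in> carrier G" for g x
  proof -
    have "F (comult Q (u (g, x))) = (\<Sum>y\<in>UNIV. op_tensor (comult Q (u (g, y))) (u (tw y g, x = y)))"
      by (subst comult_u[OF g], rule tensor_hom_sum[OF F]) (simp_all add: u_in g)
    moreover have "H (comult Q (u (g, x))) = (\<Sum>y\<in>UNIV. op_tensor (u (g, y)) (comult Q (u (tw y g, x = y))))"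
      by (subst comult_u[OF g], rule tensor_hom_sum[OF H]) (simp_all add: u_in g)
    ultimately show ?thesis
      using g
      by (cases x) (simp_all add: comult_u sum_bool op_tensor_add_left op_tensor_add_right
          op_assoc_add op_assoc_tensor tw_def ac_simps)
  qed
  have "op_assoc (F (comult Q a)) = H (comult Q a)" if a: "a \<in> A" for a
    by (rule linear_on_eq_on_span[of "u ` K" "\<lambda>a. op_assoc (F (comult Q a))" "\<lambda>a. H (comult Q a)" a])
      (use lF lH basis a in \<open>auto simp: alg_eq op_assoc_add op_assoc_scale\<close>)
  then show ?thesis using F H by blast
qed

lemma subset_closure_of_basis:
  assumes "\<And>k. k \<in> I \<Longrightarrow> w k \<in> X"
  shows "l2op.span (w ` I) \<subseteq> norm_closure (l2op.span X)"
proof -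
  have "l2op.span (w ` I) \<subseteq> l2op.span X" by (rule l2op.span_mono) (use assms in auto)
  also note norm_closure_superset
  finally show ?thesis .
qed

text \<open>
  Multiplying by \<open>1 \<otimes> u (h, y)\<close> annihilates one of the two summands of a coproduct, so every
  product of basis vectors is of the required form on the nose.
\<close>

lemma comult_dense_right:
  "AA \<subseteq> norm_closure (l2op.span {op_mult (comult Q a) (op_tensor (alg_unit A) b) | a b. a \<in> A \<and> b \<in> A})"
  unfolding AA_eq
proof (rule subset_closure_of_basis)
  fix k assume "k \<in> K \<times> K"
  then obtain g x h y where k: "k = ((g, x), (h, y))" "g \<in> carrier G" "h \<in> carrier G" by auto
  have "op_mult (comult Q (u (g, x = y))) (op_tensor e (u (inv (tw x g) \<otimes> h, y)))
      = op_tensor (u (g, x)) (u (h, y))"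
    using k A_l2[OF e_in]
    by (cases x; cases y) (simp_all add: comult_u sum_bool op_mult_add_left op_mult_tensor
        l2_matrix_tensor u_l2 u_mult u_e tw_def m_assoc[symmetric])
  then show "(case k of (k, l) \<Rightarrow> op_tensor (u k) (u l))
      \<in> {op_mult (comult Q a) (op_tensor (alg_unit A) b) | a b. a \<in> A \<and> b \<in> A}"
    using k u_in[of g "x = y"] u_in[of "inv (tw x g) \<otimes> h" y] unfolding alg_unit_A
    by (intro CollectI exI[of _ "u (g, x = y)"] exI[of _ "u (inv (tw x g) \<otimes> h, y)"]) simp
qed

lemma comult_dense_left:
  "AA \<subseteq> norm_closure (l2op.span {op_mult (comult Q a) (op_tensor b (alg_unit A)) | a b. a \<in> A \<and> b \<in> A})"
  unfolding AA_eq
proof (rule subset_closure_of_basis)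
  fix k assume "k \<in> K \<times> K"
  then obtain g x h y where k: "k = ((g, x), (h, y))" "g \<in> carrier G" "h \<in> carrier G" by auto
  have "op_mult (comult Q (u (tw x h, x = y))) (op_tensor (u (inv (tw x h) \<otimes> g, x)) e)
      = op_tensor (u (g, x)) (u (h, y))"
    using k A_l2[OF e_in]
    by (cases x; cases y) (simp_all add: comult_u sum_bool op_mult_add_left op_mult_tensor
        l2_matrix_tensor u_l2 u_mult u_e tw_def m_assoc[symmetric])
  then show "(case k of (k, l) \<Rightarrow> op_tensor (u k) (u l))
      \<in> {op_mult (comult Q a) (op_tensor b (alg_unit A)) | a b. a \<in> A \<and> b \<in> A}"
    using k u_in[of "tw x h" "x = y"] u_in[of "inv (tw x h) \<otimes> g" x] unfolding alg_unit_A
    by (intro CollectI exI[of _ "u (tw x h, x = y)"] exI[of _ "u (inv (tw x h) \<otimes> g, x)"]) simp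
qed

lemma compact_quantum_group: "compact_quantum_group Q"
  unfolding compact_quantum_group_def Let_def
  using A_cstar comult_unital comult_coassoc comult_dense_right comult_dense_left by blast

subsection \<open>The action on the reduced group algebra\<close>

text \<open>
  \<open>g \<mapsto> g \<otimes> \<xi>(g) + \<theta>(g) \<otimes> \<eta>(\<theta>(g))\<close>. The twist in the second summand is dictated by
  the convention for the coproduct of the doubling; with \<open>\<eta>(g)\<close> in its place coassociativity
  fails.
\<close>

definition act :: "'g l2op \<Rightarrow> ('g \<times> 'k) l2op" where
  "act = frame_map (carrier G) (\<lambda>g. (g, \<one>)) (\<lambda>g. \<Sum>y\<in>UNIV. op_tensor (lam (tw y g)) (u (tw y g, y)))"

lemma act_lam: "g \<in> carrier G \<Longrightarrow> act (lam g) = (\<Sum>y\<in>UNIV. op_tensor (lam (tw y g)) (u (tw y g, y)))"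
  unfolding act_def by (rule frame_map_basis[OF left_regular_frame])

lemma act_add: "act (a + b) = act a + act b"
  and act_scale: "act (op_scale c a) = op_scale c (act a)"
  by (simp_all add: act_def frame_map_add frame_map_scale)

lemma act_star_hom: "star_hom B BA act"
proof -
  let ?f = "\<lambda>g. \<Sum>y\<in>UNIV. op_tensor (lam (tw y g)) (u (tw y g, y))"
  have "star_hom (l2op.span (lam ` carrier G)) BA act"
    unfolding act_def
  proof (rule star_hom_frame_map[OF left_regular_frame], fold act_def)
    show "l2op.subspace BA" by (rule BA_subspace)
    show "?f g \<in> BA" if "g \<in> carrier G" for g
      using that
      by (auto intro!: l2op.subspace_sum[OF BA_subspace] op_tensor_in_spatial u_in left_regular_in)
    then show "l2_matrix (?f g)" if "g \<in> carrier G" for g using BA_l2 that by blast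
    show "act (op_mult (lam g) (lam h)) = op_mult (?f g) (?f h)"
      if "g \<in> carrier G" "h \<in> carrier G" for g h
      using that by (simp add: left_regular_mult act_lam sum_bool op_mult_add_left op_mult_add_right
          op_mult_tensor l2_matrix_tensor l2_matrix_add left_regular_l2 u_l2 u_mult tw_mult)
    show "act (op_adj (lam g)) = op_adj (?f g)" if "g \<in> carrier G" for g
      using that by (simp add: left_regular_adj act_lam sum_bool op_adj_add op_adj_tensor u_adj tw_inv)
  qed
  then show ?thesis by (simp add: reduced_eq)
qed

lemma act_coassoc:
  "\<exists>F H. tensor_hom B A BA A act (\<lambda>x. x) F \<and> tensor_hom B A B AA (\<lambda>x. x) (comult Q) H \<and>
    (\<forall>b\<in>B. op_assoc (F (act b)) = H (act b))"
proof -
  obtain F where F: "tensor_hom B A BA A act (\<lambda>x. x) F"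
    using tensor_hom_frame[OF left_regular_frame frame reduced_eq alg_eq reduced_mult reduced_adj
        A_mult A_adj act_star_hom star_hom_id BA_l2 A_l2] by blast
  obtain H where H: "tensor_hom B A B AA (\<lambda>x. x) (comult Q) H"
    using tensor_hom_frame[OF left_regular_frame frame reduced_eq alg_eq reduced_mult reduced_adj
        A_mult A_adj star_hom_id comult_star_hom reduced_l2 AA_l2] by blast
  have hF: "star_hom BA (spatial_tensor BA A) F" and hH: "star_hom BA (spatial_tensor B AA) H"
    using F H by (simp_all add: tensor_hom_def)
  have lF: "star_hom B (spatial_tensor BA A) (\<lambda>a. F (act a))"
    by (rule star_hom_comp[OF act_star_hom hF])
  have lH: "star_hom B (spatial_tensor B AA) (\<lambda>a. H (act a))"
    by (rule star_hom_comp[OF act_star_hom hH])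
  have basis: "op_assoc (F (act (lam g))) = H (act (lam g))" if g: "g \<in> carrier G" for g
  proof -
    have "F (act (lam g)) = (\<Sum>y\<in>UNIV. op_tensor (act (lam (tw y g))) (u (tw y g, y)))"
      by (subst act_lam[OF g], rule tensor_hom_sum[OF F]) (simp_all add: u_in g left_regular_in)
    moreover have "H (act (lam g)) = (\<Sum>y\<in>UNIV. op_tensor (lam (tw y g)) (comult Q (u (tw y g, y))))"
      by (subst act_lam[OF g], rule tensor_hom_sum[OF H]) (simp_all add: u_in g left_regular_in)
    ultimately show ?thesis
      using g by (simp add: comult_u act_lam sum_bool op_tensor_add_left op_tensor_add_right
          op_assoc_add op_assoc_tensor tw_def ac_simps)
  qed
  have "op_assoc (F (act a)) = H (act a)" if a: "a \<in> B" for a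
    by (rule linear_on_eq_on_span[of "lam ` carrier G" "\<lambda>a. op_assoc (F (act a))" "\<lambda>a. H (act a)" a])
      (use lF lH basis a in \<open>auto simp: reduced_eq star_hom_def op_assoc_add op_assoc_scale\<close>)
  then show ?thesis using F H by blast
qed

lemma act_dense:
  "BA \<subseteq> norm_closure (l2op.span {op_mult (act b) (op_tensor (alg_unit B) q) | b q. b \<in> B \<and> q \<in> A})"
  unfolding BA_eq
proof (rule subset_closure_of_basis)
  fix k assume "k \<in> carrier G \<times> K"
  then obtain g h y where k: "k = (g, (h, y))" "g \<in> carrier G" "h \<in> carrier G" by auto
  have "op_mult (act (lam (tw y g))) (op_tensor (lam \<one>) (u (inv g \<otimes> h, y)))
      = op_tensor (lam g) (u (h, y))"
    using k by (cases y) (simp_all add: act_lam sum_bool op_mult_add_left op_mult_tensor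
        l2_matrix_tensor u_l2 left_regular_l2 left_regular_mult u_mult tw_def m_assoc[symmetric])
  then show "(case k of (k, l) \<Rightarrow> op_tensor (lam k) (u l))
      \<in> {op_mult (act b) (op_tensor (alg_unit B) q) | b q. b \<in> B \<and> q \<in> A}"
    using k u_in[of "inv g \<otimes> h" y] left_regular_in[of "tw y g"] unfolding reduced_unit
    by (intro CollectI exI[of _ "lam (tw y g)"] exI[of _ "u (inv g \<otimes> h, y)"]) simp
qed

lemma act_action: "cqg_action B Q act"
  unfolding cqg_action_def Let_def unital_star_hom_def
  using act_star_hom act_coassoc act_dense
  by (simp add: reduced_unit BA_unit act_lam)
    (simp add: e_def op_tensor_sum_right)

lemma trace_slice_add: "trace_slice G (x + y) = trace_slice G x + trace_slice G y"
  and trace_slice_scale: "trace_slice G (op_scale c x) = op_scale c (trace_slice G x)"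
  by (simp_all add: trace_slice_def op_scale_def fun_eq_iff plus_fun_apply)

lemma canonical_trace_add: "canonical_trace G (x + y) = canonical_trace G x + canonical_trace G y"
  and canonical_trace_scale: "canonical_trace G (op_scale c x) = c * canonical_trace G x"
  by (simp_all add: canonical_trace_def op_scale_def plus_fun_apply)

text \<open>
  Both summands of \<open>act (lam g)\<close> sit over group elements that are trivial only for trivial
  \<open>g\<close>, and over the identity they add up to the unit.
\<close>

lemma act_trace:
  assumes "x \<in> B"
  shows "trace_slice G (act x) = op_scale (canonical_trace G x) (alg_unit A)"
proof (rule linear_on_eq_on_span[of "lam ` carrier G" "\<lambda>x. trace_slice G (act x)"
      "\<lambda>x. op_scale (canonical_trace G x) (alg_unit A)"])
  fix y assume "y \<in> lam ` carrier G"
  then obtain g where g: "g \<in> carrier G" "y = lam g" by auto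
  have *: "trace_slice G (op_tensor (lam h) v) = op_scale (of_bool (h = \<one>)) v"
    if "h \<in> carrier G" for h v
    using that by (auto simp: trace_slice_def op_tensor_def left_regular_def op_scale_def fun_eq_iff)
  have "tw y (tw y g) = g" for y
    using g by (simp add: tw_def)
  then have "tw y g = \<one> \<longleftrightarrow> g = \<one>" for y
    using tw_one[of y] by metis
  moreover have "canonical_trace G (lam g) = of_bool (g = \<one>)"
    using g by (auto simp: canonical_trace_def left_regular_def)
  ultimately show "trace_slice G (act y) = op_scale (canonical_trace G y) (alg_unit A)"
    using g by (cases "g = \<one>") (simp_all add: act_lam sum_bool trace_slice_add * alg_unit_A e_def)
qed (use assms in \<open>simp_all add: act_add act_scale trace_slice_add trace_slice_scale
  canonical_trace_add canonical_trace_scale l2op.scale_left_distrib reduced_eq\<close>)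

lemma act_length:
  assumes "x \<in> l2op.span {lam g | g. g \<in> carrier G \<and> word_length G {s, t} g = r}"
  shows "act x \<in> l2op.span {op_tensor (lam g) q | g q. g \<in> carrier G \<and> word_length G {s, t} g = r \<and> q \<in> A}"
    (is "_ \<in> l2op.span ?Y")
  using assms
proof (induction rule: l2op.span_induct_alt)
  case base
  have "act 0 = 0" by (simp add: act_def frame_map_zero)
  then show ?case by (simp add: l2op.span_zero)
next
  case (step c x y)
  then obtain g where g: "x = lam g" "g \<in> carrier G" "word_length G {s, t} g = r" by auto
  have "act x \<in> l2op.span ?Y"
    unfolding g(1) act_lam[OF g(2)]
  proof (intro l2op.span_sum l2op.span_base CollectI)
    fix y :: bool
    show "\<exists>h q. op_tensor (lam (tw y g)) (u (tw y g, y)) = op_tensor (lam h) q \<and>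
        h \<in> carrier G \<and> word_length G {s, t} h = r \<and> q \<in> A"
      using g word_length_tw[OF g(2), of y] u_in[of "tw y g" y]
      by (intro exI[of _ "tw y g"] exI[of _ "u (tw y g, y)"]) simp
  qed
  then show ?case using step by (simp add: act_add act_scale l2op.span_add l2op.span_scale)
qed

lemma length_preserving: "length_preserving_action G {s, t} Q act"
  unfolding length_preserving_action_def
  using compact_quantum_group act_action act_trace act_length by blast

end

section \<open>Length-preserving actions\<close>

text \<open>
  The coefficient of \<open>left_regular G g\<close>: the matrix entry of the first tensor factor that
  determines it.
\<close>

definition slice :: "('g, 'm) monoid_scheme \<Rightarrow> 'g \<Rightarrow> ('g \<times> 'i) l2op \<Rightarrow> 'i l2op" where
  "slice G g x = (\<lambda>i j. x (g, i) (\<one>\<^bsub>G\<^esub>, j))"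

lemma slice_add: "slice G g (x + y) = slice G g x + slice G g y"
  by (simp add: slice_def fun_eq_iff plus_fun_apply)

lemma slice_one: "slice G \<one>\<^bsub>G\<^esub> = trace_slice G"
  by (simp add: slice_def trace_slice_def fun_eq_iff)

locale isometric_action = swapped_involutions G s t \<theta>
  for G :: "('g, 'm) monoid_scheme" (structure) and s t \<theta> +
  fixes R :: "'l cqg" and \<beta> :: "'g l2op \<Rightarrow> ('g \<times> 'l) l2op"
  assumes action: "length_preserving_action G {s, t} R \<beta>"
begin

abbreviation C where "C \<equiv> alg R"
abbreviation BC where "BC \<equiv> spatial_tensor B C"
abbreviation unit_C where "unit_C \<equiv> alg_unit C"
abbreviation prod_C (infixl "\<cdot>" 70) where "a \<cdot> b \<equiv> op_mult a b"

lemma cqg_R: "compact_quantum_group R" and action_R: "cqg_action B R \<beta>"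
  using action by (simp_all add: length_preserving_action_def)

lemma C_cstar: "unital_cstar_algebra C"
  using cqg_R by (simp add: compact_quantum_group_def Let_def)

lemma C_subspace: "l2op.subspace C"
  and C_bounded: "a \<in> C \<Longrightarrow> bounded_op a"
  and C_mult [simp]: "a \<in> C \<Longrightarrow> b \<in> C \<Longrightarrow> a \<cdot> b \<in> C"
  and C_adj: "a \<in> C \<Longrightarrow> op_adj a \<in> C"
  using C_cstar by (simp_all add: unital_cstar_algebra_def)

lemma C_l2 [simp]: "a \<in> C \<Longrightarrow> l2_matrix a"
  using C_bounded by (rule bounded_op_l2_matrix)

lemma C_zero [simp]: "0 \<in> C"
  using C_subspace by (rule l2op.subspace_0)

lemma C_add [simp]: "a \<in> C \<Longrightarrow> b \<in> C \<Longrightarrow> a + b \<in> C"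
  using C_subspace by (rule l2op.subspace_add)

lemma C_assoc: "a \<in> C \<Longrightarrow> b \<in> C \<Longrightarrow> c \<in> C \<Longrightarrow> a \<cdot> b \<cdot> c = a \<cdot> (b \<cdot> c)"
  by (simp add: op_mult_assoc C_bounded)

lemma C_unit_in [simp]: "unit_C \<in> C"
  and C_unit [simp]: "a \<in> C \<Longrightarrow> unit_C \<cdot> a = a" "a \<in> C \<Longrightarrow> a \<cdot> unit_C = a"
proof -
  obtain e where e: "e \<in> C" "\<forall>a\<in>C. e \<cdot> a = a \<and> a \<cdot> e = a"
    using C_cstar by (auto simp: unital_cstar_algebra_def)
  have "unit_C = e" by (rule alg_unit_eqI) (use e in auto)
  then show "unit_C \<in> C" "a \<in> C \<Longrightarrow> unit_C \<cdot> a = a" "a \<in> C \<Longrightarrow> a \<cdot> unit_C = a"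
    using e by auto
qed

lemma \<beta>_star_hom: "star_hom B BC \<beta>"
  using action_R by (simp add: cqg_action_def Let_def unital_star_hom_def)

lemma \<beta>_mult: "g \<in> carrier G \<Longrightarrow> h \<in> carrier G \<Longrightarrow> \<beta> (lam (g \<otimes> h)) = \<beta> (lam g) \<cdot> \<beta> (lam h)"
  using \<beta>_star_hom left_regular_in by (simp add: star_hom_def flip: left_regular_mult)

lemma \<beta>_adj: "g \<in> carrier G \<Longrightarrow> \<beta> (lam (inv g)) = op_adj (\<beta> (lam g))"
  using \<beta>_star_hom left_regular_in by (simp add: star_hom_def flip: left_regular_adj)

lemma slice_tensor [simp]:
  "g \<in> carrier G \<Longrightarrow> h \<in> carrier G \<Longrightarrow> slice G g (op_tensor (lam h) q) = (if g = h then q else 0)"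
  by (auto simp: slice_def op_tensor_def left_regular_def fun_eq_iff zero_fun_apply)

lemma \<beta>_length:
  assumes "g \<in> carrier G"
  shows "\<beta> (lam g) \<in> l2op.span {op_tensor (lam h) q | h q.
      h \<in> carrier G \<and> word_length G {s, t} h = word_length G {s, t} g \<and> q \<in> C}"
proof -
  have "lam g \<in> l2op.span {lam h | h. h \<in> carrier G \<and> word_length G {s, t} h = word_length G {s, t} g}"
    by (rule l2op.span_base) (use assms in auto)
  then show ?thesis using action unfolding length_preserving_action_def by simp
qed

lemma \<beta>_generator:
  assumes g: "g \<in> {s, t}"
  obtains a b where "a \<in> C" "b \<in> C" "\<beta> (lam g) = op_tensor (lam s) a + op_tensor (lam t) b"
proof -
  have gc: "g \<in> carrier G" using g by auto
  have "word_length G {s, t} g = 1" using word_length_1_iff[OF gc] g by blast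
  then have "\<beta> (lam g) \<in> l2op.span {op_tensor (lam h) q | h q.
      h \<in> carrier G \<and> word_length G {s, t} h = 1 \<and> q \<in> C}"
    using \<beta>_length[OF gc] by simp
  then have "\<exists>a\<in>C. \<exists>b\<in>C. \<beta> (lam g) = op_tensor (lam s) a + op_tensor (lam t) b"
  proof (induction rule: l2op.span_induct_alt)
    case base
    show ?case by (intro bexI[of _ 0]) simp_all
  next
    case (step c x y)
    then obtain h q where h: "x = op_tensor (lam h) q" "h \<in> {s, t}" "q \<in> C"
      using word_length_1_iff by blast
    obtain a b where ab: "a \<in> C" "b \<in> C" "y = op_tensor (lam s) a + op_tensor (lam t) b"
      using step by blast
    have cq: "op_scale c q \<in> C" using h(3) C_subspace by (simp add: l2op.subspace_scale)
    show ?case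
    proof (cases "h = s")
      case True
      then show ?thesis using h ab cq
        by (intro bexI[of _ "op_scale c q + a"] bexI[of _ b])
          (simp_all add: op_tensor_add_right op_tensor_scale_right add.assoc)
    next
      case False
      then show ?thesis using h ab cq
        by (intro bexI[of _ a] bexI[of _ "op_scale c q + b"])
          (simp_all add: op_tensor_add_right op_tensor_scale_right ac_simps)
    qed
  qed
  then show ?thesis using that by blast
qed

lemma trace_\<beta>: "g \<in> carrier G \<Longrightarrow> slice G \<one> (\<beta> (lam g)) = (if g = \<one> then unit_C else 0)"
  using action left_regular_in[of g]
  by (auto simp: slice_one length_preserving_action_def canonical_trace_def left_regular_def)

text \<open>
  Length zero leaves only one coefficient, and the trace identifies it as the unit.
\<close>

lemma \<beta>_one: "\<beta> (lam \<one>) = op_tensor (lam \<one>) unit_C"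
proof -
  have "word_length G {s, t} \<one> = 0" by (simp add: word_length_0_iff)
  then have "\<beta> (lam \<one>) \<in> l2op.span {op_tensor (lam h) q | h q.
      h \<in> carrier G \<and> word_length G {s, t} h = 0 \<and> q \<in> C}"
    using \<beta>_length[OF one_closed] by simp
  then have "\<exists>q\<in>C. \<beta> (lam \<one>) = op_tensor (lam \<one>) q"
  proof (induction rule: l2op.span_induct_alt)
    case base
    show ?case by (intro bexI[of _ 0]) simp_all
  next
    case (step c x y)
    then obtain q r where "x = op_tensor (lam \<one>) q" "q \<in> C" "y = op_tensor (lam \<one>) r" "r \<in> C"
      using word_length_0_iff by blast
    then show ?case
      using C_subspace by (intro bexI[of _ "op_scale c q + r"])
        (simp_all add: op_tensor_add_right op_tensor_scale_right l2op.subspace_scale)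
  qed
  then obtain q where "\<beta> (lam \<one>) = op_tensor (lam \<one>) q" by blast
  then show ?thesis using trace_\<beta>[OF one_closed] by simp
qed

subsection \<open>The coefficients of the two generators\<close>

text \<open>
  \<open>\<beta>(s) = s \<otimes> ca + t \<otimes> cb\<close> and \<open>\<beta>(t) = s \<otimes> cc + t \<otimes> cd\<close>.
\<close>

definition ca where "ca = slice G s (\<beta> (lam s))"
definition cb where "cb = slice G t (\<beta> (lam s))"
definition cc where "cc = slice G s (\<beta> (lam t))"
definition cd where "cd = slice G t (\<beta> (lam t))"

lemma \<beta>_s: "\<beta> (lam s) = op_tensor (lam s) ca + op_tensor (lam t) cb"
  and ca_in [simp]: "ca \<in> C" and cb_in [simp]: "cb \<in> C"
proof -
  obtain a b where *: "a \<in> C" "b \<in> C" "\<beta> (lam s) = op_tensor (lam s) a + op_tensor (lam t) b"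
    using \<beta>_generator[of s] by blast
  then have "ca = a" "cb = b" using s_neq_t by (simp_all add: ca_def cb_def slice_add)
  then show "\<beta> (lam s) = op_tensor (lam s) ca + op_tensor (lam t) cb" "ca \<in> C" "cb \<in> C"
    using * by auto
qed

lemma \<beta>_t: "\<beta> (lam t) = op_tensor (lam s) cc + op_tensor (lam t) cd"
  and cc_in [simp]: "cc \<in> C" and cd_in [simp]: "cd \<in> C"
proof -
  obtain a b where *: "a \<in> C" "b \<in> C" "\<beta> (lam t) = op_tensor (lam s) a + op_tensor (lam t) b"
    using \<beta>_generator[of t] by blast
  then have "cc = a" "cd = b" using s_neq_t by (simp_all add: cc_def cd_def slice_add)
  then show "\<beta> (lam t) = op_tensor (lam s) cc + op_tensor (lam t) cd" "cc \<in> C" "cd \<in> C"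
    using * by auto
qed

lemma coeff_adj: "op_adj ca = ca" "op_adj cb = cb" "op_adj cc = cc" "op_adj cd = cd"
proof -
  have s: "op_tensor (lam s) (op_adj ca) + op_tensor (lam t) (op_adj cb)
      = op_tensor (lam s) ca + op_tensor (lam t) cb"
    using \<beta>_adj[of s] by (simp add: inv_s inv_t \<beta>_s op_adj_add op_adj_tensor left_regular_adj)
  show "op_adj ca = ca" "op_adj cb = cb"
    using arg_cong[OF s, of "slice G s"] arg_cong[OF s, of "slice G t"] s_neq_t
    by (simp_all add: slice_add)
  have t: "op_tensor (lam s) (op_adj cc) + op_tensor (lam t) (op_adj cd)
      = op_tensor (lam s) cc + op_tensor (lam t) cd"
    using \<beta>_adj[of t] by (simp add: inv_s inv_t \<beta>_t op_adj_add op_adj_tensor left_regular_adj)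
  show "op_adj cc = cc" "op_adj cd = cd"
    using arg_cong[OF t, of "slice G s"] arg_cong[OF t, of "slice G t"] s_neq_t
    by (simp_all add: slice_add)
qed

lemma tensor_pair_mult:
  assumes "a \<in> C" "b \<in> C" "a' \<in> C" "b' \<in> C"
  shows "op_mult (op_tensor (lam s) a + op_tensor (lam t) b) (op_tensor (lam s) a' + op_tensor (lam t) b')
    = op_tensor (lam \<one>) (a \<cdot> a' + b \<cdot> b') + op_tensor (lam (s \<otimes> t)) (a \<cdot> b') + op_tensor (lam (t \<otimes> s)) (b \<cdot> a')"
  using assms
  by (simp add: op_mult_add_left op_mult_add_right op_mult_tensor l2_matrix_add l2_matrix_tensor
      left_regular_l2 left_regular_mult s_s t_t op_tensor_add_right ac_simps)

text \<open>
  Comparison of coefficients in \<open>\<beta>(g)\<^sup>2 = 1\<close>. The three group elements \<open>e\<close>, \<open>st\<close>, \<open>ts\<close> that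
  occur in the square are distinct because \<open>s\<close> and \<open>t\<close> do not commute.
\<close>

lemma square_relations:
  assumes "g \<in> {s, t}" "a \<in> C" "b \<in> C" "\<beta> (lam g) = op_tensor (lam s) a + op_tensor (lam t) b"
  shows "a \<cdot> a + b \<cdot> b = unit_C" "a \<cdot> b = 0" "b \<cdot> a = 0"
proof -
  have "g \<otimes> g = \<one>" "g \<in> carrier G" using assms(1) s_s t_t by auto
  then have "op_tensor (lam \<one>) (a \<cdot> a + b \<cdot> b) + op_tensor (lam (s \<otimes> t)) (a \<cdot> b)
      + op_tensor (lam (t \<otimes> s)) (b \<cdot> a) = op_tensor (lam \<one>) unit_C"
    using \<beta>_mult[of g g] by (simp add: \<beta>_one assms tensor_pair_mult)
  from this[THEN arg_cong, of "slice G \<one>"] this[THEN arg_cong, of "slice G (s \<otimes> t)"]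
    this[THEN arg_cong, of "slice G (t \<otimes> s)"]
  show "a \<cdot> a + b \<cdot> b = unit_C" "a \<cdot> b = 0" "b \<cdot> a = 0"
    using st_neq_one ts_neq_one noncommuting by (simp_all add: slice_add split: if_splits)
qed

lemmas s_relations = square_relations[of s, OF _ ca_in cb_in \<beta>_s, simplified]
lemmas t_relations = square_relations[of t, OF _ cc_in cd_in \<beta>_t, simplified]

text \<open>
  The coefficients of the identity in \<open>\<beta>(st)\<close> and \<open>\<beta>(ts)\<close>, which vanish since \<open>\<beta>\<close>
  preserves the trace.
\<close>

lemma trace_relations: "ca \<cdot> cc + cb \<cdot> cd = 0" "cc \<cdot> ca + cd \<cdot> cb = 0"
proof -
  have "slice G \<one> (\<beta> (lam (s \<otimes> t))) = ca \<cdot> cc + cb \<cdot> cd"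
    using st_neq_one ts_neq_one by (auto simp: \<beta>_mult \<beta>_s \<beta>_t tensor_pair_mult slice_add)
  then show "ca \<cdot> cc + cb \<cdot> cd = 0"
    using trace_\<beta>[of "s \<otimes> t"] st_neq_one by simp
  have "slice G \<one> (\<beta> (lam (t \<otimes> s))) = cc \<cdot> ca + cd \<cdot> cb"
    using st_neq_one ts_neq_one by (auto simp: \<beta>_mult \<beta>_s \<beta>_t tensor_pair_mult slice_add)
  then show "cc \<cdot> ca + cd \<cdot> cb = 0"
    using trace_\<beta>[of "t \<otimes> s"] ts_neq_one by simp
qed

lemma cube:
  assumes "a \<in> C" "b \<in> C" "a \<cdot> a + b \<cdot> b = unit_C" "a \<cdot> b = 0" "b \<cdot> a = 0"
  shows "a \<cdot> (a \<cdot> a) = a" "b \<cdot> (b \<cdot> b) = b"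
proof -
  have "a \<cdot> (a \<cdot> a + b \<cdot> b) = a \<cdot> (a \<cdot> a) + a \<cdot> b \<cdot> b"
    using assms(1,2) by (simp add: op_mult_add_right C_assoc)
  then show "a \<cdot> (a \<cdot> a) = a" using assms by simp
  have "b \<cdot> (a \<cdot> a + b \<cdot> b) = b \<cdot> a \<cdot> a + b \<cdot> (b \<cdot> b)"
    using assms(1,2) by (simp add: op_mult_add_right C_assoc)
  then show "b \<cdot> (b \<cdot> b) = b" using assms by simp
qed

lemmas s_cube = cube[OF ca_in cb_in s_relations]
lemmas t_cube = cube[OF cc_in cd_in t_relations]

text \<open>
  Multiplication by \<open>ca\<close> removes the second summand of \<open>trace_relations\<close>, since
  \<open>ca cb = 0\<close>; the factor \<open>ca\<^sup>2\<close> that remains is cancelled using \<open>ca\<^sup>3 = ca\<close>.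
\<close>

lemma cross_zero: "ca \<cdot> cc = 0" "cb \<cdot> cd = 0" "cc \<cdot> ca = 0" "cd \<cdot> cb = 0"
proof -
  have "ca \<cdot> (ca \<cdot> cc + cb \<cdot> cd) = ca \<cdot> (ca \<cdot> cc) + ca \<cdot> cb \<cdot> cd"
    by (simp add: op_mult_add_right C_assoc)
  then have "ca \<cdot> (ca \<cdot> cc) = 0" by (simp add: trace_relations s_relations)
  then have "ca \<cdot> (ca \<cdot> ca) \<cdot> cc = 0" by (simp add: C_assoc)
  then show ac: "ca \<cdot> cc = 0" by (simp add: s_cube)
  then show "cb \<cdot> cd = 0" using trace_relations by simp
  have "(cc \<cdot> ca + cd \<cdot> cb) \<cdot> ca = cc \<cdot> ca \<cdot> ca + cd \<cdot> (cb \<cdot> ca)"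
    by (simp add: op_mult_add_left C_assoc)
  then have *: "cc \<cdot> ca \<cdot> ca = 0" by (simp add: trace_relations s_relations)
  have "cc \<cdot> ca \<cdot> ca \<cdot> ca = cc \<cdot> (ca \<cdot> (ca \<cdot> ca))" by (simp add: C_assoc)
  then show "cc \<cdot> ca = 0" by (simp add: s_cube *)
  then show "cd \<cdot> cb = 0" using trace_relations by simp
qed

text \<open>
  With \<open>p + q = 1 = p' + q'\<close> and \<open>p p' = 0 = q q'\<close> one gets \<open>p = p q' = q'\<close>.
\<close>

lemma square_eq: "cd \<cdot> cd = ca \<cdot> ca" "cc \<cdot> cc = cb \<cdot> cb"
proof -
  let ?p = "ca \<cdot> ca" and ?q = "cb \<cdot> cb" and ?p' = "cc \<cdot> cc" and ?q' = "cd \<cdot> cd"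
  have "?p \<cdot> ?p' = ca \<cdot> (ca \<cdot> cc \<cdot> cc)" "?q \<cdot> ?q' = cb \<cdot> (cb \<cdot> cd \<cdot> cd)" by (simp_all add: C_assoc)
  then have 0: "?p \<cdot> ?p' = 0" "?q \<cdot> ?q' = 0" by (simp_all add: cross_zero)
  have "?p = ?p \<cdot> (?p' + ?q')" by (simp add: t_relations)
  also have "\<dots> = ?p \<cdot> ?q'" using 0 by (simp add: op_mult_add_right)
  also have "\<dots> = (?p + ?q) \<cdot> ?q'" using 0 by (simp add: op_mult_add_left)
  also have "\<dots> = ?q'" by (simp add: s_relations)
  finally show "?q' = ?p" ..
  have "?q = ?q \<cdot> (?p' + ?q')" by (simp add: t_relations)
  also have "\<dots> = ?q \<cdot> ?p'" using 0 by (simp add: op_mult_add_right)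
  also have "\<dots> = (?p + ?q) \<cdot> ?p'" using 0 by (simp add: op_mult_add_left)
  also have "\<dots> = ?p'" by (simp add: s_relations)
  finally show "?p' = ?q" ..
qed

subsection \<open>The coefficients of all group elements\<close>

text \<open>
  The two projections into which the unit splits.
\<close>

definition E :: "bool \<Rightarrow> 'l l2op" where
  "E y = (if y then ca \<cdot> ca else cb \<cdot> cb)"

lemma E_in [simp]: "E y \<in> C"
  by (simp add: E_def)

lemma E_sum: "E True + E False = unit_C"
  by (simp add: E_def s_relations)

lemma E_mult: "E x \<cdot> E y = (if x = y then E x else 0)"
proof -
  have "ca \<cdot> ca \<cdot> (ca \<cdot> ca) = ca \<cdot> (ca \<cdot> (ca \<cdot> ca))" "cb \<cdot> cb \<cdot> (cb \<cdot> cb) = cb \<cdot> (cb \<cdot> (cb \<cdot> cb))"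
    "ca \<cdot> ca \<cdot> (cb \<cdot> cb) = ca \<cdot> (ca \<cdot> cb \<cdot> cb)" "cb \<cdot> cb \<cdot> (ca \<cdot> ca) = cb \<cdot> (cb \<cdot> ca \<cdot> ca)"
    by (simp_all add: C_assoc)
  then show ?thesis by (auto simp: E_def s_relations s_cube)
qed

lemma E_adj: "op_adj (E y) = E y"
  by (simp add: E_def op_adj_mult coeff_adj)

text \<open>
  The shape of \<open>\<beta>(g)\<close> for every group element. When \<open>\<theta>(g) = g\<close> the two summands belong to
  the same group element and comparison of coefficients only yields \<open>f True + f False\<close>; the
  requirement that \<open>f y\<close> belongs to the corner of \<open>E y\<close> keeps them apart.
\<close>

definition coeffs :: "'g \<Rightarrow> (bool \<Rightarrow> 'l l2op) \<Rightarrow> bool" where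
  "coeffs g f \<longleftrightarrow> (\<forall>y. f y \<in> C \<and> E y \<cdot> f y = f y \<and> f y \<cdot> E y = f y) \<and>
     \<beta> (lam g) = (\<Sum>y\<in>UNIV. op_tensor (lam (tw y g)) (f y))"

lemma coeffs_orthogonal:
  assumes "coeffs g f" "coeffs h f'" "y \<noteq> z"
  shows "f y \<cdot> f' z = 0" "E y \<cdot> f' z = 0"
proof -
  have f: "f y \<in> C" "f y \<cdot> E y = f y" "f' z \<in> C" "E z \<cdot> f' z = f' z"
    using assms by (auto simp: coeffs_def)
  show "E y \<cdot> f' z = 0"
    using C_assoc[of "E y" "E z" "f' z"] f assms(3) by (simp add: E_mult)
  then show "f y \<cdot> f' z = 0"
    using C_assoc[of "f y" "E y" "f' z"] f by simp
qed

lemma coeffs_s: "coeffs s (\<lambda>y. if y then ca else cb)"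
  by (auto simp: coeffs_def sum_bool \<beta>_s tw_def swap_s E_def s_cube C_assoc)

lemma coeffs_t: "coeffs t (\<lambda>y. if y then cd else cc)"
proof -
  have "E True \<cdot> cd = cd" "cd \<cdot> E True = cd" "E False \<cdot> cc = cc" "cc \<cdot> E False = cc"
    unfolding E_def square_eq[symmetric] using t_cube by (simp_all add: C_assoc)
  then show ?thesis
    by (auto simp: coeffs_def sum_bool \<beta>_t tw_def swap_t add.commute)
qed

text \<open>
  In the product of two sums of this shape the mixed terms vanish, as the corners are
  orthogonal.
\<close>

lemma coeffs_mult:
  assumes g: "g \<in> carrier G" and h: "h \<in> carrier G" and f: "coeffs g f" and f': "coeffs h f'"
  shows "coeffs (g \<otimes> h) (\<lambda>y. f y \<cdot> f' y)"
proof -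
  have in_C: "f y \<in> C" "f' y \<in> C" "E y \<cdot> f y = f y" "f' y \<cdot> E y = f' y" for y
    using f f' by (auto simp: coeffs_def)
  have "f y \<cdot> f' y \<in> C \<and> E y \<cdot> (f y \<cdot> f' y) = f y \<cdot> f' y \<and> f y \<cdot> f' y \<cdot> E y = f y \<cdot> f' y" for y
    using in_C[of y] C_assoc[of "E y" "f y" "f' y"] C_assoc[of "f y" "f' y" "E y"] by simp
  moreover have "\<beta> (lam (g \<otimes> h)) = (\<Sum>y\<in>UNIV. op_tensor (lam (tw y (g \<otimes> h))) (f y \<cdot> f' y))"
    using f f' g h coeffs_orthogonal[OF f f', of True False] coeffs_orthogonal[OF f f', of False True]
    by (simp add: coeffs_def \<beta>_mult op_mult_tensor_sums in_C left_regular_l2 left_regular_mult)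
      (simp add: sum_bool tw_mult left_regular_mult)
  ultimately show ?thesis by (simp add: coeffs_def)
qed

lemma coeffs_adj:
  assumes g: "g \<in> carrier G" and f: "coeffs g f"
  shows "coeffs (inv g) (\<lambda>y. op_adj (f y))"
proof -
  have "op_adj (f y) \<in> C \<and> E y \<cdot> op_adj (f y) = op_adj (f y) \<and> op_adj (f y) \<cdot> E y = op_adj (f y)" for y
    using f op_adj_mult[of "E y" "f y"] op_adj_mult[of "f y" "E y"]
    by (simp add: coeffs_def E_adj C_adj)
  moreover have "\<beta> (lam (inv g)) = (\<Sum>y\<in>UNIV. op_tensor (lam (tw y (inv g))) (op_adj (f y)))"
    using f g by (simp add: coeffs_def \<beta>_adj sum_bool op_adj_add op_adj_tensor left_regular_adj tw_inv)
  ultimately show ?thesis by (simp add: coeffs_def)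
qed

lemma ex_coeffs: "g \<in> carrier G \<Longrightarrow> \<exists>f. coeffs g f"
  by (induction rule: generators_induct) (blast intro: coeffs_s coeffs_t coeffs_mult)+

text \<open>
  The image of \<open>u (g, y)\<close>. It occurs in \<open>\<beta>\<close> at \<open>tw y g\<close>, and the projection \<open>E y\<close> singles it
  out when both summands lie over \<open>g\<close>.
\<close>

definition P :: "'g \<times> bool \<Rightarrow> 'l l2op" where
  "P k = E (snd k) \<cdot> slice G (fst k) (\<beta> (lam (tw (snd k) (fst k))))"

lemma tw_twice: "g \<in> carrier G \<Longrightarrow> tw y (tw y g) = g"
  by (simp add: tw_def)

lemma coeffs_unique:
  assumes g: "g \<in> carrier G" and f: "coeffs g f"
  shows "f y = P (tw y g, y)"
proof -
  have "slice G (tw y g) (\<beta> (lam g)) = (\<Sum>z\<in>UNIV. if tw y g = tw z g then f z else 0)"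
    using f g by (simp add: coeffs_def sum_bool slice_add)
  moreover have "E y \<cdot> (\<Sum>z\<in>UNIV. if tw y g = tw z g then f z else 0) = f y"
    using f coeffs_orthogonal(2)[OF f f, of True False] coeffs_orthogonal(2)[OF f f, of False True]
    by (cases y) (auto simp: sum_bool coeffs_def op_mult_add_right)
  ultimately have "f y = E y \<cdot> slice G (tw y g) (\<beta> (lam g))" by simp
  then show ?thesis using g by (simp only: P_def fst_conv snd_conv tw_twice)
qed

lemma coeffs_P:
  assumes g: "g \<in> carrier G"
  shows "coeffs g (\<lambda>y. P (tw y g, y))"
proof -
  obtain f where f: "coeffs g f" using ex_coeffs[OF g] ..
  then have "f = (\<lambda>y. P (tw y g, y))" using coeffs_unique[OF g f] by auto
  then show ?thesis using f by simp
qed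

lemma P_in [simp]: "g \<in> carrier G \<Longrightarrow> P (g, y) \<in> C"
  using coeffs_P[of "tw y g"] by (auto simp: coeffs_def tw_twice dest!: spec[of _ y])

lemma \<beta>_P: "g \<in> carrier G \<Longrightarrow> \<beta> (lam g) = (\<Sum>y\<in>UNIV. op_tensor (lam (tw y g)) (P (tw y g, y)))"
  using coeffs_P[of g] by (simp add: coeffs_def)

lemma P_mult:
  assumes g: "g \<in> carrier G" and h: "h \<in> carrier G"
  shows "P (g, x) \<cdot> P (h, y) = (if x = y then P (g \<otimes> h, x) else 0)"
proof (cases "x = y")
  case True
  have "coeffs (tw x g \<otimes> tw x h) (\<lambda>z. P (tw z (tw x g), z) \<cdot> P (tw z (tw x h), z))"
    by (intro coeffs_mult coeffs_P tw_closed g h)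
  from coeffs_unique[OF _ this, of x] show ?thesis
    using True g h by (simp add: tw_twice flip: tw_mult)
next
  case False
  from coeffs_orthogonal(1)[OF coeffs_P[of "tw x g"] coeffs_P[of "tw y h"] this] show ?thesis
    using False g h by (simp add: tw_twice)
qed

lemma P_adj:
  assumes g: "g \<in> carrier G"
  shows "op_adj (P (g, x)) = P (inv g, x)"
  using coeffs_unique[OF _ coeffs_adj[OF _ coeffs_P[of "tw x g"]], of x] g
  by (simp add: tw_twice tw_inv)

lemma P_one: "P (\<one>, y) = E y"
  using coeffs_unique[OF _ coeffs_mult[OF _ _ coeffs_s coeffs_s], of y]
  by (simp add: s_s E_def split: if_splits)

subsection \<open>The coproduct of the coefficients\<close>

lemma \<Delta>_star_hom: "star_hom C (spatial_tensor C C) (comult R)"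
  using cqg_R by (simp add: compact_quantum_group_def Let_def unital_star_hom_def)

text \<open>
  Coassociativity at \<open>h = tw x g\<close> is an identity in \<open>B \<otimes> R \<otimes> R\<close>, whose coefficient over \<open>g\<close> is
  the claim. For \<open>g = s, t\<close> no other summand lies over \<open>g\<close>, because \<open>\<theta>(h) \<noteq> h\<close>.
\<close>

lemma comult_P_generator:
  assumes g: "g \<in> {s, t}"
  shows "comult R (P (g, x)) = (\<Sum>y\<in>UNIV. op_tensor (P (g, y)) (P (tw y g, x = y)))"
proof -
  define h where "h = tw x g"
  have h: "h \<in> carrier G" "\<theta> h \<noteq> h" "g = tw x h" "g \<in> carrier G"
    using g s_neq_t by (auto simp: h_def tw_def swap_s swap_t)
  obtain F H where F: "tensor_hom B C BC C \<beta> (\<lambda>x. x) F"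
    and H: "tensor_hom B C B (spatial_tensor C C) (\<lambda>x. x) (comult R) H"
    and FH: "\<forall>b\<in>B. op_assoc (F (\<beta> b)) = H (\<beta> b)"
    using action_R by (auto simp: cqg_action_def Let_def)
  have "F (\<beta> (lam h)) = (\<Sum>y\<in>UNIV. op_tensor (\<beta> (lam (tw y h))) (P (tw y h, y)))"
    by (subst \<beta>_P[OF h(1)], rule tensor_hom_sum[OF F]) (simp_all add: h left_regular_in)
  moreover have "H (\<beta> (lam h)) = (\<Sum>y\<in>UNIV. op_tensor (lam (tw y h)) (comult R (P (tw y h, y))))"
    by (subst \<beta>_P[OF h(1)], rule tensor_hom_sum[OF H]) (simp_all add: h left_regular_in)
  moreover have "H (\<beta> (lam h)) = op_assoc (F (\<beta> (lam h)))"
    using FH left_regular_in[OF h(1)] by simp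
  ultimately have "(\<Sum>y\<in>UNIV. op_tensor (lam (tw y h)) (comult R (P (tw y h, y))))
      = (\<Sum>y\<in>UNIV. \<Sum>z\<in>UNIV. op_tensor (lam (tw z (tw y h)))
          (op_tensor (P (tw z (tw y h), z)) (P (tw y h, y))))"
    using h(1)
    by (simp add: \<beta>_P[of "tw _ h"] op_tensor_sum_left op_assoc_sum op_assoc_tensor)
  from arg_cong[OF this, of "slice G g"] show ?thesis
    using h by (cases x) (simp_all add: sum_bool slice_add tw_def ac_simps)
qed

text \<open>
  Both sides are multiplicative in \<open>g\<close>, the right-hand side by orthogonality of the two
  copies; so the generators suffice.
\<close>

lemma comult_P:
  assumes "g \<in> carrier G"
  shows "comult R (P (g, x)) = (\<Sum>y\<in>UNIV. op_tensor (P (g, y)) (P (tw y g, x = y)))"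
  using assms
proof (induction rule: generators_induct)
  case (mult g h)
  have "comult R (P (g \<otimes> h, x)) = comult R (P (g, x) \<cdot> P (h, x))"
    using mult by (simp add: P_mult)
  also have "\<dots> = comult R (P (g, x)) \<cdot> comult R (P (h, x))"
    using \<Delta>_star_hom mult by (simp add: star_hom_def)
  also have "\<dots> = (\<Sum>y\<in>UNIV. op_tensor (P (g \<otimes> h, y)) (P (tw y (g \<otimes> h), x = y)))"
    using mult by (simp add: op_mult_tensor_sums P_mult tw_mult) (simp add: sum_bool P_mult)
  finally show ?case .
qed (simp_all add: comult_P_generator)

end

section \<open>Universality\<close>

locale doubling_and_action =
  doubled_group_algebra G s t \<theta> Q u p + isometric_action G s t \<theta> R \<beta>
  for G :: "('g, 'm) monoid_scheme" (structure) and s t \<theta>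
    and Q :: "'k cqg" and u p and R :: "'l cqg" and \<beta>
begin

definition \<phi> :: "'k l2op \<Rightarrow> 'l l2op" where
  "\<phi> = frame_map K p P"

lemma \<phi>_u: "g \<in> carrier G \<Longrightarrow> \<phi> (u (g, x)) = P (g, x)"
  unfolding \<phi>_def by (rule frame_map_basis[OF frame]) simp

lemma \<phi>_star_hom: "star_hom A C \<phi>"
proof -
  have "star_hom (l2op.span (u ` K)) C (frame_map K p P)"
  proof (rule star_hom_frame_map[OF frame C_subspace], fold \<phi>_def)
    fix k l assume "k \<in> K" "l \<in> K"
    then obtain g x h y where kl: "k = (g, x)" "l = (h, y)" "g \<in> carrier G" "h \<in> carrier G" by auto
    have "\<phi> 0 = 0" by (simp add: \<phi>_def frame_map_zero)
    then show "\<phi> (op_mult (u k) (u l)) = P k \<cdot> P l"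
      using kl by (simp add: u_mult P_mult \<phi>_u)
  qed (auto simp: u_adj P_adj \<phi>_u)
  then show ?thesis by (simp add: \<phi>_def alg_eq)
qed

lemma \<phi>_morphism: "cqg_morphism Q R \<phi>"
proof -
  have "\<phi> e = unit_C"
    using \<phi>_star_hom u_in[of \<one>]
    by (simp add: e_def sum_bool star_hom_def \<phi>_u P_one E_sum)
  then have unital: "unital_star_hom A C \<phi>"
    using \<phi>_star_hom by (simp add: unital_star_hom_def alg_unit_A)
  obtain F where F: "tensor_hom A A C C \<phi> \<phi> F"
    using tensor_hom_frame[OF frame frame alg_eq alg_eq A_mult A_adj A_mult A_adj
        \<phi>_star_hom \<phi>_star_hom C_l2 C_l2] by blast
  have lF: "star_hom A (spatial_tensor C C) (\<lambda>a. F (comult Q a))"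
    by (rule star_hom_comp[OF comult_star_hom]) (use F in \<open>simp add: tensor_hom_def\<close>)
  have lR: "star_hom A (spatial_tensor C C) (\<lambda>a. comult R (\<phi> a))"
    by (rule star_hom_comp[OF \<phi>_star_hom \<Delta>_star_hom])
  have basis: "F (comult Q (u (g, x))) = comult R (\<phi> (u (g, x)))" if g: "g \<in> carrier G" for g x
  proof -
    have "F (comult Q (u (g, x))) = (\<Sum>y\<in>UNIV. op_tensor (\<phi> (u (g, y))) (\<phi> (u (tw y g, x = y))))"
      by (subst comult_u[OF g], rule tensor_hom_sum[OF F]) (simp_all add: g u_in)
    then show ?thesis using g by (simp add: \<phi>_u comult_P)
  qed
  have "F (comult Q a) = comult R (\<phi> a)" if a: "a \<in> A" for a
    by (rule linear_on_eq_on_span[of "u ` K" "\<lambda>a. F (comult Q a)" "\<lambda>a. comult R (\<phi> a)" a])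
      (use star_hom_linear[OF lF] star_hom_linear[OF lR] basis a in \<open>auto simp: alg_eq\<close>)
  then show ?thesis using unital F unfolding cqg_morphism_def by blast
qed

lemma \<phi>_action_morphism: "action_morphism B Q act R \<beta> \<phi>"
proof -
  obtain F where F: "tensor_hom B A B C (\<lambda>x. x) \<phi> F"
    using tensor_hom_frame[OF left_regular_frame frame reduced_eq alg_eq reduced_mult reduced_adj
        A_mult A_adj star_hom_id \<phi>_star_hom reduced_l2 C_l2] by blast
  have lF: "star_hom B BC (\<lambda>b. F (act b))"
    by (rule star_hom_comp[OF act_star_hom]) (use F in \<open>simp add: tensor_hom_def\<close>)
  have basis: "F (act (lam g)) = \<beta> (lam g)" if g: "g \<in> carrier G" for g
  proof -
    have "F (act (lam g)) = (\<Sum>y\<in>UNIV. op_tensor (lam (tw y g)) (\<phi> (u (tw y g, y))))"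
      by (subst act_lam[OF g], rule tensor_hom_sum[OF F]) (simp_all add: g u_in left_regular_in)
    then show ?thesis using g by (simp add: \<phi>_u \<beta>_P)
  qed
  have "F (act b) = \<beta> b" if b: "b \<in> B" for b
    by (rule linear_on_eq_on_span[of "lam ` carrier G" "\<lambda>b. F (act b)" \<beta> b])
      (use lF \<beta>_star_hom basis b in \<open>auto simp: reduced_eq star_hom_def\<close>)
  then show ?thesis using \<phi>_morphism F unfolding action_morphism_def by blast
qed

text \<open>
  A morphism is determined on \<open>u (g, x)\<close> for \<open>g\<close> one of the two generators, where the
  summands of \<open>act\<close> belong to different group elements, and hence everywhere.
\<close>

lemma action_morphism_unique:
  assumes "action_morphism B Q act R \<beta> \<psi>" "a \<in> A"
  shows "\<psi> a = \<phi> a"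
proof -
  obtain F where \<psi>: "star_hom A C \<psi>" and F: "tensor_hom B A B C (\<lambda>x. x) \<psi> F"
    and F\<beta>: "\<forall>b\<in>B. F (act b) = \<beta> b"
    using assms(1) by (auto simp: action_morphism_def cqg_morphism_def unital_star_hom_def)
  have gen: "\<psi> (u (g, x)) = P (g, x)" if g: "g \<in> {s, t}" for g x
  proof -
    define h where "h = tw x g"
    have h: "h \<in> carrier G" "\<theta> h \<noteq> h" "g = tw x h" "g \<in> carrier G"
      using g s_neq_t by (auto simp: h_def tw_def swap_s swap_t)
    have "(\<Sum>y\<in>UNIV. op_tensor (lam (tw y h)) (\<psi> (u (tw y h, y)))) = F (act (lam h))"
      by (subst act_lam[OF h(1)], rule tensor_hom_sum[OF F, symmetric])
        (simp_all add: h u_in left_regular_in)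
    also have "\<dots> = (\<Sum>y\<in>UNIV. op_tensor (lam (tw y h)) (P (tw y h, y)))"
      using F\<beta> left_regular_in[OF h(1)] \<beta>_P[OF h(1)] by simp
    finally show ?thesis
      using h by (cases x) (auto simp: sum_bool slice_add tw_def dest!: arg_cong[of _ _ "slice G g"])
  qed
  have "\<psi> (u (g, x)) = P (g, x)" if "g \<in> carrier G" for g x
    using that
  proof (induction rule: generators_induct)
    case (mult g h)
    have "\<psi> (u (g \<otimes> h, x)) = \<psi> (op_mult (u (g, x)) (u (h, x)))"
      using mult by (simp add: u_mult)
    also have "\<dots> = \<psi> (u (g, x)) \<cdot> \<psi> (u (h, x))"
      using \<psi> mult u_in by (simp add: star_hom_def)
    finally show ?case using mult by (simp add: P_mult)
  qed (simp_all add: gen)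
  then show ?thesis
    by (intro linear_on_eq_on_span[of "u ` K" \<psi> \<phi> a])
      (use star_hom_linear[OF \<psi>] star_hom_linear[OF \<phi>_star_hom] assms(2) in
        \<open>auto simp: alg_eq \<phi>_u\<close>)
qed

end

text \<open>
  The index type of \<open>R\<close> is arbitrary here, whereas \<open>quantum_isometry_group\<close> speaks about a
  single type. Comparing realisations on different types rests on this.
\<close>

lemma (in doubled_group_algebra) universal:
  assumes "length_preserving_action G {s, t} R \<beta>"
  obtains \<phi> where "action_morphism B Q act R \<beta> \<phi>"
    "\<And>\<psi> a. action_morphism B Q act R \<beta> \<psi> \<Longrightarrow> a \<in> alg Q \<Longrightarrow> \<psi> a = \<phi> a"
proof -
  interpret doubling_and_action G s t \<theta> Q u p R \<beta>
    by unfold_locales (rule assms)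
  show thesis
    using that[OF \<phi>_action_morphism] action_morphism_unique by blast
qed

lemma (in doubled_group_algebra) quantum_isometry_group:
  "quantum_isometry_group G {s, t} Q act"
  unfolding quantum_isometry_group_def
proof (intro conjI allI impI length_preserving)
  fix R :: "'k cqg" and \<beta> assume "length_preserving_action G {s, t} R \<beta>"
  then obtain \<phi> where "action_morphism B Q act R \<beta> \<phi>"
    "\<And>\<psi> a. action_morphism B Q act R \<beta> \<psi> \<Longrightarrow> a \<in> A \<Longrightarrow> \<psi> a = \<phi> a"
    using universal by blast
  then show "\<exists>\<phi>. action_morphism B Q act R \<beta> \<phi> \<and>
      (\<forall>\<psi>. action_morphism B Q act R \<beta> \<psi> \<longrightarrow> (\<forall>a\<in>A. \<psi> a = \<phi> a))"
    by blast
qed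

subsection \<open>Uniqueness of universal objects\<close>

lemma tensor_hom_comp:
  assumes "tensor_hom A B C D \<phi> \<psi> F" "tensor_hom C D A' B' \<phi>' \<psi>' F'"
    and "star_hom A C \<phi>" "star_hom B D \<psi>"
  shows "tensor_hom A B A' B' (\<lambda>x. \<phi>' (\<phi> x)) (\<lambda>x. \<psi>' (\<psi> x)) (\<lambda>x. F' (F x))"
  using assms by (auto simp: tensor_hom_def star_hom_def)

lemma tensor_hom_id: "tensor_hom A B A B (\<lambda>x. x) (\<lambda>x. x) (\<lambda>x. x)"
  by (simp add: tensor_hom_def star_hom_id)

lemma cqg_morphism_star_hom: "cqg_morphism Q R \<phi> \<Longrightarrow> star_hom (alg Q) (alg R) \<phi>"
  by (simp add: cqg_morphism_def unital_star_hom_def)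

lemma cqg_morphism_comp:
  assumes "cqg_morphism Q R \<phi>" "cqg_morphism R S \<psi>"
  shows "cqg_morphism Q S (\<lambda>x. \<psi> (\<phi> x))"
proof -
  obtain F F' where F: "tensor_hom (alg Q) (alg Q) (alg R) (alg R) \<phi> \<phi> F"
      "\<forall>a\<in>alg Q. F (comult Q a) = comult R (\<phi> a)"
    and F': "tensor_hom (alg R) (alg R) (alg S) (alg S) \<psi> \<psi> F'"
      "\<forall>a\<in>alg R. F' (comult R a) = comult S (\<psi> a)"
    using assms unfolding cqg_morphism_def by blast
  note h = cqg_morphism_star_hom[OF assms(1)]
  have "F' (F (comult Q a)) = comult S (\<psi> (\<phi> a))" if "a \<in> alg Q" for a
    using F(2) F'(2) that h by (simp add: star_hom_def)
  moreover have "unital_star_hom (alg Q) (alg S) (\<lambda>x. \<psi> (\<phi> x))"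
    using assms star_hom_comp by (auto simp: cqg_morphism_def unital_star_hom_def)
  ultimately show ?thesis
    unfolding cqg_morphism_def using tensor_hom_comp[OF F(1) F'(1) h h] by blast
qed

lemma action_morphism_comp:
  assumes "action_morphism B Q \<alpha> R \<beta> \<phi>" "action_morphism B R \<beta> S \<gamma> \<psi>"
  shows "action_morphism B Q \<alpha> S \<gamma> (\<lambda>x. \<psi> (\<phi> x))"
proof -
  obtain F F' where F: "tensor_hom B (alg Q) B (alg R) (\<lambda>x. x) \<phi> F" "\<forall>b\<in>B. F (\<alpha> b) = \<beta> b"
    and F': "tensor_hom B (alg R) B (alg S) (\<lambda>x. x) \<psi> F'" "\<forall>b\<in>B. F' (\<beta> b) = \<gamma> b"
    and m: "cqg_morphism Q R \<phi>" "cqg_morphism R S \<psi>"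
    using assms unfolding action_morphism_def by blast
  show ?thesis
    unfolding action_morphism_def
    using tensor_hom_comp[OF F(1) F'(1) star_hom_id cqg_morphism_star_hom[OF m(1)]] F(2) F'(2)
      cqg_morphism_comp[OF m] by (intro conjI exI[of _ "\<lambda>x. F' (F x)"]) auto
qed

lemma action_morphism_id: "action_morphism B Q \<alpha> Q \<alpha> (\<lambda>x. x)"
proof -
  have "cqg_morphism Q Q (\<lambda>x. x)"
    unfolding cqg_morphism_def unital_star_hom_def using star_hom_id tensor_hom_id by blast
  then show ?thesis
    unfolding action_morphism_def using tensor_hom_id by blast
qed

text \<open>
  \<open>Q\<close> and \<open>Q1\<close> live on different index types, and the universal property of \<open>Q\<close> only
  provides morphisms within its own type. The morphism from \<open>Q\<close> to \<open>Q1\<close> therefore passes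
  through \<open>Q0\<close>, which shares the type of \<open>Q\<close> and maps to \<open>Q1\<close> because it is initial for all
  types.
\<close>

lemma universal_isomorphic:
  assumes Q: "quantum_isometry_group G {s, t} (Q :: 'i cqg) \<alpha>"
    and Q0: "doubled_group_algebra G s t \<theta> (Q0 :: 'i cqg) u0 p0"
    and Q1: "doubled_group_algebra G s t \<theta> Q1 u1 p1"
  shows "cqg_isomorphic Q Q1"
proof -
  interpret Q0: doubled_group_algebra G s t \<theta> Q0 u0 p0 by (rule Q0)
  interpret Q1: doubled_group_algebra G s t \<theta> Q1 u1 p1 by (rule Q1)
  let ?B = "reduced_group_cstar G"
  have lp: "length_preserving_action G {s, t} Q \<alpha>"
    using Q by (simp add: quantum_isometry_group_def)
  have unique: "\<psi> a = \<psi>' a"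
    if "action_morphism ?B Q \<alpha> Q \<alpha> \<psi>" "action_morphism ?B Q \<alpha> Q \<alpha> \<psi>'" "a \<in> alg Q" for \<psi> \<psi>' a
    using Q lp that unfolding quantum_isometry_group_def by metis
  have unique1: "\<psi> a = \<psi>' a"
    if "action_morphism ?B Q1 Q1.act Q1 Q1.act \<psi>" "action_morphism ?B Q1 Q1.act Q1 Q1.act \<psi>'"
      "a \<in> alg Q1" for \<psi> \<psi>' a
    using Q1.universal[OF Q1.length_preserving] that by metis
  obtain \<kappa> where \<kappa>: "action_morphism ?B Q \<alpha> Q0 Q0.act \<kappa>"
    using Q Q0.length_preserving unfolding quantum_isometry_group_def by blast
  obtain \<mu> where \<mu>: "action_morphism ?B Q0 Q0.act Q1 Q1.act \<mu>"
    using Q0.universal[OF Q1.length_preserving] by blast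
  obtain \<psi> where \<psi>: "action_morphism ?B Q1 Q1.act Q \<alpha> \<psi>"
    using Q1.universal[OF lp] by blast
  define \<phi> where "\<phi> = (\<lambda>x. \<mu> (\<kappa> x))"
  have \<phi>: "action_morphism ?B Q \<alpha> Q1 Q1.act \<phi>"
    unfolding \<phi>_def by (rule action_morphism_comp[OF \<kappa> \<mu>])
  have "\<psi> (\<phi> a) = a" if "a \<in> alg Q" for a
    by (rule unique[OF action_morphism_comp[OF \<phi> \<psi>] action_morphism_id that])
  moreover have "\<phi> (\<psi> b) = b" if "b \<in> alg Q1" for b
    by (rule unique1[OF action_morphism_comp[OF \<psi> \<phi>] action_morphism_id that])
  ultimately show ?thesis
    using \<phi> \<psi> unfolding cqg_isomorphic_def action_morphism_def by blast
qed

section \<open>Multiples of the regular representation\<close>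

context swapped_involutions
begin

text \<open>
  For a map \<open>c\<close> into an index type that is injective on \<open>G \<times> M\<close>: the regular representation, with
  multiplicity space \<open>\<ell>\<^sup>2(M)\<close>, on the coordinates in the image of \<open>c\<close>. Disjoint \<open>M\<close> give the
  orthogonal copies of the doubling; for countably infinite \<open>M\<close>, where \<open>c\<close> can be a bijection
  onto the natural numbers, one obtains a representation on all of \<open>\<ell>\<^sup>2(nat)\<close>.
\<close>

definition perm_rep :: "('g \<times> 'x \<Rightarrow> 'i) \<Rightarrow> 'x set \<Rightarrow> 'g \<Rightarrow> 'i l2op" where
  "perm_rep c M g = (\<lambda>i k. of_bool (\<exists>h\<in>carrier G. \<exists>m\<in>M. k = c (h, m) \<and> i = c (g \<otimes> h, m)))"

context
  fixes c :: "'g \<times> 'x \<Rightarrow> 'i"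
  assumes inj: "inj_on c (carrier G \<times> UNIV)"
begin

lemma c_eq: "g \<in> carrier G \<Longrightarrow> h \<in> carrier G \<Longrightarrow> c (g, x) = c (h, y) \<longleftrightarrow> g = h \<and> x = y"
  using inj_on_eq_iff[OF inj, of "(g, x)" "(h, y)"] by auto

lemma perm_rep_apply:
  assumes "g \<in> carrier G" "h \<in> carrier G"
  shows "perm_rep c M g i (c (h, m)) = of_bool (m \<in> M \<and> i = c (g \<otimes> h, m))"
  using assms by (auto simp: perm_rep_def c_eq)

lemma perm_rep_outside: "k \<notin> c ` (carrier G \<times> UNIV) \<Longrightarrow> perm_rep c M g i k = 0"
  by (auto simp: perm_rep_def)

lemma perm_rep_adj:
  assumes g: "g \<in> carrier G"
  shows "op_adj (perm_rep c M g) = perm_rep c M (inv g)"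
proof -
  have "(\<exists>h\<in>carrier G. \<exists>m\<in>M. i = c (h, m) \<and> k = c (g \<otimes> h, m)) \<longleftrightarrow>
      (\<exists>h\<in>carrier G. \<exists>m\<in>M. k = c (h, m) \<and> i = c (inv g \<otimes> h, m))" (is "?L \<longleftrightarrow> ?R") for i k
  proof
    assume ?L
    then obtain h m where "h \<in> carrier G" "m \<in> M" "i = c (h, m)" "k = c (g \<otimes> h, m)" by auto
    then show ?R using g
      by (intro bexI[of _ "g \<otimes> h"] bexI[of _ m]) (auto simp: m_assoc[symmetric])
  next
    assume ?R
    then obtain h m where "h \<in> carrier G" "m \<in> M" "k = c (h, m)" "i = c (inv g \<otimes> h, m)" by auto
    then show ?L using g
      by (intro bexI[of _ "inv g \<otimes> h"] bexI[of _ m]) (auto simp: m_assoc[symmetric])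
  qed
  then show ?thesis by (simp add: op_adj_def perm_rep_def fun_eq_iff)
qed

lemma perm_rep_l2:
  assumes g: "g \<in> carrier G"
  shows "l2_matrix (perm_rep c M g)"
proof -
  have col: "square_summable (\<lambda>i. perm_rep c M g i k)" if g: "g \<in> carrier G" for g k
  proof (rule square_summable_finite_support, cases "k \<in> c ` (carrier G \<times> UNIV)")
    case True
    then obtain h m where k: "k = c (h, m)" "h \<in> carrier G" by auto
    then have "{i. perm_rep c M g i k \<noteq> 0} \<subseteq> {c (g \<otimes> h, m)}"
      using g by (auto simp: perm_rep_apply)
    then show "finite {i. perm_rep c M g i k \<noteq> 0}" by (rule finite_subset) simp
  qed (simp add: perm_rep_outside)
  have "perm_rep c M g = op_adj (perm_rep c M (inv g))" using g by (simp add: perm_rep_adj)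
  then have "perm_rep c M g i = (\<lambda>k. cnj (perm_rep c M (inv g) k i))" for i
    by (simp add: op_adj_def)
  then show ?thesis
    using col g square_summable_cnj unfolding l2_matrix_def by (metis inv_closed)
qed

lemma perm_rep_mult:
  assumes g: "g \<in> carrier G" and h: "h \<in> carrier G"
  shows "op_mult (perm_rep c M g) (perm_rep c N h) = perm_rep c (M \<inter> N) (g \<otimes> h)"
proof (intro ext)
  fix i k
  show "op_mult (perm_rep c M g) (perm_rep c N h) i k = perm_rep c (M \<inter> N) (g \<otimes> h) i k"
  proof (cases "k \<in> c ` (carrier G \<times> UNIV)")
    case True
    then obtain a m where k: "k = c (a, m)" "a \<in> carrier G" by auto
    have "op_mult (perm_rep c M g) (perm_rep c N h) i k
        = perm_rep c M g i (c (h \<otimes> a, m)) * perm_rep c N h (c (h \<otimes> a, m)) k"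
      unfolding op_mult_def by (rule infsum_single) (use k h in \<open>auto simp: perm_rep_apply\<close>)
    then show ?thesis using g h k by (auto simp: perm_rep_apply m_assoc)
  qed (simp add: op_mult_def perm_rep_outside)
qed

lemma perm_rep_one: "perm_rep c M \<one> i k = of_bool (i = k \<and> i \<in> c ` (carrier G \<times> M))"
  by (auto simp: perm_rep_def)

lemma perm_rep_bounded: "g \<in> carrier G \<Longrightarrow> bounded_op (perm_rep c M g)"
  unfolding bounded_op_def
  by (intro exI[of _ 1] op_norm_le_partial_isometry[of _ "\<lambda>i. i \<in> c ` (carrier G \<times> M)"])
    (simp_all add: perm_rep_l2 perm_rep_adj perm_rep_mult perm_rep_one)

end

lemma perm_rep_empty: "perm_rep c {} g = 0"
  by (simp add: perm_rep_def fun_eq_iff zero_fun_apply)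

subsection \<open>The doubling on an arbitrary infinite index type\<close>

text \<open>
  The doubling has finite dimension, so two copies of the regular representation fit on
  finitely many coordinates. The coproduct is prescribed on the basis.
\<close>

lemma ex_doubled_group_algebra:
  assumes "infinite (UNIV :: 'i set)"
  shows "\<exists>(Q :: 'i cqg) u p. doubled_group_algebra G s t \<theta> Q u p"
proof -
  let ?K = "carrier G \<times> (UNIV :: bool set)"
  obtain T :: "'i set" where T: "finite T" "card T = card ?K"
    using infinite_arbitrarily_large[OF assms] by blast
  have finK: "finite ?K" using finite_carrier by simp
  obtain c where "bij_betw c ?K T"
    using finite_same_card_bij[OF finK T(1)] T(2) by auto
  then have inj: "inj_on c ?K" by (rule bij_betw_imp_inj_on)
  define u where "u = (\<lambda>(g, x). perm_rep c {x} g)"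
  define p where "p = (\<lambda>(g, x). (c (g, x), c (\<one>, x)))"
  define f where "f = (\<lambda>(g, x). \<Sum>y\<in>UNIV. op_tensor (u (g, y)) (u (tw y g, x = y)))"
  define Q where "Q = \<lparr>alg = l2op.span (u ` ?K), comult = frame_map ?K p f\<rparr>"
  have fr: "entry_frame ?K u p"
    using finK inj
    by (auto simp: entry_frame_def u_def p_def perm_rep_l2 perm_rep_apply c_eq)
  have "doubled_group_algebra G s t \<theta> Q u p"
  proof unfold_locales
    show "entry_frame ?K u p" by (rule fr)
    show "op_mult (u (g, x)) (u (h, y)) = (if x = y then u (g \<otimes> h, x) else 0)"
      if "g \<in> carrier G" "h \<in> carrier G" for g h x y
      using that inj by (auto simp: u_def perm_rep_mult perm_rep_empty)
    show "comult Q (u (g, x)) = (\<Sum>y\<in>UNIV. op_tensor (u (g, y)) (u (tw y g, x = y)))"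
      if "g \<in> carrier G" for g x
      using frame_map_basis[OF fr, of "(g, x)" f] that by (simp add: Q_def f_def)
  qed (use inj in \<open>simp_all add: Q_def u_def perm_rep_bounded perm_rep_adj frame_map_add frame_map_scale\<close>)
  then show ?thesis by blast
qed

section \<open>The full group algebra\<close>

abbreviation U where "U \<equiv> universal_rep G"

lemma universal_rep_apply: "U g (\<pi>, i) (\<rho>, j) = (if \<pi> = \<rho> \<and> unitary_rep G \<pi> then \<pi> g i j else 0)"
  by (simp add: universal_rep_def)

lemma U_adj:
  assumes "g \<in> carrier G"
  shows "op_adj (U g) = U (inv g)"
proof -
  have "cnj (U g b a) = U (inv g) a b" for a b
  proof (cases a, cases b)
    fix \<pi> i \<rho> j assume ab: "a = (\<pi>, i)" "b = (\<rho>, j)"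
    have "unitary_rep G \<pi> \<Longrightarrow> op_adj (\<pi> g) i j = \<pi> (inv g) i j"
      using assms by (simp add: unitary_rep_def)
    then show ?thesis by (auto simp: ab universal_rep_apply op_adj_def)
  qed
  then show ?thesis by (simp add: op_adj_def fun_eq_iff)
qed

lemma U_l2:
  assumes g: "g \<in> carrier G"
  shows "l2_matrix (U g)"
proof -
  have col: "square_summable (\<lambda>a. U g a (\<rho>, j))" if g: "g \<in> carrier G" for g \<rho> j
  proof (rule square_summable_range[of "Pair \<rho>"])
    show "square_summable (\<lambda>k. U g (\<rho>, k) (\<rho>, j))"
    proof (cases "unitary_rep G \<rho>")
      case True
      then have "l2_matrix (\<rho> g)" using g by (auto simp: unitary_rep_def intro: bounded_op_l2_matrix)
      then show ?thesis using True l2_matrix_col by (simp add: universal_rep_apply)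
    qed (simp add: universal_rep_apply square_summable_def)
  qed (auto simp: inj_def universal_rep_def)
  have "U g = op_adj (U (inv g))" using g by (simp add: U_adj)
  then have "U g a = (\<lambda>b. cnj (U (inv g) b a))" for a
    by (simp add: op_adj_def)
  then show ?thesis
    using col g square_summable_cnj unfolding l2_matrix_def by (metis inv_closed surj_pair)
qed

lemma U_mult:
  assumes g: "g \<in> carrier G" and h: "h \<in> carrier G"
  shows "op_mult (U g) (U h) = U (g \<otimes> h)"
proof (intro ext)
  fix a b :: "('g \<Rightarrow> nat l2op) \<times> nat"
  obtain \<pi> i \<rho> j where ab: "a = (\<pi>, i)" "b = (\<rho>, j)" by (cases a; cases b) auto
  have "op_mult (U g) (U h) a b = (\<Sum>\<^sub>\<infinity>k. U g a (\<rho>, k) * U h (\<rho>, k) b)"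
    unfolding op_mult_def
    by (rule infsum_range) (auto simp: ab inj_def universal_rep_def split: if_splits)
  also have "\<dots> = U (g \<otimes> h) a b"
  proof (cases "\<pi> = \<rho> \<and> unitary_rep G \<rho>")
    case True
    then have "\<rho> (g \<otimes> h) = op_mult (\<rho> g) (\<rho> h)" using g h by (simp add: unitary_rep_def)
    then show ?thesis using True by (simp add: ab universal_rep_apply op_mult_def)
  qed (auto simp: ab universal_rep_apply)
  finally show "op_mult (U g) (U h) a b = U (g \<otimes> h) a b" .
qed

lemma U_one: "U \<one> a b = of_bool (a = b \<and> unitary_rep G (fst a))"
  by (cases a; cases b) (auto simp: universal_rep_apply unitary_rep_def op_id_def)

text \<open>
  The elements of the group remain linearly independent in the universal representation
  because a multiple of the regular representation is among its summands.
\<close>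

lemma ex_universal_frame: "\<exists>q. entry_frame (carrier G) U q"
proof -
  let ?S = "carrier G \<times> (UNIV :: nat set)"
  have "countable ?S" using finite_carrier by (simp add: countable_finite)
  moreover have "infinite ?S"
    using one_closed by (auto simp: finite_cartesian_product_iff)
  ultimately obtain c :: "'g \<times> nat \<Rightarrow> nat" where c: "bij_betw c ?S UNIV"
    using to_nat_on_infinite by blast
  then have inj: "inj_on c ?S" by (rule bij_betw_imp_inj_on)
  define \<pi> where "\<pi> = perm_rep c UNIV"
  have "\<pi> \<one> = op_id"
    using c by (auto simp: \<pi>_def perm_rep_one op_id_def fun_eq_iff bij_betw_def)
  then have \<pi>: "unitary_rep G \<pi>"
    using inj by (simp add: unitary_rep_def \<pi>_def perm_rep_bounded perm_rep_adj perm_rep_mult)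
  show ?thesis
  proof (rule exI)
    show "entry_frame (carrier G) U (\<lambda>g. ((\<pi>, c (g, 0)), (\<pi>, c (\<one>, 0))))"
      using finite_carrier \<pi> inj
      by (auto simp: entry_frame_def U_l2 universal_rep_apply) (auto simp: \<pi>_def perm_rep_apply c_eq)
  qed
qed

definition pos where "pos = (SOME q. entry_frame (carrier G) U q)"

lemma U_frame: "entry_frame (carrier G) U pos"
  unfolding pos_def using ex_universal_frame by (rule someI_ex)

abbreviation FG where "FG \<equiv> full_group_cstar G"

lemma full_eq: "FG = l2op.span (U ` carrier G)"
  unfolding full_group_cstar_def by (rule norm_closure_frame[OF U_frame])

lemma U_in: "g \<in> carrier G \<Longrightarrow> U g \<in> FG"
  unfolding full_eq by (auto intro: l2op.span_base)

lemma full_mult: "x \<in> FG \<Longrightarrow> y \<in> FG \<Longrightarrow> op_mult x y \<in> FG"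
  unfolding full_eq
  by (rule op_mult_span_closed) (auto simp: U_l2 U_mult intro!: l2op.span_base)

lemma full_adj: "x \<in> FG \<Longrightarrow> op_adj x \<in> FG"
  unfolding full_eq
  by (rule op_adj_span_closed) (auto simp: U_adj intro!: l2op.span_base)

lemma full_l2: "x \<in> FG \<Longrightarrow> l2_matrix x"
  unfolding full_eq by (erule l2_matrix_span) (auto simp: U_l2)

lemma full_subspace: "l2op.subspace FG"
  unfolding full_eq by (rule l2op.subspace_span)

lemma full_unit: "alg_unit FG = U \<one>"
  unfolding full_eq
  by (rule alg_unit_span) (use U_in in \<open>auto simp: U_l2 U_mult full_eq\<close>)

lemma full_tensor_unit: "alg_unit (spatial_tensor FG FG) = op_tensor (U \<one>) (U \<one>)"
  by (rule alg_unit_tensor[OF U_frame U_frame full_eq full_eq U_in U_in]) (auto simp: U_mult)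

text \<open>
  The coproduct and the automorphism of the full group algebra are specified only by their
  values on group elements; this provides their existence.
\<close>

lemma ex_full_group_hom:
  assumes C: "l2op.subspace C" and f: "\<And>g. g \<in> carrier G \<Longrightarrow> f g \<in> C" "\<And>g. g \<in> carrier G \<Longrightarrow> l2_matrix (f g)"
    and "\<And>g h. g \<in> carrier G \<Longrightarrow> h \<in> carrier G \<Longrightarrow> f (g \<otimes> h) = op_mult (f g) (f h)"
    and "\<And>g. g \<in> carrier G \<Longrightarrow> f (inv g) = op_adj (f g)"
    and "f \<one> = alg_unit C"
  shows "\<exists>\<phi>. unital_star_hom FG C \<phi> \<and> (\<forall>g\<in>carrier G. \<phi> (U g) = f g)"
proof -
  note basis = frame_map_basis[OF U_frame]
  have "star_hom FG C (frame_map (carrier G) pos f)"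
    unfolding full_eq
    by (rule star_hom_frame_map[OF U_frame C f]) (simp_all add: U_mult U_adj basis assms)
  then show ?thesis
    using basis[of _ f] assms(6) unfolding unital_star_hom_def full_unit
    by (intro exI[of _ "frame_map (carrier G) pos f"]) simp
qed

lemma full_comult_hom: "star_hom FG (spatial_tensor FG FG) (comult (full_group_cqg G))"
  and full_comult_U: "g \<in> carrier G \<Longrightarrow> comult (full_group_cqg G) (U g) = op_tensor (U g) (U g)"
proof -
  have "l2op.subspace (spatial_tensor FG FG)"
    unfolding full_eq spatial_tensor_frame[OF U_frame U_frame] by (rule l2op.subspace_span)
  then have "\<exists>\<Delta>. unital_star_hom FG (spatial_tensor FG FG) \<Delta> \<and>
      (\<forall>g\<in>carrier G. \<Delta> (U g) = op_tensor (U g) (U g))"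
    by (rule ex_full_group_hom) (auto simp: op_tensor_in_spatial U_in l2_matrix_tensor U_l2
        op_mult_tensor U_mult op_adj_tensor U_adj full_tensor_unit)
  from someI_ex[OF this]
  show "star_hom FG (spatial_tensor FG FG) (comult (full_group_cqg G))"
    "g \<in> carrier G \<Longrightarrow> comult (full_group_cqg G) (U g) = op_tensor (U g) (U g)"
    by (simp_all add: full_group_cqg_def unital_star_hom_def)
qed

lemma full_swap_hom: "star_hom FG FG (full_group_map G \<theta>)"
  and full_swap_U: "g \<in> carrier G \<Longrightarrow> full_group_map G \<theta> (U g) = U (\<theta> g)"
proof -
  have "\<exists>\<phi>. unital_star_hom FG FG \<phi> \<and> (\<forall>g\<in>carrier G. \<phi> (U g) = U (\<theta> g))"
    by (rule ex_full_group_hom) (auto simp: full_subspace U_in U_l2 U_mult U_adj swap_mult swap_inv full_unit)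
  from someI_ex[OF this]
  show "star_hom FG FG (full_group_map G \<theta>)"
    "g \<in> carrier G \<Longrightarrow> full_group_map G \<theta> (U g) = U (\<theta> g)"
    by (simp_all add: full_group_map_def unital_star_hom_def)
qed

end

section \<open>Direct sums\<close>

lemma inl_op_simps [simp]:
  "inl_op a (Inl i) (Inl j) = a i j" "inl_op a (Inr k) q = 0" "inl_op a p (Inr k) = 0"
  by (simp_all add: inl_op_def split: sum.splits)

lemma inr_op_simps [simp]:
  "inr_op a (Inr i) (Inr j) = a i j" "inr_op a (Inl k) q = 0" "inr_op a p (Inl k) = 0"
  by (simp_all add: inr_op_def split: sum.splits)

lemma op_sum_eqI:
  assumes "\<And>i j. x (Inl i) (Inl j) = y (Inl i) (Inl j)" "\<And>i j. x (Inl i) (Inr j) = y (Inl i) (Inr j)"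
    "\<And>i j. x (Inr i) (Inl j) = y (Inr i) (Inl j)" "\<And>i j. x (Inr i) (Inr j) = y (Inr i) (Inr j)"
  shows "x = (y :: ('i + 'j) l2op)"
proof (intro ext)
  fix a b show "x a b = y a b" by (cases a; cases b) (simp_all add: assms)
qed

lemma inl_add: "inl_op (a + b) = inl_op a + inl_op b"
  and inr_add: "inr_op (a + b) = inr_op a + inr_op b"
  and inl_scale: "inl_op (op_scale z a) = op_scale z (inl_op a)"
  and inr_scale: "inr_op (op_scale z a) = op_scale z (inr_op a)"
  and inl_adj: "inl_op (op_adj a) = op_adj (inl_op a)"
  and inr_adj: "inr_op (op_adj a) = op_adj (inr_op a)"
  and inl_zero: "inl_op 0 = 0" and inr_zero: "inr_op 0 = 0"
  by (rule op_sum_eqI; simp add: plus_fun_apply zero_fun_apply op_scale_def op_adj_def)+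

lemma not_range_Inl: "k \<notin> range Inl \<longleftrightarrow> k \<in> range Inr"
  and not_range_Inr: "k \<notin> range Inr \<longleftrightarrow> k \<in> range Inl"
  by (cases k; auto)+

lemma inl_mult: "inl_op (op_mult a b) = op_mult (inl_op a) (inl_op b)"
proof (rule op_sum_eqI)
  fix i j
  have "op_mult (inl_op a) (inl_op b) (Inl i) (Inl j)
      = (\<Sum>\<^sub>\<infinity>k. inl_op a (Inl i) (Inl k) * inl_op b (Inl k) (Inl j))"
    unfolding op_mult_def by (rule infsum_range) (auto simp: not_range_Inl)
  then show "inl_op (op_mult a b) (Inl i) (Inl j) = op_mult (inl_op a) (inl_op b) (Inl i) (Inl j)"
    by (simp add: op_mult_def)
qed (simp_all add: op_mult_def)

lemma inr_mult: "inr_op (op_mult a b) = op_mult (inr_op a) (inr_op b)"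
proof (rule op_sum_eqI)
  fix i j
  have "op_mult (inr_op a) (inr_op b) (Inr i) (Inr j)
      = (\<Sum>\<^sub>\<infinity>k. inr_op a (Inr i) (Inr k) * inr_op b (Inr k) (Inr j))"
    unfolding op_mult_def by (rule infsum_range) (auto simp: not_range_Inr)
  then show "inr_op (op_mult a b) (Inr i) (Inr j) = op_mult (inr_op a) (inr_op b) (Inr i) (Inr j)"
    by (simp add: op_mult_def)
qed (simp_all add: op_mult_def)

lemma inl_inr_mult: "op_mult (inl_op a) (inr_op b) = 0" "op_mult (inr_op b) (inl_op a) = 0"
proof -
  have *: "inl_op a p k * inr_op b k q = 0" "inr_op b p k * inl_op a k q = 0" for p k q
    by (cases k; simp)+
  then show "op_mult (inl_op a) (inr_op b) = 0" "op_mult (inr_op b) (inl_op a) = 0"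
    by (simp_all only: op_mult_def * infsum_0_simp zero_fun_def)
qed

lemma inl_l2:
  assumes "l2_matrix a"
  shows "l2_matrix (inl_op a)"
  unfolding l2_matrix_def
proof (intro conjI allI)
  fix p
  show "square_summable (inl_op a p)"
    by (rule square_summable_range[of Inl], simp, force simp: not_range_Inl)
      (use assms l2_matrix_row in \<open>cases p; simp add: square_summable_def\<close>)
  show "square_summable (\<lambda>i. inl_op a i p)"
    by (rule square_summable_range[of Inl], simp, force simp: not_range_Inl)
      (use assms l2_matrix_col in \<open>cases p; simp add: square_summable_def\<close>)
qed

lemma inr_l2:
  assumes "l2_matrix a"
  shows "l2_matrix (inr_op a)"
  unfolding l2_matrix_def
proof (intro conjI allI)
  fix p
  show "square_summable (inr_op a p)"
    by (rule square_summable_range[of Inr], simp, force simp: not_range_Inr)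
      (use assms l2_matrix_row in \<open>cases p; simp add: square_summable_def\<close>)
  show "square_summable (\<lambda>i. inr_op a i p)"
    by (rule square_summable_range[of Inr], simp, force simp: not_range_Inr)
      (use assms l2_matrix_col in \<open>cases p; simp add: square_summable_def\<close>)
qed

context swapped_involutions
begin

subsection \<open>The doubling of the full group algebra\<close>

abbreviation DS where "DS \<equiv> direct_sum FG"
abbreviation T where "T \<equiv> tensor_map FG FG DS DS"

definition dbl :: "'g \<times> bool \<Rightarrow> ((('g \<Rightarrow> nat l2op) \<times> nat) + (('g \<Rightarrow> nat l2op) \<times> nat)) l2op" where
  "dbl = (\<lambda>(g, x). if x then inl_op (U g) else inr_op (U g))"

lemma DS_subspace: "l2op.subspace DS"
  unfolding l2op.subspace_def
proof (intro conjI ballI allI)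
  show "0 \<in> DS"
    unfolding direct_sum_def
    by (intro CollectI exI[of _ 0]) (simp add: inl_zero inr_zero l2op.subspace_0[OF full_subspace])
  show "x + y \<in> DS" if "x \<in> DS" "y \<in> DS" for x y
  proof -
    obtain a b c d where "x = inl_op a + inr_op b" "y = inl_op c + inr_op d"
      "a \<in> FG" "b \<in> FG" "c \<in> FG" "d \<in> FG"
      using \<open>x \<in> DS\<close> \<open>y \<in> DS\<close> by (auto simp: direct_sum_def)
    then show ?thesis
      unfolding direct_sum_def using full_subspace
      by (intro CollectI exI[of _ "a + c"] exI[of _ "b + d"])
        (simp add: inl_add inr_add l2op.subspace_add ac_simps)
  qed
  show "op_scale z x \<in> DS" if "x \<in> DS" for z x
  proof -
    obtain a b where "x = inl_op a + inr_op b" "a \<in> FG" "b \<in> FG"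
      using \<open>x \<in> DS\<close> by (auto simp: direct_sum_def)
    then show ?thesis
      unfolding direct_sum_def using full_subspace
      by (intro CollectI exI[of _ "op_scale z a"] exI[of _ "op_scale z b"])
        (simp add: inl_scale inr_scale l2op.subspace_scale l2op.scale_right_distrib)
  qed
qed

lemma inl_in: "a \<in> FG \<Longrightarrow> inl_op a \<in> DS" and inr_in: "a \<in> FG \<Longrightarrow> inr_op a \<in> DS"
proof -
  have 0: "0 \<in> FG" by (rule l2op.subspace_0[OF full_subspace])
  show "a \<in> FG \<Longrightarrow> inl_op a \<in> DS" unfolding direct_sum_def
    by (intro CollectI exI[of _ a] exI[of _ 0]) (simp add: inr_zero 0)
  show "a \<in> FG \<Longrightarrow> inr_op a \<in> DS" unfolding direct_sum_def
    by (intro CollectI exI[of _ 0] exI[of _ a]) (simp add: inl_zero 0)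
qed

lemma DS_l2: "x \<in> DS \<Longrightarrow> l2_matrix x"
  by (auto simp: direct_sum_def intro!: l2_matrix_add inl_l2 inr_l2 full_l2)

lemma inl_hom: "star_hom FG DS inl_op" and inr_hom: "star_hom FG DS inr_op"
  by (simp_all add: star_hom_def inl_in inr_in inl_add inr_add inl_scale inr_scale
      inl_mult inr_mult inl_adj inr_adj)

lemma T_tensor_hom:
  assumes "star_hom FG DS \<phi>" "star_hom FG DS \<psi>"
  shows "tensor_hom FG FG DS DS \<phi> \<psi> (T \<phi> \<psi>)"
proof -
  have "\<exists>F. tensor_hom FG FG DS DS \<phi> \<psi> F"
    by (rule tensor_hom_frame[OF U_frame U_frame full_eq full_eq
        full_mult full_adj full_mult full_adj assms DS_l2 DS_l2])
  then show ?thesis unfolding tensor_map_def by (metis someI_ex)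
qed

text \<open>
  The four terms of the coproduct of the doubling are compositions of this form.
\<close>

lemma linear_T:
  assumes "star_hom FG DS \<phi>" "star_hom FG DS \<psi>"
  defines "f \<equiv> \<lambda>a. T \<phi> \<psi> (comult (full_group_cqg G) a)"
  shows "a \<in> FG \<Longrightarrow> b \<in> FG \<Longrightarrow> f (a + b) = f a + f b"
    and "a \<in> FG \<Longrightarrow> f (op_scale z a) = op_scale z (f a)"
    and "f 0 = 0"
    and "g \<in> carrier G \<Longrightarrow> f (U g) = op_tensor (\<phi> (U g)) (\<psi> (U g))"
proof -
  have T: "tensor_hom FG FG DS DS \<phi> \<psi> (T \<phi> \<psi>)" by (rule T_tensor_hom[OF assms(1,2)])
  have f: "star_hom FG (spatial_tensor DS DS) f"
    unfolding f_def by (rule star_hom_comp[OF full_comult_hom]) (use T in \<open>simp add: tensor_hom_def\<close>)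
  then show "a \<in> FG \<Longrightarrow> b \<in> FG \<Longrightarrow> f (a + b) = f a + f b"
    "a \<in> FG \<Longrightarrow> f (op_scale z a) = op_scale z (f a)"
    by (simp_all add: star_hom_def)
  show "f 0 = 0" by (rule star_hom_zero[OF f l2op.subspace_0[OF full_subspace]])
  show "g \<in> carrier G \<Longrightarrow> f (U g) = op_tensor (\<phi> (U g)) (\<psi> (U g))"
    unfolding f_def by (simp add: full_comult_U tensor_hom_apply[OF T] U_in)
qed

abbreviation DG where "DG \<equiv> doubling (full_group_cqg G) (full_group_map G \<theta>)"

lemma DG_alg: "alg DG = DS"
  by (simp add: doubling_def full_group_cqg_def Let_def)

lemma DG_comult:
  "comult DG (inl_op a + inr_op b) =
     (T inl_op inl_op (comult (full_group_cqg G) a)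
       + T inr_op (inr_op \<circ> full_group_map G \<theta>) (comult (full_group_cqg G) a))
   + (T inl_op inr_op (comult (full_group_cqg G) b)
       + T inr_op (inl_op \<circ> full_group_map G \<theta>) (comult (full_group_cqg G) b))"
proof -
  have "(\<lambda>i j. (inl_op a + inr_op b) (Inl i) (Inl j)) = a"
    "(\<lambda>i j. (inl_op a + inr_op b) (Inr i) (Inr j)) = b"
    by (simp_all add: plus_fun_apply)
  then show ?thesis
    by (simp add: doubling_def Let_def) (simp add: full_group_cqg_def)
qed

lemma inl_swap_hom: "star_hom FG DS (inl_op \<circ> full_group_map G \<theta>)"
  and inr_swap_hom: "star_hom FG DS (inr_op \<circ> full_group_map G \<theta>)"
  using star_hom_comp[OF full_swap_hom inl_hom] star_hom_comp[OF full_swap_hom inr_hom]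
  by (simp_all add: o_def)

lemmas T_linear = linear_T[OF inl_hom inl_hom] linear_T[OF inr_hom inr_swap_hom]
  linear_T[OF inl_hom inr_hom] linear_T[OF inr_hom inl_swap_hom]

lemma dbl_l2: "g \<in> carrier G \<Longrightarrow> l2_matrix (dbl (g, x))"
  by (simp add: dbl_def inl_l2 inr_l2 U_l2)

lemma dbl_mult:
  "g \<in> carrier G \<Longrightarrow> h \<in> carrier G \<Longrightarrow>
    op_mult (dbl (g, x)) (dbl (h, y)) = (if x = y then dbl (g \<otimes> h, x) else 0)"
  by (auto simp: dbl_def inl_inr_mult U_mult simp flip: inl_mult inr_mult)

lemma dbl_adj: "g \<in> carrier G \<Longrightarrow> op_adj (dbl (g, x)) = dbl (inv g, x)"
  by (simp add: dbl_def U_adj flip: inl_adj inr_adj)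

lemma dbl_bounded:
  assumes g: "g \<in> carrier G"
  shows "bounded_op (dbl (g, x))"
  unfolding bounded_op_def
proof (rule exI, rule op_norm_le_partial_isometry[of _ "\<lambda>i. dbl (\<one>, x) i i = 1"])
  show "l2_matrix (dbl (g, x))" by (rule dbl_l2[OF g])
  fix i j
  \<comment> \<open>\<open>dbl (\<one>, x)\<close> is a coordinate projection, so its diagonal indicates its range\<close>
  show "op_mult (op_adj (dbl (g, x))) (dbl (g, x)) i j = of_bool (i = j \<and> dbl (\<one>, x) i i = 1)"
    using g by (cases i; cases j; cases x; simp add: dbl_adj dbl_mult; auto simp: dbl_def U_one)
qed

lemma dbl_span: "DS = l2op.span (dbl ` (carrier G \<times> UNIV))"
proof (rule equalityI)
  have "dbl ` (carrier G \<times> UNIV) \<subseteq> DS"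
    by (auto simp: dbl_def inl_in inr_in U_in)
  then show "l2op.span (dbl ` (carrier G \<times> UNIV)) \<subseteq> DS"
    by (rule l2op.span_minimal[OF _ DS_subspace])
  have base: "inl_op (U g) \<in> l2op.span (dbl ` (carrier G \<times> UNIV))"
    "inr_op (U g) \<in> l2op.span (dbl ` (carrier G \<times> UNIV))" if "g \<in> carrier G" for g
  proof -
    have "dbl (g, x) \<in> l2op.span (dbl ` (carrier G \<times> UNIV))" for x
      by (rule l2op.span_base) (use that in auto)
    from this[of True] this[of False]
    show "inl_op (U g) \<in> l2op.span (dbl ` (carrier G \<times> UNIV))"
      "inr_op (U g) \<in> l2op.span (dbl ` (carrier G \<times> UNIV))"
      by (simp_all add: dbl_def)
  qed
  have "inl_op a \<in> l2op.span (dbl ` (carrier G \<times> UNIV)) \<and>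
      inr_op a \<in> l2op.span (dbl ` (carrier G \<times> UNIV))" if "a \<in> FG" for a
    using that unfolding full_eq
  proof (induction rule: l2op.span_induct_alt)
    case (step c x y)
    then show ?case using base
      by (auto simp: inl_add inr_add inl_scale inr_scale l2op.span_add l2op.span_scale)
  qed (simp add: inl_zero inr_zero l2op.span_zero)
  then show "DS \<subseteq> l2op.span (dbl ` (carrier G \<times> UNIV))"
    by (auto simp: direct_sum_def intro!: l2op.span_add)
qed

lemma dbl_frame: "\<exists>q. entry_frame (carrier G \<times> UNIV) dbl q"
proof (rule exI)
  let ?q = "\<lambda>(g, x). if x then (Inl (fst (pos g)), Inl (snd (pos g)))
    else (Inr (fst (pos g)), Inr (snd (pos g)))"
  have "dbl k (fst (?q l)) (snd (?q l)) = of_bool (k = l)"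
    if "k \<in> carrier G \<times> UNIV" "l \<in> carrier G \<times> UNIV" for k l
    using that U_frame by (cases k; cases l) (auto simp: dbl_def entry_frame_def)
  then show "entry_frame (carrier G \<times> UNIV) dbl ?q"
    using finite_carrier by (auto simp: entry_frame_def dbl_l2)
qed

lemma doubling_doubled_group_algebra: "\<exists>q. doubled_group_algebra G s t \<theta> DG dbl q"
proof -
  obtain q where q: "entry_frame (carrier G \<times> UNIV) dbl q" using dbl_frame by blast
  have "doubled_group_algebra G s t \<theta> DG dbl q"
  proof unfold_locales
    show "entry_frame (carrier G \<times> UNIV) dbl q" by (rule q)
    show "alg DG = l2op.span (dbl ` (carrier G \<times> UNIV))" by (simp add: DG_alg dbl_span)
    show "comult DG (x + y) = comult DG x + comult DG y" if xy: "x \<in> alg DG" "y \<in> alg DG" for x y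
    proof -
      obtain a b c d where *: "x = inl_op a + inr_op b" "y = inl_op c + inr_op d"
        "a \<in> FG" "b \<in> FG" "c \<in> FG" "d \<in> FG"
        using xy by (auto simp: DG_alg direct_sum_def)
      have "x + y = inl_op (a + c) + inr_op (b + d)"
        by (simp add: * inl_add inr_add ac_simps)
      then have "comult DG (x + y) = comult DG (inl_op (a + c) + inr_op (b + d))" by simp
      also have "\<dots> = comult DG x + comult DG y"
        unfolding *(1,2) DG_comult by (simp only: T_linear *(3-6) ac_simps)
      finally show ?thesis .
    qed
    show "comult DG (op_scale z x) = op_scale z (comult DG x)" if x: "x \<in> alg DG" for z x
    proof -
      obtain a b where *: "x = inl_op a + inr_op b" "a \<in> FG" "b \<in> FG"
        using x by (auto simp: DG_alg direct_sum_def)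
      have "op_scale z x = inl_op (op_scale z a) + inr_op (op_scale z b)"
        by (simp add: * inl_scale inr_scale l2op.scale_right_distrib)
      then have "comult DG (op_scale z x)
          = comult DG (inl_op (op_scale z a) + inr_op (op_scale z b))" by simp
      also have "\<dots> = op_scale z (comult DG x)"
        unfolding *(1) DG_comult by (simp only: T_linear *(2,3) l2op.scale_right_distrib)
      finally show ?thesis .
    qed
    show "comult DG (dbl (g, x)) = (\<Sum>y\<in>UNIV. op_tensor (dbl (g, y)) (dbl (tw y g, x = y)))"
      if g: "g \<in> carrier G" for g x
    proof (cases x)
      case True
      have "dbl (g, True) = inl_op (U g) + inr_op 0" by (simp add: dbl_def inr_zero)
      then have "comult DG (dbl (g, x)) = comult DG (inl_op (U g) + inr_op 0)"
        using True by simp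
      also have "\<dots> = (\<Sum>y\<in>UNIV. op_tensor (dbl (g, y)) (dbl (tw y g, x = y)))"
        unfolding DG_comult by (simp add: T_linear g) (simp add: True sum_bool dbl_def tw_def full_swap_U g)
      finally show ?thesis .
    next
      case False
      have "dbl (g, False) = inl_op 0 + inr_op (U g)" by (simp add: dbl_def inl_zero)
      then have "comult DG (dbl (g, x)) = comult DG (inl_op 0 + inr_op (U g))"
        using False by simp
      also have "\<dots> = (\<Sum>y\<in>UNIV. op_tensor (dbl (g, y)) (dbl (tw y g, x = y)))"
        unfolding DG_comult by (simp add: T_linear g) (simp add: False sum_bool dbl_def tw_def full_swap_U g)
      finally show ?thesis .
    qed
  qed (simp_all add: dbl_bounded dbl_mult dbl_adj)
  then show ?thesis by blast
qed

end

section \<open>The dihedral group\<close>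

text \<open>
  The generators act on \<open>\<int> / n\<close> as the reflections \<open>x \<mapsto> -x\<close> and \<open>x \<mapsto> 1 - x\<close>, whose
  product is a translation by one. For \<open>n \<ge> 3\<close> this separates \<open>st\<close> from \<open>ts\<close>.
\<close>

fun reflect :: "dihedral_gen \<times> bool \<Rightarrow> int \<Rightarrow> int" where
  "reflect (Gen_s, _) x = - x"
| "reflect (Gen_t, _) x = 1 - x"

lemma reflect_reflect: "reflect (a, b) (reflect (a, c) x) = x"
  by (cases a) simp_all

lemma foldr_reflect_cong: "m dvd x - y \<Longrightarrow> m dvd foldr reflect u x - foldr reflect u y"
proof (induction u)
  case (Cons a u)
  moreover obtain g b where "a = (g, b)" by fastforce
  ultimately show ?case
    by (cases g) (simp_all add: dvd_diff_commute algebra_simps)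
qed simp

lemma foldr_reflect_rotation:
  "foldr reflect (concat (replicate k [(Gen_s, True), (Gen_t, True)])) x = x - int k"
  by (induction k) simp_all

text \<open>
  The letters act by involutions, which takes care of cancellation and of the relators
  \<open>s\<^sup>2\<close> and \<open>t\<^sup>2\<close>; and \<open>(st)\<^sup>n\<close> is the translation by \<open>-n\<close>.
\<close>

lemma foldr_reflect_word_equiv:
  "word_equiv (dihedral_relators n) u v \<Longrightarrow> int n dvd foldr reflect u x - foldr reflect v x"
proof (induction arbitrary: x rule: word_equiv.induct)
  case (sym u v)
  then show ?case by (simp add: dvd_diff_commute)
next
  case (trans u v w)
  then have "int n dvd (foldr reflect u x - foldr reflect v x) + (foldr reflect v x - foldr reflect w x)"
    by (intro dvd_add)
  then show ?case by simp
next
  case (cancel u a b v)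
  then show ?case by (simp add: reflect_reflect)
next
  case (relator r u v)
  then have "int n dvd foldr reflect r y - y" for y
    by (auto simp: dihedral_relators_def foldr_reflect_rotation)
  then show ?case by (simp add: foldr_reflect_cong)
qed simp

lemma letter_square: "word_equiv (dihedral_relators n) [(a, True), (a, True)] []"
  using word_equiv.relator[of "[(a, True), (a, True)]" "dihedral_relators n" "[]" "[]"]
  by (cases a) (simp_all add: dihedral_relators_def)

text \<open>
  Conjugation by \<open>s\<close> inverts \<open>st\<close>, so that every element is a power of \<open>st\<close>, possibly times \<open>s\<close>;
  and \<open>st\<close> has finite order. As exponents are natural numbers, the inverse of \<open>st\<close> is
  represented by its power \<open>n - 1\<close>.
\<close>

lemma (in group) finite_two_involutions:
  assumes st: "s \<in> carrier G" "t \<in> carrier G" and inv: "s \<otimes> s = \<one>" "t \<otimes> t = \<one>"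
    and ord: "(s \<otimes> t) [^] (n :: nat) = \<one>" "n > 0"
    and gen: "carrier G = generate G {s, t}"
  shows "finite (carrier G)"
proof -
  let ?r = "s \<otimes> t"
  define N where "N = {?r [^] k \<otimes> c | (k :: nat) c. c \<in> {\<one>, s}}"
  have r: "?r \<in> carrier G" using st by simp
  have inv_s: "inv s = s" and inv_t: "inv t = t" using st inv by (simp_all add: inv_equality)
  have t_eq: "t = s \<otimes> ?r" using st inv by (simp flip: m_assoc)
  have "?r [^] (n - 1) \<otimes> ?r = \<one>"
    using ord r by (metis Suc_diff_1 nat_pow_Suc)
  then have "?r [^] (n - 1) = inv ?r" using r by (metis inv_equality inv_inv nat_pow_closed)
  then have sr: "s \<otimes> ?r = ?r [^] (n - 1) \<otimes> s"
    using st inv inv_s inv_t t_eq by (simp add: inv_mult_group m_assoc)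
  have srk: "s \<otimes> ?r [^] k = ?r [^] ((n - 1) * k) \<otimes> s" for k :: nat
  proof (induction k)
    case (Suc k)
    have "s \<otimes> ?r [^] Suc k = (s \<otimes> ?r [^] k) \<otimes> ?r" using st r by (simp add: m_assoc)
    also have "\<dots> = ?r [^] ((n - 1) * k) \<otimes> (s \<otimes> ?r)"
      using st r by (simp only: Suc m_assoc nat_pow_closed m_closed)
    also have "\<dots> = ?r [^] ((n - 1) * k) \<otimes> ?r [^] (n - 1) \<otimes> s"
      using st r by (simp only: sr m_assoc nat_pow_closed m_closed)
    finally show ?case using r by (simp add: nat_pow_mult add.commute)
  qed (use st in simp)
  have s_N: "s \<otimes> x \<in> N" if x: "x \<in> N" for x
  proof -
    obtain k c where x: "x = ?r [^] (k :: nat) \<otimes> c" "c \<in> {\<one>, s}" using x by (auto simp: N_def)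
    have "s \<otimes> x = ?r [^] ((n - 1) * k) \<otimes> (s \<otimes> c)"
      using x st r by (auto simp: m_assoc[symmetric] srk)
    moreover have "s \<otimes> c \<in> {\<one>, s}" using x st inv by auto
    ultimately show ?thesis unfolding N_def by blast
  qed
  have r_N: "?r \<otimes> x \<in> N" if x: "x \<in> N" for x
  proof -
    obtain k c where x: "x = ?r [^] (k :: nat) \<otimes> c" "c \<in> {\<one>, s}" using x by (auto simp: N_def)
    have "?r \<otimes> x = ?r [^] Suc k \<otimes> c"
      using x st r nat_pow_Suc2[OF r, of k] by (auto simp: m_assoc[symmetric])
    then show ?thesis using x(2) unfolding N_def by blast
  qed
  have N_closed: "x \<in> carrier G" if "x \<in> N" for x using that st r by (auto simp: N_def)
  have t_N: "t \<otimes> x \<in> N" if x: "x \<in> N" for x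
  proof -
    have "t \<otimes> x = s \<otimes> (?r \<otimes> x)" using N_closed[OF x] st r t_eq by (metis m_assoc)
    then show ?thesis using s_N[OF r_N[OF x]] by simp
  qed
  have "\<forall>x\<in>N. g \<otimes> x \<in> N" if "g \<in> generate G {s, t}" for g
    using that
  proof (induction rule: generate.induct)
    case one
    then show ?case using N_closed by simp
  next
    case (incl h)
    then show ?case using s_N t_N by blast
  next
    case (inv h)
    then show ?case using s_N t_N inv_s inv_t by auto
  next
    case (eng g h)
    then have "g \<otimes> h \<otimes> x = g \<otimes> (h \<otimes> x)" if "x \<in> N" for x
      using N_closed[OF that] gen by (intro m_assoc) auto
    then show ?case using eng.IH by simp
  qed
  moreover have "\<one> \<in> N" unfolding N_def using st by (intro CollectI exI[of _ 0] exI[of _ \<one>]) simp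
  ultimately have "carrier G \<subseteq> N"
    using gen by (metis r_one subsetI)
  moreover have "N \<subseteq> (\<lambda>(k, c). ?r [^] k \<otimes> c) ` ({..<n} \<times> {\<one>, s})"
  proof
    fix x assume "x \<in> N"
    then obtain k c where x: "x = ?r [^] (k :: nat) \<otimes> c" "c \<in> {\<one>, s}" by (auto simp: N_def)
    have "?r [^] k = ?r [^] (n * (k div n)) \<otimes> ?r [^] (k mod n)"
      using r by (simp add: nat_pow_mult)
    also have "?r [^] (n * (k div n)) = \<one>"
      using r ord by (simp flip: nat_pow_pow)
    finally have "?r [^] k = ?r [^] (k mod n)" using r by simp
    then show "x \<in> (\<lambda>(k, c). ?r [^] k \<otimes> c) ` ({..<n} \<times> {\<one>, s})"
      using x ord(2) by (intro image_eqI[of _ _ "(k mod n, c)"]) auto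
  qed
  ultimately show ?thesis by (rule finite_subset[OF order_trans]) simp
qed

lemma dihedral_swapped_involutions:
  assumes n: "n \<ge> 3"
  shows "swapped_involutions (dihedral n) (dih_s n) (dih_t n) dihedral_swap"
proof -
  let ?G = "dihedral n" and ?R = "dihedral_relators n"
  let ?c = "\<lambda>u. word_rel ?R `` {u}"
  interpret group ?G unfolding dihedral_def by (rule group_presented_group)
  have mult: "?c u \<otimes>\<^bsub>?G\<^esub> ?c v = ?c (u @ v)" for u v
    unfolding dihedral_def by (rule presented_mult)
  have one: "\<one>\<^bsub>?G\<^esub> = ?c []" unfolding dihedral_def by (rule presented_one)
  have carr: "carrier ?G = range ?c" unfolding dihedral_def by (rule presented_carrier)
  have st: "dih_s n \<in> carrier ?G" "dih_t n \<in> carrier ?G"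
    by (simp_all add: carr dih_s_def dih_t_def)
  have sq: "dih_s n \<otimes>\<^bsub>?G\<^esub> dih_s n = \<one>\<^bsub>?G\<^esub>" "dih_t n \<otimes>\<^bsub>?G\<^esub> dih_t n = \<one>\<^bsub>?G\<^esub>"
    by (simp_all add: dih_s_def dih_t_def mult one word_class_eq_iff letter_square)
  have "\<not> int n dvd -2"
    using n zdvd_imp_le[of "int n" 2] by auto
  then have nc: "dih_s n \<otimes>\<^bsub>?G\<^esub> dih_t n \<noteq> dih_t n \<otimes>\<^bsub>?G\<^esub> dih_s n"
    using foldr_reflect_word_equiv[of n "[(Gen_s, True), (Gen_t, True)]" "[(Gen_t, True), (Gen_s, True)]" 0]
    by (auto simp: dih_s_def dih_t_def mult word_class_eq_iff)
  have letter: "?c [(a, b)] \<in> generate ?G {dih_s n, dih_t n}" for a b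
  proof (cases b)
    case True
    then show ?thesis
      by (cases a) (auto simp: dih_s_def dih_t_def intro!: generate.incl)
  next
    case False
    have "?c [(a, False)] \<otimes>\<^bsub>?G\<^esub> ?c [(a, True)] = \<one>\<^bsub>?G\<^esub>"
      using word_equiv.cancel[of ?R "[]" a False "[]"] by (simp add: mult one word_class_eq_iff)
    then have "?c [(a, False)] = inv\<^bsub>?G\<^esub> (?c [(a, True)])"
      by (rule inv_equality[symmetric]) (auto simp: carr)
    then show ?thesis
      using False by (cases a) (auto simp: dih_s_def dih_t_def intro!: generate.inv)
  qed
  have "?c u \<in> generate ?G {dih_s n, dih_t n}" for u
  proof (induction u)
    case Nil
    show ?case unfolding one[symmetric] by (rule generate.one)
  next
    case (Cons a u)
    have "?c (a # u) = ?c [a] \<otimes>\<^bsub>?G\<^esub> ?c u" by (simp add: mult)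
    then show ?case using Cons letter[of "fst a" "snd a"] by (simp add: generate.eng)
  qed
  then have gen: "carrier ?G = generate ?G {dih_s n, dih_t n}"
    using generate_incl[of "{dih_s n, dih_t n}"] st by (auto simp: carr)
  have "(dih_s n \<otimes>\<^bsub>?G\<^esub> dih_t n) [^]\<^bsub>?G\<^esub> k = ?c (concat (replicate k [(Gen_s, True), (Gen_t, True)]))"
    for k :: nat
  proof (induction k)
    case (Suc k)
    have "concat (replicate k [(Gen_s, True), (Gen_t, True)]) @ [(Gen_s, True), (Gen_t, True)]
        = concat (replicate (Suc k) [(Gen_s, True), (Gen_t, True)])"
      by (induction k) auto
    then show ?case using Suc by (simp add: dih_s_def dih_t_def mult)
  qed (simp add: one)
  moreover have "word_equiv ?R (concat (replicate n [(Gen_s, True), (Gen_t, True)])) []"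
    using word_equiv.relator[of _ ?R "[]" "[]"] by (simp add: dihedral_relators_def)
  ultimately have "(dih_s n \<otimes>\<^bsub>?G\<^esub> dih_t n) [^]\<^bsub>?G\<^esub> n = \<one>\<^bsub>?G\<^esub>"
    by (simp add: one word_class_eq_iff)
  then have "finite (carrier ?G)"
    using finite_two_involutions[OF st sq _ _ gen] n by simp
  then show ?thesis
    using st sq nc gen dihedral_swap_iso[of n] dihedral_swap_s[of n] dihedral_swap_t[of n]
    by unfold_locales (auto simp: iso_def)
qed

theorem theorem5p1:
  fixes n :: nat
  assumes "n \<ge> 3"
    and "infinite (UNIV :: 'i set)"
  shows "(\<exists>(Q :: 'i cqg) \<alpha>. quantum_isometry_group (dihedral n) {dih_s n, dih_t n} Q \<alpha>) \<and>
    (\<forall>(Q :: 'i cqg) \<alpha>. quantum_isometry_group (dihedral n) {dih_s n, dih_t n} Q \<alpha> \<longrightarrow>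
       cqg_isomorphic Q
         (doubling (full_group_cqg (dihedral n)) (full_group_map (dihedral n) dihedral_swap)))"
proof -
  interpret swapped_involutions "dihedral n" "dih_s n" "dih_t n" dihedral_swap
    using assms(1) by (rule dihedral_swapped_involutions)
  obtain Q0 :: "'i cqg" and u0 p0
    where Q0: "doubled_group_algebra (dihedral n) (dih_s n) (dih_t n) dihedral_swap Q0 u0 p0"
    using ex_doubled_group_algebra[OF assms(2)] by blast
  obtain q where "doubled_group_algebra (dihedral n) (dih_s n) (dih_t n) dihedral_swap DG dbl q"
    using doubling_doubled_group_algebra by blast
  then have "cqg_isomorphic Q DG"
    if "quantum_isometry_group (dihedral n) {dih_s n, dih_t n} Q \<alpha>" for Q :: "'i cqg" and \<alpha>
    by (rule universal_isomorphic[OF that Q0])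
  then show ?thesis
    using doubled_group_algebra.quantum_isometry_group[OF Q0] by blast
qed

end
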